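(* Let $N\ge1$, $m>0$, $\kappa>0$, $\mathcal V=(\nu_i)\in\mathbb R^N$, and let $(\Theta,\Omega)$ be the global solution of the inertial Kuramoto model with initial data $(\Theta^0,\Omega^0)$. Let $\lambda,\ell$ be reals with $\frac12<\lambda\le1$ and $\ell\in(0,2\cos^{-1}(\frac1\lambda-1))$, let $\eta>0$, and let $\mathcal A\subset[N]$ satisfy $|\mathcal A|\ge\lambda N$, $$\xi(m,\kappa,\mathcal V_{\mathcal A},\Omega^0_{\mathcal A},\eta)<\frac\lambda2\sin\ell-(1-\lambda)\sin\frac\ell2,$$ and $$\mathcal D(\Theta^0_{\mathcal A})\le\ell-m(1-e^{-\eta})\mathcal D(\Omega^0_{\mathcal A})-(\eta m-m+me^{-\eta})(\mathcal D(\mathcal V_{\mathcal A})+2\kappa).$$ Write $\delta_{\mathcal C}=2m\mathcal D(\mathcal V_{\mathcal C})+4m\kappa+\frac{\mathcal D(\mathcal V_{\mathcal C})}{\kappa}$ for $\mathcal C\subset[N]$. Then: (1) $\sup_{t\ge\eta m}\mathcal D(\Theta_{\mathcal A}(t))\le\ell$ and $\limsup_{t\to\infty}\mathcal D(\Theta_{\mathcal A}(t))\le\phi_1(\lambda,\delta_{\mathcal A})<\frac{3\pi}{4(2\lambda-1)}\delta_{\mathcal A}$. (2) If in addition $\delta_{\mathcal A}<\frac{(2\lambda-1)^{3/2}}{\sqrt{2\lambda}}\frac{2-\lambda}{\sqrt{\lambda/2}+(1-\lambda)}$, then for $i,j\in\mathcal A$ with $\nu_i\ge\nu_j$, with $\phi_1=\phi_1(\lambda,\delta_{\mathcal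 A})$, $$\frac{\nu_i-\nu_j}{\kappa}\le\liminf_{t\to\infty}[\theta_i(t)-\theta_j(t)]\le\limsup_{t\to\infty}[\theta_i(t)-\theta_j(t)]\le\frac{\phi_1}{2\sin(\phi_1/2)(\lambda\cos\phi_1-(1-\lambda))}\,\frac{\nu_i-\nu_j}{\kappa}.$$ If in addition $\mathcal B\subset[N]$ satisfies $\mathcal B\supset\mathcal A$ and $m\mathcal D(\mathcal V_{\mathcal B})+2m\kappa+\frac{\mathcal D(\mathcal V_{\mathcal B})}{2\kappa}<\frac\lambda2\sin\ell-(1-\lambda)\sin\frac\ell2$, then: (3) $\sup_{t\ge0}\mathcal D(\Theta_{\mathcal B}(t))<\infty$; in particular, if $\mathcal B=[N]$, then asymptotic phase-locking occurs. (4) There is a unique index set $\mathcal A_{\max}$ with $\mathcal A\subset\mathcal A_{\max}\subset\mathcal B$ having properties (a) and (b): (a) After replacing $\theta_i$ by $\theta_i-2k_i\pi$ for suitable integers $k_i$, $i\in\mathcal A_{\max}\setminus\mathcal A$, one has $\limsup_{t\to\infty}\mathcal D(\Theta_{\mathcal A_{\max}}(t))\le\phi_1(\lambda,\delta_{\mathcal B})$. (b) If $\mathcal A_{\max}\subsetneq\mathcal B$, then (with the translated phases of (a)) $$\liminf_{t\to\infty}\min_{i\in\mathcal B\setminus\mathcal A_{\max},\,k\in\mathbb Z}\mathcal D\big(\Theta_{\mathcal A_{\max}}(t)\cup\{\theta_i(t)-2\pi k\}\big)\ge\phi_2(\lambda,\delta_{\mathcal B}),$$ $$\liminf_{t\to\infty}\min_{i\in\mathcal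 B\setminus\mathcal A_{\max},\,j\in\mathcal A_{\max},\,k\in\mathbb Z}|\theta_i(t)-2\pi k-\theta_j(t)|\ge\phi_2(\lambda,\delta_{\mathcal B})-\phi_1(\lambda,\delta_{\mathcal B}).$$ Moreover: (c) if in addition $\delta_{\mathcal B}<\frac{(2\lambda-1)^{3/2}}{\sqrt{2\lambda}}\frac{2-\lambda}{\sqrt{\lambda/2}+(1-\lambda)}$, then, after suitable $2\pi$-translations, for $i,j\in\mathcal A_{\max}$ with $\nu_i\ge\nu_j$, with $\phi_1=\phi_1(\lambda,\delta_{\mathcal B})$, $$\frac{\nu_i-\nu_j}{\kappa}\le\liminf_{t\to\infty}[\theta_i(t)-\theta_j(t)]\le\limsup_{t\to\infty}[\theta_i(t)-\theta_j(t)]\le\frac{\phi_1}{2\sin(\phi_1/2)(\lambda\cos\phi_1-(1-\lambda))}\,\frac{\nu_i-\nu_j}{\kappa}.$$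
   Context: $[N]=\{1,\dots,N\}$. The inertial Kuramoto model is the Cauchy problem $$m\ddot\theta_i+\dot\theta_i=\nu_i+\frac\kappa N\sum_{j=1}^N\sin(\theta_j-\theta_i),\quad t>0,\qquad(\theta_i,\dot\theta_i)(0)=(\theta_i^0,\omega_i^0),\quad i\in[N],$$ with real-valued unknowns $\theta_i$ on $[0,\infty)$; it has a unique global solution. $\Theta=(\theta_i)$, $\Omega=\dot\Theta$, $\Theta^0=(\theta_i^0)$, $\Omega^0=(\omega_i^0)$. For $X\in\mathbb R^N$ and $\mathcal C\subset[N]$, $X_{\mathcal C}=(x_i)_{i\in\mathcal C}$. For a finite family of reals $X$, $\mathcal D(X)$ is the maximum of $|x-x'|$ over its members (so $\mathcal D(\Theta_{\mathcal C}\cup\{a\})$ is the diameter of the family $\theta_i$, $i\in\mathcal C$, together with $a$). Asymptotic phase-locking means that $\lim_{t\to\infty}(\theta_i(t)-\theta_j(t))$ exists for all $i,j\in[N]$. For $\mathcal C\subset[N]$ and $\eta>0$, $$\xi(m,\kappa,\mathcal V_{\mathcal C},\Omega^0_{\mathcal C},\eta)=m\mathcal D(\mathcal V_{\mathcal C})+2m\kappa+\frac{\mathcal D(\mathcal V_{\mathcal C})}{2\kappa}+\mathcal D(\Omega^0_{\mathcal C})m\max\{1,\eta\}e^{-\max\{1,\eta\}}+\frac{\mathcal D(\Omega^0_{\mathcal C})}{2\kappa}\frac{e^{-\eta}}{1-e^{-\eta}}.$$ For $\lambda\in(1/2,1]$ let $f_\lambda(\theta)=\lambda\sin\theta-2(1-\lambda)\sin\frac\theta2$.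 On $(0,2\cos^{-1}\frac{1-\lambda}{\lambda})$ it is positive and strictly concave and vanishes at both endpoints. For $0<\delta<\max_{(0,2\cos^{-1}\frac{1-\lambda}{\lambda})}f_\lambda$, let $\phi_1(\lambda,\delta)<\phi_2(\lambda,\delta)$ denote the two roots of $f_\lambda(\theta)=\delta$ in $(0,2\cos^{-1}\frac{1-\lambda}{\lambda})$. *)

theory Defs
  imports "HOL-Analysis.Analysis"
begin

(* The index set [N] is {1..N}; families (x_i) are functions on nat of which only the values
   on [N] are used, and the phases are theta i t with index i and time t.

   Limits superior and inferior, suprema and infima of time-dependent real quantities are taken
   in ereal, so that the inequalities between them include the relevant finiteness claims. *)

(* The equation is required for t > 0; at t = 0 the derivative is one-sided and the velocities
   attain the initial data continuously. *)
definition kuramoto_solution ::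
  "nat \<Rightarrow> real \<Rightarrow> real \<Rightarrow> (nat \<Rightarrow> real) \<Rightarrow> (nat \<Rightarrow> real) \<Rightarrow> (nat \<Rightarrow> real) \<Rightarrow>
   (nat \<Rightarrow> real \<Rightarrow> real) \<Rightarrow> (nat \<Rightarrow> real \<Rightarrow> real) \<Rightarrow> bool"
where
  "kuramoto_solution N m \<kappa> \<nu> \<theta>0 \<omega>0 \<theta> \<omega> \<longleftrightarrow>
     (\<forall>i\<in>{1..N}.
        \<theta> i 0 = \<theta>0 i \<and> \<omega> i 0 = \<omega>0 i \<and>
        continuous_on {0..} (\<omega> i) \<and>
        (\<forall>t\<ge>0. (\<theta> i has_real_derivative \<omega> i t) (at t within {0..})) \<and>
        (\<forall>t>0. \<exists>a. (\<omega> i has_real_derivative a) (at t) \<and>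
           m * a + \<omega> i t = \<nu> i + \<kappa> / real N * (\<Sum>j=1..N. sin (\<theta> j t - \<theta> i t))))"

definition asymptotic_phase_locking :: "nat \<Rightarrow> (nat \<Rightarrow> real \<Rightarrow> real) \<Rightarrow> bool" where
  "asymptotic_phase_locking N \<theta> \<longleftrightarrow>
     (\<forall>i\<in>{1..N}. \<forall>j\<in>{1..N}. \<exists>L. ((\<lambda>t. \<theta> i t - \<theta> j t) \<longlongrightarrow> L) at_top)"

(* The library's diameter of the finite set of values is the maximum of the mutual distances. *)
abbreviation fam_diam :: "nat set \<Rightarrow> (nat \<Rightarrow> real) \<Rightarrow> real" where
  "fam_diam C x \<equiv> diameter (x ` C)"

definition xi ::
  "real \<Rightarrow> real \<Rightarrow> (nat \<Rightarrow> real) \<Rightarrow> (nat \<Rightarrow> real) \<Rightarrow> nat set \<Rightarrow> real \<Rightarrow> real" where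
  "xi m \<kappa> \<nu> \<omega>0 C \<eta> =
     m * fam_diam C \<nu> + 2 * m * \<kappa> + fam_diam C \<nu> / (2 * \<kappa>)
     + fam_diam C \<omega>0 * m * max 1 \<eta> * exp (- max 1 \<eta>)
     + fam_diam C \<omega>0 / (2 * \<kappa>) * (exp (- \<eta>) / (1 - exp (- \<eta>)))"

definition delta :: "real \<Rightarrow> real \<Rightarrow> (nat \<Rightarrow> real) \<Rightarrow> nat set \<Rightarrow> real" where
  "delta m \<kappa> \<nu> C = 2 * m * fam_diam C \<nu> + 4 * m * \<kappa> + fam_diam C \<nu> / \<kappa>"

definition f_lam :: "real \<Rightarrow> real \<Rightarrow> real" where
  "f_lam lam x = lam * sin x - 2 * (1 - lam) * sin (x / 2)"

definition f_roots :: "real \<Rightarrow> real \<Rightarrow> real set" where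
  "f_roots lam d = {x. 0 < x \<and> x < 2 * arccos ((1 - lam) / lam) \<and> f_lam lam x = d}"

(* Meaningful when there are exactly two roots: 1/2 < lam <= 1 and 0 < d < max f_lam. *)
definition phi1 :: "real \<Rightarrow> real \<Rightarrow> real" where
  "phi1 lam d = (THE a. \<exists>b. a < b \<and> f_roots lam d = {a, b})"

definition phi2 :: "real \<Rightarrow> real \<Rightarrow> real" where
  "phi2 lam d = (THE b. \<exists>a. a < b \<and> f_roots lam d = {a, b})"

definition delta_threshold :: "real \<Rightarrow> real" where
  "delta_threshold lam =
     (2 * lam - 1) powr (3 / 2) / sqrt (2 * lam) * ((2 - lam) / (sqrt (lam / 2) + (1 - lam)))"

definition phase_difference_bounds ::
  "real \<Rightarrow> real \<Rightarrow> (nat \<Rightarrow> real) \<Rightarrow> real \<Rightarrow> nat set \<Rightarrow> (nat \<Rightarrow> real \<Rightarrow> real) \<Rightarrow> bool" where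
  "phase_difference_bounds lam \<kappa> \<nu> \<phi> C \<theta> \<longleftrightarrow>
     (\<forall>i\<in>C. \<forall>j\<in>C. \<nu> i \<ge> \<nu> j \<longrightarrow>
        ereal ((\<nu> i - \<nu> j) / \<kappa>) \<le> Liminf at_top (\<lambda>t. ereal (\<theta> i t - \<theta> j t)) \<and>
        Liminf at_top (\<lambda>t. ereal (\<theta> i t - \<theta> j t)) \<le> Limsup at_top (\<lambda>t. ereal (\<theta> i t - \<theta> j t)) \<and>
        Limsup at_top (\<lambda>t. ereal (\<theta> i t - \<theta> j t)) \<le>
          ereal (\<phi> / (2 * sin (\<phi> / 2) * (lam * cos \<phi> - (1 - lam))) * ((\<nu> i - \<nu> j) / \<kappa>)))"

definition translate :: "(nat \<Rightarrow> int) \<Rightarrow> (nat \<Rightarrow> real \<Rightarrow> real) \<Rightarrow> nat \<Rightarrow> real \<Rightarrow> real" where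
  "translate k \<theta> i t = \<theta> i t - 2 * real_of_int (k i) * pi"

definition ensemble_concentrates ::
  "real \<Rightarrow> real \<Rightarrow> nat set \<Rightarrow> (nat \<Rightarrow> real \<Rightarrow> real) \<Rightarrow> bool" where
  "ensemble_concentrates lam d C \<theta> \<longleftrightarrow>
     Limsup at_top (\<lambda>t. ereal (fam_diam C (\<lambda>i. \<theta> i t))) \<le> ereal (phi1 lam d)"

(* The infima over the integers k are attained, i.e. they are minima. *)
definition ensemble_separated ::
  "real \<Rightarrow> real \<Rightarrow> nat set \<Rightarrow> nat set \<Rightarrow> (nat \<Rightarrow> real \<Rightarrow> real) \<Rightarrow> bool" where
  "ensemble_separated lam d B C \<theta> \<longleftrightarrow>
     Liminf at_top (\<lambda>t. INF (i, k)\<in>(B - C) \<times> (UNIV :: int set).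
         ereal (diameter (insert (\<theta> i t - 2 * pi * real_of_int k) ((\<lambda>j. \<theta> j t) ` C))))
       \<ge> ereal (phi2 lam d) \<and>
     Liminf at_top (\<lambda>t. INF (i, j, k)\<in>(B - C) \<times> C \<times> (UNIV :: int set).
         ereal \<bar>\<theta> i t - 2 * pi * real_of_int k - \<theta> j t\<bar>)
       \<ge> ereal (phi2 lam d - phi1 lam d)"

(* C plays the role of A_max, with the phases in C - A (and no others) translated by 2 pi k_i. *)
definition maximal_ensemble ::
  "real \<Rightarrow> real \<Rightarrow> nat set \<Rightarrow> nat set \<Rightarrow> (nat \<Rightarrow> real \<Rightarrow> real) \<Rightarrow> nat set \<Rightarrow> (nat \<Rightarrow> int) \<Rightarrow> bool" where
  "maximal_ensemble lam d A B \<theta> C k \<longleftrightarrow>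
     (\<forall>i. i \<notin> C - A \<longrightarrow> k i = 0) \<and>
     ensemble_concentrates lam d C (translate k \<theta>) \<and>
     (C \<noteq> B \<longrightarrow> ensemble_separated lam d B C (translate k \<theta>))"

end

theory Submission
  imports Defs "HOL-Complex_Analysis.Complex_Analysis"
begin

text \<open>The key is that, up to a controlled error, the relative phases of the inertial model obey a
  differential inequality of first order.  Write the relative velocity of two oscillators by
  variation of constants as an exponentially weighted average of past relative forces.  Relative
  velocities are bounded a priori, so that the past forces can be replaced by the present one at
  the cost of a lag error of order \<^term>\<open>m\<close> (lemma \<open>first_order_velocity_estimate\<close>).
  For the two extremal members of a cluster that contains the fraction \<^term>\<open>lam\<close> of all
  oscillators and has diameter \<^term>\<open>D\<close>, this says that \<^term>\<open>D\<close> shrinks at least at the rate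
  \<open>\<kappa> (f_lam lam D - \<delta>)\<close>, up to a transient that dies out.  So the diameter is trapped below
  \<open>\<phi>\<^sub>1\<close> as soon as it is, at a late time, below \<open>\<phi>\<^sub>2\<close>; the hypotheses on the initial data put
  \<^term>\<open>A\<close> into this situation.

  Once the cluster is concentrated, the force between two of its members is their distance times a
  coefficient that lies in a fixed interval.  The distance is then an overdamped oscillator with
  variable stiffness, because \<^prop>\<open>4 * m * \<kappa> < 1\<close>, and the bounds for its limits follow from the
  positivity of the response of overdamped oscillators.

  An oscillator of \<^term>\<open>B\<close> that meets \<^term>\<open>A\<close> modulo full turns at a late time is trapped
  together with \<^term>\<open>A\<close>; one that never does stays between two consecutive translates
  of \<^term>\<open>A\<close>.  Hence relative phases in \<^term>\<open>B\<close> are bounded.  The maximal ensemble is a largest subset of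
  \<^term>\<open>B\<close> that concentrates after translation: outsiders stay at a distance from it since
  otherwise they would be trapped as well, and it is unique since the union of two concentrating
  sets concentrates (lemma \<open>union_concentrates\<close>).

  For phase locking, energy dissipation forces velocities and accelerations to zero, so the
  solution approaches the set of equilibria.  Its order parameter stays away from zero, and up to
  signs an equilibrium is determined by the modulus of the order parameter, which satisfies one of
  finitely many analytic self-consistency equations.  These have isolated solutions, hence the modulus
  converges (lemma \<open>self_consistent_convergence\<close>) and with it all relative phases.\<close>

section \<open>Diameters of finite families\<close>

lemma diff_le_fam_diam:
  assumes "finite C" "i \<in> C" "j \<in> C"
  shows "x i - x j \<le> fam_diam C x"
proof -
  have "bounded (x ` C)" using assms(1) by (simp add: finite_imp_bounded)
  from diameter_bounded_bound[OF this, of "x i" "x j"] assms show ?thesis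
    by (auto simp: dist_real_def)
qed

lemma fam_diam_le_iff:
  assumes "finite C" "C \<noteq> {}"
  shows "fam_diam C x \<le> c \<longleftrightarrow> (\<forall>i\<in>C. \<forall>j\<in>C. x i - x j \<le> c)"
proof
  assume "fam_diam C x \<le> c"
  then show "\<forall>i\<in>C. \<forall>j\<in>C. x i - x j \<le> c"
    using diff_le_fam_diam[OF assms(1)] by (meson order_trans)
next
  assume *: "\<forall>i\<in>C. \<forall>j\<in>C. x i - x j \<le> c"
  show "fam_diam C x \<le> c"
  proof (rule diameter_le)
    show "x ` C \<noteq> {} \<or> 0 \<le> c" using assms by simp
    fix u v assume "u \<in> x ` C" "v \<in> x ` C"
    then obtain i j where ij: "i \<in> C" "j \<in> C" "u = x i" "v = x j" by blast
    then have "x i - x j \<le> c" "x j - x i \<le> c" using * by auto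
    then show "norm (u - v) \<le> c" using ij by (simp add: abs_le_iff)
  qed
qed

lemma fam_diam_nonneg: "finite C \<Longrightarrow> 0 \<le> fam_diam C x"
  by (simp add: diameter_ge_0 finite_imp_bounded)

lemma fam_diam_attained:
  assumes "finite C" "C \<noteq> {}"
  obtains i j where "i \<in> C" "j \<in> C" "x i - x j = fam_diam C x"
proof -
  have "compact (x ` C)" using assms(1) by (simp add: finite_imp_compact)
  from diameter_compact_attained[OF this] assms(2)
  obtain i j where ij: "i \<in> C" "j \<in> C" "dist (x i) (x j) = fam_diam C x" by auto
  then have "x i - x j = fam_diam C x \<or> x j - x i = fam_diam C x"
    by (auto simp: dist_real_def abs_if split: if_splits)
  then show ?thesis using ij that by blast
qed

lemma Limsup_ereal_le_iff:
  fixes f :: "real \<Rightarrow> real"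
  shows "Limsup at_top (\<lambda>t. ereal (f t)) \<le> ereal c \<longleftrightarrow>
    (\<forall>a>c. eventually (\<lambda>t. f t \<le> a) at_top)"
proof
  assume L: "Limsup at_top (\<lambda>t. ereal (f t)) \<le> ereal c"
  show "\<forall>a>c. eventually (\<lambda>t. f t \<le> a) at_top"
  proof (intro allI impI)
    fix a assume "a > c"
    then have "ereal c < ereal a" by simp
    then have "eventually (\<lambda>t. ereal (f t) < ereal a) at_top"
      using L unfolding Limsup_le_iff by blast
    then show "eventually (\<lambda>t. f t \<le> a) at_top" by eventually_elim simp
  qed
next
  assume R: "\<forall>a>c. eventually (\<lambda>t. f t \<le> a) at_top"
  show "Limsup at_top (\<lambda>t. ereal (f t)) \<le> ereal c"
  proof (rule ereal_le_epsilon2)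
    fix e :: real assume "e > 0"
    then have "eventually (\<lambda>t. f t \<le> c + e) at_top" using R by simp
    then show "Limsup at_top (\<lambda>t. ereal (f t)) \<le> ereal c + ereal e"
      by (intro Limsup_bounded) (auto elim: eventually_mono)
  qed
qed

lemma Liminf_ereal_geI:
  fixes f :: "real \<Rightarrow> ereal"
  assumes "\<And>a. a < c \<Longrightarrow> eventually (\<lambda>t. ereal a \<le> f t) at_top"
  shows "ereal c \<le> Liminf at_top f"
proof (subst le_Liminf_iff, intro allI impI)
  fix y assume "y < ereal c"
  then obtain a where a: "y < ereal a" "ereal a < ereal c" using ereal_dense2 by blast
  then have "a < c" by simp
  show "\<forall>\<^sub>F t in at_top. y < f t"
    using assms[OF \<open>a < c\<close>] by eventually_elim (rule less_le_trans[OF a(1)])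
qed


section \<open>Real functions on a half line\<close>

text \<open>Just after a time at which all members of the family are still non-positive, each member
  is negative: a member that vanishes has negative derivative, the others stay negative by
  continuity.  So there is no first time at which some member becomes positive.\<close>

lemma finite_family_barrier:
  fixes g g' :: "'p \<Rightarrow> real \<Rightarrow> real"
  assumes fin: "finite P"
    and der: "\<And>p t. p \<in> P \<Longrightarrow> T \<le> t \<Longrightarrow> t \<le> S \<Longrightarrow> (g p has_real_derivative g' p t) (at t)"
    and start: "\<And>p. p \<in> P \<Longrightarrow> g p T \<le> 0"
    and barrier: "\<And>p t. p \<in> P \<Longrightarrow> T \<le> t \<Longrightarrow> t < S \<Longrightarrow> g p t = 0 \<Longrightarrow> (\<forall>q\<in>P. g q t \<le> 0) \<Longrightarrow> g' p t < 0"
    and p: "p \<in> P" and t: "T \<le> t" "t \<le> S"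
  shows "g p t \<le> 0"
proof (rule ccontr)
  assume "\<not> g p t \<le> 0"
  define X where "X = {s \<in> {T..S}. \<exists>q\<in>P. g q s > 0}"
  have tX: "t \<in> X" using \<open>\<not> g p t \<le> 0\<close> p t by (auto simp: X_def intro!: bexI[of _ p])
  have bdd: "bdd_below X" by (auto simp: X_def bdd_below_def)
  define s where "s = Inf X"
  have sT: "T \<le> s" unfolding s_def using tX by (intro cInf_greatest) (auto simp: X_def)
  have st: "s \<le> t" unfolding s_def using tX bdd by (rule cInf_lower)
  have before: "g q r \<le> 0" if "q \<in> P" "T \<le> r" "r < s" for q r
  proof (rule ccontr)
    assume "\<not> g q r \<le> 0"
    then have "r \<in> X" using that st t by (auto simp: X_def intro!: bexI[of _ q])
    then have "s \<le> r" unfolding s_def using bdd by (intro cInf_lower) auto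
    then show False using that by simp
  qed
  have at_s: "g q s \<le> 0" if q: "q \<in> P" for q
  proof (cases "s = T")
    case True then show ?thesis using start q by simp
  next
    case False
    then have "T < s" using sT by simp
    have "isCont (g q) s" using der[OF q sT] st t by (intro DERIV_isCont) auto
    then have "(g q \<longlongrightarrow> g q s) (at_left s)"
      by (simp add: isCont_def filterlim_at_split)
    moreover have "\<forall>\<^sub>F r in at_left s. g q r \<le> 0"
      using eventually_at_left_real[OF \<open>T < s\<close>] by eventually_elim (use before q in auto)
    ultimately show ?thesis by (intro tendsto_upperbound) auto
  qed
  have "s < t" using at_s[OF p] \<open>\<not> g p t \<le> 0\<close> st by (cases "s = t") auto
  have after: "\<forall>\<^sub>F r in at_right s. g q r < 0" if q: "q \<in> P" for q
  proof (cases "g q s = 0")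
    case True
    have "g' q s < 0" using barrier[OF q sT _ True] at_s \<open>s < t\<close> t by auto
    moreover have "(g q has_real_derivative g' q s) (at s)" using der[OF q sT] st t by simp
    ultimately obtain d where d: "d > 0" "\<And>h. 0 < h \<Longrightarrow> h < d \<Longrightarrow> g q (s + h) < g q s"
      using DERIV_neg_dec_right by blast
    have "\<forall>\<^sub>F r in at_right s. r \<in> {s<..<s + d}" using d(1) by (intro eventually_at_right_real) simp
    then show ?thesis
      by eventually_elim (use d(2)[of "r - s" for r] True in \<open>auto simp: algebra_simps\<close>)
  next
    case False
    then have neg: "g q s < 0" using at_s[OF q] by simp
    have "isCont (g q) s" using der[OF q sT] st t by (intro DERIV_isCont) auto
    then have "(g q \<longlongrightarrow> g q s) (at_right s)"
      by (simp add: isCont_def filterlim_at_split)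
    then show ?thesis using neg by (rule order_tendstoD)
  qed
  have "\<forall>\<^sub>F r in at_right s. \<forall>q\<in>P. g q r < 0" using fin after by (simp add: eventually_ball_finite)
  then obtain b where b: "b > s" "\<And>r. s < r \<Longrightarrow> r < b \<Longrightarrow> \<forall>q\<in>P. g q r < 0"
    by (auto simp: eventually_at_right_field)
  have "Inf X < b" using b(1) by (simp add: s_def)
  then obtain r where r: "r \<in> X" "r < b" using cInf_lessD[of X b] tX by blast
  have "s \<le> r" unfolding s_def using r bdd by (intro cInf_lower) auto
  then have "\<forall>q\<in>P. g q r \<le> 0" using b(2)[of r] r at_s by (cases "s = r") force+
  then show False using r(1) unfolding X_def by force
qed

text \<open>A continuous function that comes ever closer to a uniformly discrete set cannot change
  over from one point of that set to another, since on the way it would be far from all.\<close>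

lemma tendsto_of_approaching_discrete_set:
  fixes g :: "real \<Rightarrow> real"
  assumes cont: "continuous_on {T..} g"
    and d: "d > 0" "\<And>x y. x \<in> S \<Longrightarrow> y \<in> S \<Longrightarrow> x \<noteq> y \<Longrightarrow> d \<le> \<bar>x - y\<bar>"
    and near: "\<And>\<epsilon>. \<epsilon> > 0 \<Longrightarrow> \<forall>\<^sub>F t in at_top. \<exists>x\<in>S. \<bar>g t - x\<bar> < \<epsilon>"
  shows "\<exists>L\<in>S. (g \<longlongrightarrow> L) at_top"
proof -
  obtain T0 where T0: "\<And>t. t \<ge> T0 \<Longrightarrow> \<exists>x\<in>S. \<bar>g t - x\<bar> < d/3"
    using near[of "d/3"] d(1) by (auto simp: eventually_at_top_linorder)
  define T1 where "T1 = max T T0"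
  obtain x where x: "x \<in> S" "\<bar>g T1 - x\<bar> < d/3" using T0[of T1] by (auto simp: T1_def)
  have stay: "\<bar>g t - x\<bar> < d/3" if "t \<ge> T1" for t
  proof (rule ccontr)
    assume "\<not> \<bar>g t - x\<bar> < d/3"
    have "continuous_on {T1..t} (\<lambda>t. \<bar>g t - x\<bar>)"
      by (intro continuous_intros continuous_on_subset[OF cont]) (auto simp: T1_def)
    then have "\<exists>s. T1 \<le> s \<and> s \<le> t \<and> \<bar>g s - x\<bar> = d/3"
      using x(2) \<open>\<not> \<bar>g t - x\<bar> < d/3\<close> that by (intro IVT') auto
    then obtain s where s: "T1 \<le> s" "\<bar>g s - x\<bar> = d/3" by blast
    obtain y where y: "y \<in> S" "\<bar>g s - y\<bar> < d/3" using T0[of s] s by (auto simp: T1_def)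
    then have "x \<noteq> y" using s(2) by auto
    then have "d \<le> \<bar>x - y\<bar>" using d(2) x(1) y(1) by blast
    then show False using s(2) y(2) d(1) by linarith
  qed
  have "(g \<longlongrightarrow> x) at_top"
  proof (rule tendstoI)
    fix e :: real assume "e > 0"
    then have "\<forall>\<^sub>F t in at_top. \<exists>y\<in>S. \<bar>g t - y\<bar> < min e (d/3)" using d(1) by (intro near) simp
    with eventually_ge_at_top[of T1] show "\<forall>\<^sub>F t in at_top. dist (g t) x < e"
    proof eventually_elim
      case (elim t)
      then obtain y where y: "y \<in> S" "\<bar>g t - y\<bar> < min e (d/3)" by blast
      have "x = y"
      proof (rule ccontr)
        assume "x \<noteq> y"
        then have "d \<le> \<bar>x - y\<bar>" using d(2) x(1) y(1) by blast
        then show False using stay[OF elim(1)] y(2) d(1) by linarith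
      qed
      then show ?case using y by (simp add: dist_real_def)
    qed
  qed
  then show ?thesis using x(1) by blast
qed

lemma tendsto_of_cos_sin_tendsto:
  fixes g :: "real \<Rightarrow> real"
  assumes cont: "continuous_on {T..} g"
    and C: "((\<lambda>t. cos (g t)) \<longlongrightarrow> c) at_top" and S: "((\<lambda>t. sin (g t)) \<longlongrightarrow> s) at_top"
  shows "\<exists>L. (g \<longlongrightarrow> L) at_top"
proof -
  have "((\<lambda>t. (cos (g t))\<^sup>2 + (sin (g t))\<^sup>2) \<longlongrightarrow> c\<^sup>2 + s\<^sup>2) at_top"
    by (intro tendsto_intros C S)
  then have "c\<^sup>2 + s\<^sup>2 = 1" by (simp add: LIM_const_eq tendsto_const_iff)
  then obtain \<alpha> where \<alpha>: "c = cos \<alpha>" "s = sin \<alpha>" using sincos_total_2pi by metis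
  have lim: "((\<lambda>t. cos (g t - \<alpha>)) \<longlongrightarrow> 1) at_top"
  proof -
    have "((\<lambda>t. cos (g t) * cos \<alpha> + sin (g t) * sin \<alpha>) \<longlongrightarrow> c * cos \<alpha> + s * sin \<alpha>) at_top"
      by (intro tendsto_intros C S)
    then show ?thesis using \<alpha> by (simp add: cos_diff flip: power2_eq_square)
  qed
  define S where "S = range (\<lambda>n::int. \<alpha> + 2 * pi * of_int n)"
  have near: "\<forall>\<^sub>F t in at_top. \<exists>x\<in>S. \<bar>g t - x\<bar> < \<epsilon>" if "\<epsilon> > 0" for \<epsilon>
  proof -
    have "\<forall>\<^sub>F t in at_top. cos (g t - \<alpha>) > cos (min \<epsilon> pi)"
      using lim by (rule order_tendstoD) (use that cos_monotone_0_pi[of 0 "min \<epsilon> pi"] in auto)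
    then show ?thesis
    proof eventually_elim
      case (elim t)
      define n where "n = round ((g t - \<alpha>) / (2 * pi))"
      define y where "y = g t - (\<alpha> + 2 * pi * of_int n)"
      have "\<bar>(g t - \<alpha>) / (2 * pi) - of_int n\<bar> \<le> 1/2"
        unfolding n_def using of_int_round_abs_le by (metis abs_minus_commute)
      then have "\<bar>2 * pi * ((g t - \<alpha>) / (2 * pi) - of_int n)\<bar> \<le> 2 * pi * (1/2)"
        unfolding abs_mult by (intro mult_mono) auto
      moreover have "2 * pi * ((g t - \<alpha>) / (2 * pi) - of_int n) = y"
        by (simp add: y_def field_simps)
      ultimately have y: "\<bar>y\<bar> \<le> pi" by simp
      have "cos \<bar>y\<bar> = cos (g t - \<alpha> - 2 * pi * of_int n)" by (simp add: y_def algebra_simps)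
      also have "\<dots> = cos (g t - \<alpha>)"
        by (subst cos_diff) simp
      finally have "cos \<bar>y\<bar> > cos (min \<epsilon> pi)" using elim by simp
      then have "\<bar>y\<bar> < min \<epsilon> pi" using y that by (subst (asm) cos_mono_less_eq) auto
      then show ?case by (auto simp: S_def y_def)
    qed
  qed
  have "\<exists>L\<in>S. (g \<longlongrightarrow> L) at_top"
  proof (rule tendsto_of_approaching_discrete_set[OF cont _ _ near])
    show "(0::real) < 2 * pi" by simp
    fix x y assume "x \<in> S" "y \<in> S" "x \<noteq> y"
    then obtain a b :: int where ab: "x = \<alpha> + 2 * pi * of_int a" "y = \<alpha> + 2 * pi * of_int b"
      unfolding S_def by blast
    with \<open>x \<noteq> y\<close> have "1 \<le> \<bar>a - b\<bar>" by auto
    then have "1 \<le> \<bar>real_of_int a - real_of_int b\<bar>"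
      by (metis of_int_1_le_iff of_int_abs of_int_diff)
    then have "2 * pi * 1 \<le> 2 * pi * \<bar>real_of_int a - real_of_int b\<bar>" by (intro mult_left_mono) auto
    also have "\<dots> = \<bar>x - y\<bar>" unfolding ab by (simp add: abs_mult flip: right_diff_distrib)
    finally show "2 * pi \<le> \<bar>x - y\<bar>" by simp
  qed auto
  then show ?thesis by blast
qed

text \<open>If \<^term>\<open>g\<close> diverges, its limits inferior and superior differ, and every value strictly between them
  is taken at arbitrarily late times.\<close>

lemma convergent_or_recurrent_interval:
  fixes g :: "real \<Rightarrow> real"
  assumes cont: "continuous_on {T..} g" and bd: "\<And>t. t \<ge> T \<Longrightarrow> \<bar>g t\<bar> \<le> M"
  shows "(\<exists>L. (g \<longlongrightarrow> L) at_top) \<or> (\<exists>\<alpha> \<beta>. \<alpha> < \<beta> \<and> (\<forall>r\<in>{\<alpha>..\<beta>}. \<exists>\<^sub>F t in at_top. g t = r))"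
proof (cases "Liminf at_top (\<lambda>t. ereal (g t)) = Limsup at_top (\<lambda>t. ereal (g t))")
  case True
  have ev: "\<forall>\<^sub>F t in at_top. \<bar>g t\<bar> \<le> M"
    using eventually_ge_at_top[of T] by eventually_elim (rule bd)
  have "ereal (-M) \<le> Liminf at_top (\<lambda>t. ereal (g t))"
    using ev by (intro Liminf_bounded) (auto elim!: eventually_mono)
  moreover have "Limsup at_top (\<lambda>t. ereal (g t)) \<le> ereal M"
    using ev by (intro Limsup_bounded) (auto elim!: eventually_mono)
  ultimately obtain L where "Limsup at_top (\<lambda>t. ereal (g t)) = ereal L"
    using True by (cases "Limsup at_top (\<lambda>t. ereal (g t))") auto
  then have "((\<lambda>t. ereal (g t)) \<longlongrightarrow> ereal L) at_top"
    using True by (intro Liminf_eq_Limsup) auto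
  then show ?thesis by auto
next
  case False
  then have "Liminf at_top (\<lambda>t. ereal (g t)) < Limsup at_top (\<lambda>t. ereal (g t))"
    using Liminf_le_Limsup[of at_top "\<lambda>t. ereal (g t)"] by simp
  then obtain \<beta> where b: "Liminf at_top (\<lambda>t. ereal (g t)) < ereal \<beta>"
    "ereal \<beta> < Limsup at_top (\<lambda>t. ereal (g t))" using ereal_dense2 by blast
  then obtain \<alpha> where a: "Liminf at_top (\<lambda>t. ereal (g t)) < ereal \<alpha>" "ereal \<alpha> < ereal \<beta>"
    using ereal_dense2 by blast
  have low: "\<exists>\<^sub>F t in at_top. g t < \<alpha>"
  proof (rule ccontr)
    assume "\<not> ?thesis"
    then have "\<forall>\<^sub>F t in at_top. ereal \<alpha> \<le> ereal (g t)"
      by (simp add: not_frequently not_less)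
    then have "ereal \<alpha> \<le> Liminf at_top (\<lambda>t. ereal (g t))" by (rule Liminf_bounded)
    with a show False by simp
  qed
  have high: "\<exists>\<^sub>F t in at_top. g t > \<beta>"
  proof (rule ccontr)
    assume "\<not> ?thesis"
    then have "\<forall>\<^sub>F t in at_top. ereal (g t) \<le> ereal \<beta>"
      by (simp add: not_frequently not_less)
    then have "Limsup at_top (\<lambda>t. ereal (g t)) \<le> ereal \<beta>" by (rule Limsup_bounded)
    with b show False by simp
  qed
  have "\<exists>\<^sub>F t in at_top. g t = r" if r: "r \<in> {\<alpha>..\<beta>}" for r
  proof (subst frequently_def, rule notI)
    assume "\<forall>\<^sub>F t in at_top. \<not> g t = r"
    then obtain T0 where T0: "\<And>t. t \<ge> T0 \<Longrightarrow> g t \<noteq> r" by (auto simp: eventually_at_top_linorder)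
    obtain t1 where t1: "t1 \<ge> max T T0" "g t1 < \<alpha>"
      using low unfolding frequently_def eventually_at_top_linorder by blast
    obtain t2 where t2: "t2 \<ge> t1" "g t2 > \<beta>"
      using high unfolding frequently_def eventually_at_top_linorder by blast
    have "continuous_on {t1..t2} g" using t1 by (intro continuous_on_subset[OF cont]) auto
    then have "\<exists>s. t1 \<le> s \<and> s \<le> t2 \<and> g s = r" using t1 t2 r by (intro IVT') auto
    then obtain s where "t1 \<le> s" "g s = r" by blast
    then show False using T0[of s] t1(1) by simp
  qed
  then have "\<forall>r\<in>{\<alpha>..\<beta>}. \<exists>\<^sub>F t in at_top. g t = r" by blast
  moreover have "\<alpha> < \<beta>" using a(2) by simp
  ultimately show ?thesis by blast
qed

text \<open>Barbalat's lemma: over a short interval of fixed length \<^term>\<open>h\<close> the increment of \<^term>\<open>f\<close>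
  tends to zero, and it differs from \<^term>\<open>h * f' t\<close> by at most \<^term>\<open>K * h\<^sup>2\<close>.\<close>

lemma derivative_tendsto_zero:
  fixes f f' f'' :: "real \<Rightarrow> real"
  assumes der: "\<And>t. t > 0 \<Longrightarrow> (f has_real_derivative f' t) (at t)"
    and der2: "\<And>t. t > 0 \<Longrightarrow> (f' has_real_derivative f'' t) (at t)"
    and bound: "\<And>t. t > 0 \<Longrightarrow> \<bar>f'' t\<bar> \<le> K"
    and lim: "(f \<longlongrightarrow> L) at_top"
  shows "(f' \<longlongrightarrow> 0) at_top"
proof (rule tendstoI)
  fix e :: real assume e: "e > 0"
  have K: "K \<ge> 0" using bound[of 1] by simp
  define h where "h = e / (2 * (K + 1))"
  have h: "h > 0" "K * h < e/2" using e K by (auto simp: h_def field_simps)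
  have lip: "\<bar>f' s - f' t\<bar> \<le> K * (s - t)" if "0 < t" "t < s" for s t
  proof -
    have "\<exists>z>t. z < s \<and> f' s - f' t = (s - t) * f'' z"
      by (rule MVT2[OF \<open>t < s\<close>]) (use der2 that in auto)
    then obtain z where z: "t < z" "f' s - f' t = (s - t) * f'' z" by blast
    have "\<bar>f' s - f' t\<bar> = (s - t) * \<bar>f'' z\<bar>" using z that by (simp add: abs_mult)
    also have "\<dots> \<le> (s - t) * K" using bound[of z] z that by (intro mult_left_mono) auto
    finally show ?thesis by (simp add: mult.commute)
  qed
  have "((\<lambda>t. f (t + h)) \<longlongrightarrow> L) at_top"
    by (rule filterlim_compose[OF lim])
       (rule filterlim_at_top_mono[OF filterlim_ident], use h in \<open>auto intro!: always_eventually\<close>)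
  from tendsto_diff[OF this lim] have "((\<lambda>t. f (t + h) - f t) \<longlongrightarrow> 0) at_top" by simp
  then have "\<forall>\<^sub>F t in at_top. \<bar>f (t + h) - f t\<bar> < h * (e / 2)"
    using tendstoD[of "\<lambda>t. f (t + h) - f t" 0 at_top "h * (e/2)"] h e by (simp add: dist_real_def)
  with eventually_gt_at_top[of 0] show "\<forall>\<^sub>F t in at_top. dist (f' t) 0 < e"
  proof eventually_elim
    case (elim t)
    have "\<exists>z>t. z < t + h \<and> f (t + h) - f t = (t + h - t) * f' z"
      by (rule MVT2) (use der h elim in auto)
    then obtain z where z: "t < z" "z < t + h" "f (t + h) - f t = h * f' z" by auto
    have "h * \<bar>f' z\<bar> < h * (e/2)" using elim z h by (simp add: abs_mult)
    then have "\<bar>f' z\<bar> < e/2" using h by simp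
    moreover have "\<bar>f' z - f' t\<bar> \<le> K * h"
    proof -
      have "K * (z - t) \<le> K * h" using z K by (intro mult_left_mono) auto
      then show ?thesis using lip[of t z] z elim by linarith
    qed
    ultimately show ?case using h by (simp add: dist_real_def)
  qed
qed

text \<open>A first order lag forgets its initial value and reproduces lower bounds of its input.\<close>

lemma first_order_lag_eventually_ge:
  fixes z g :: "real \<Rightarrow> real"
  assumes p: "p > 0"
    and der: "\<And>t. t > 0 \<Longrightarrow> (z has_real_derivative g t - p * z t) (at t)"
    and ge: "\<forall>\<^sub>F t in at_top. g t \<ge> p * G" and e: "e > 0"
  shows "\<forall>\<^sub>F t in at_top. z t \<ge> G - e"
proof -
  have "\<forall>\<^sub>F t in at_top. t > 0 \<and> g t \<ge> p * G" using eventually_gt_at_top ge by (rule eventually_conj)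
  then obtain T where "\<forall>t\<ge>T. t > 0 \<and> g t \<ge> p * G" unfolding eventually_at_top_linorder by blast
  then have T: "T > 0" "\<And>t. t \<ge> T \<Longrightarrow> g t \<ge> p * G" by auto
  define w where "w t = exp (p * t) * (z t - G)" for t
  have mono: "w T \<le> w t" if "t \<ge> T" for t
  proof (rule DERIV_nonneg_imp_nondecreasing[OF that])
    fix s assume s: "T \<le> s" "s \<le> t"
    have "(w has_real_derivative exp (p * s) * (g s - p * G)) (at s)"
      unfolding w_def using s T
      by (auto intro!: derivative_eq_intros der simp: algebra_simps)
    moreover have "exp (p * s) * (g s - p * G) \<ge> 0" using T(2)[of s] s by simp
    ultimately show "\<exists>y. (w has_real_derivative y) (at s) \<and> 0 \<le> y" by blast
  qed
  have "((\<lambda>t. exp (- (p * t))) \<longlongrightarrow> 0) at_top" using p by real_asymp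
  then have "((\<lambda>t. exp (- (p * t)) * w T) \<longlongrightarrow> 0 * w T) at_top" by (intro tendsto_intros)
  then have "\<forall>\<^sub>F t in at_top. exp (- (p * t)) * w T > - e"
    by (rule order_tendstoD) (use e in simp)
  with eventually_ge_at_top[of T] show ?thesis
  proof eventually_elim
    case (elim t)
    have "exp (- (p * t)) * w T \<le> exp (- (p * t)) * w t" using mono[OF elim(1)] by simp
    also have "\<dots> = z t - G" by (simp add: w_def exp_minus)
    finally show ?case using elim by simp
  qed
qed

text \<open>Since \<^prop>\<open>4 * m * \<kappa> \<le> 1\<close>, the characteristic polynomial has real negative roots, and the
  second order operator is a composition of two first order lags.\<close>

lemma overdamped_eventually_ge:
  fixes y u u' g :: "real \<Rightarrow> real"
  assumes m: "m > 0" and k: "\<kappa> > 0" "4 * m * \<kappa> \<le> 1"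
    and dy: "\<And>t. t > 0 \<Longrightarrow> (y has_real_derivative u t) (at t)"
    and du: "\<And>t. t > 0 \<Longrightarrow> (u has_real_derivative u' t) (at t)"
    and eq: "\<And>t. t > 0 \<Longrightarrow> m * u' t + u t + \<kappa> * y t = \<kappa> * g t"
    and ge: "\<forall>\<^sub>F t in at_top. g t \<ge> G" and e: "e > 0"
  shows "\<forall>\<^sub>F t in at_top. y t \<ge> G - e"
proof -
  define s where "s = sqrt (1 - 4 * m * \<kappa>)"
  have s: "s \<ge> 0" "s < 1" "s\<^sup>2 = 1 - 4 * m * \<kappa>" using m k by (auto simp: s_def)
  define p q where "p = (1 + s) / (2 * m)" and "q = (1 - s) / (2 * m)"
  have pq: "p > 0" "q > 0" using s m by (auto simp: p_def q_def)
  have sum: "p + q = 1 / m" using m by (simp add: p_def q_def field_simps)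
  have "p * q = (1 - s\<^sup>2) / (4 * m\<^sup>2)"
    using m by (simp add: p_def q_def field_simps power2_eq_square)
  also have "\<dots> = \<kappa> / m" using m unfolding s(3) by (simp add: power2_eq_square)
  finally have prod: "p * q = \<kappa> / m" .
  define w where "w t = u t + q * y t" for t
  have dw: "(w has_real_derivative \<kappa> / m * g t - p * w t) (at t)" if "t > 0" for t
  proof -
    have "u' t + q * u t = \<kappa> / m * g t - p * w t"
    proof -
      have "u' t = \<kappa> / m * g t - (p + q) * u t - p * q * y t"
        using arg_cong[OF eq[OF that], of "\<lambda>x. x / m"] m unfolding sum prod
        by (simp add: add_divide_distrib)
      then show ?thesis by (simp add: w_def algebra_simps)
    qed
    moreover have "(w has_real_derivative u' t + q * u t) (at t)"
      unfolding w_def using dy[OF that] du[OF that] by (auto intro!: derivative_eq_intros)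
    ultimately show ?thesis by simp
  qed
  have "\<forall>\<^sub>F t in at_top. \<kappa> / m * g t \<ge> p * (q * G)"
    using ge
  proof eventually_elim
    case (elim t)
    then have "\<kappa> / m * G \<le> \<kappa> / m * g t" using m k by (intro mult_left_mono) auto
    then show ?case using prod by (simp flip: mult.assoc)
  qed
  from first_order_lag_eventually_ge[OF pq(1) dw this, of "q * (e/2)"]
  have "\<forall>\<^sub>F t in at_top. w t \<ge> q * (G - e/2)" using pq e by (simp add: algebra_simps)
  moreover have "(y has_real_derivative w t - q * y t) (at t)" if "t > 0" for t
    using dy[OF that] by (simp add: w_def)
  ultimately have "\<forall>\<^sub>F t in at_top. y t \<ge> (G - e/2) - e/2"
    using first_order_lag_eventually_ge[OF pq(2), of y w "G - e/2" "e/2"] e by simp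
  then show ?thesis by (simp add: algebra_simps)
qed

lemma sin_quotient_antimono:
  fixes x y :: real
  assumes "0 < x" "x \<le> y" "y \<le> pi"
  shows "sin y / y \<le> sin x / x"
proof (rule DERIV_nonpos_imp_nonincreasing[OF assms(2)])
  fix s assume s: "x \<le> s" "s \<le> y"
  have neg: "s * cos s \<le> sin s"
  proof -
    have "(\<lambda>s. sin s - s * cos s) 0 \<le> (\<lambda>s. sin s - s * cos s) s"
    proof (rule DERIV_nonneg_imp_nondecreasing[of 0 s])
      show "0 \<le> s" using s assms by simp
    next
      fix r assume r: "0 \<le> r" "r \<le> s"
      have "((\<lambda>s. sin s - s * cos s) has_real_derivative r * sin r) (at r)"
        by (auto intro!: derivative_eq_intros)
      moreover have "r * sin r \<ge> 0" using r s assms by (intro mult_nonneg_nonneg sin_ge_zero) auto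
      ultimately show "\<exists>y. ((\<lambda>s. sin s - s * cos s) has_real_derivative y) (at r) \<and> 0 \<le> y" by blast
    qed
    then show ?thesis by simp
  qed
  have "((\<lambda>s. sin s / s) has_real_derivative (cos s * s - sin s) / (s * s)) (at s)"
    using s assms by (auto intro!: derivative_eq_intros)
  moreover have "(cos s * s - sin s) / (s * s) \<le> 0"
    using neg by (intro divide_nonpos_nonneg) (auto simp: algebra_simps)
  ultimately show "\<exists>z. ((\<lambda>s. sin s / s) has_real_derivative z) (at s) \<and> z \<le> 0" by blast
qed


section \<open>The comparison function\<close>

lemma f_lam_eq: "f_lam lam x = 2 * sin (x / 2) * (lam * cos (x / 2) - (1 - lam))"
  using sin_double[of "x / 2"] by (simp add: f_lam_def algebra_simps)

lemma f_lam_deriv: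
  "(f_lam lam has_real_derivative lam * cos x - (1 - lam) * cos (x / 2)) (at x)"
  unfolding f_lam_def by (auto intro!: derivative_eq_intros simp: field_simps)

text \<open>With \<^term>\<open>c = cos (x / 2)\<close> the derivative is the quadratic polynomial
  \<^term>\<open>2 * lam * c\<^sup>2 - (1 - lam) * c - lam\<close>, which has exactly one positive root.\<close>

lemma f_lam_unimodal:
  assumes lam: "1 / 2 < lam" "lam \<le> 1"
  obtains s where "0 < s" "s \<le> pi / 2" "s < 2 * arccos ((1 - lam) / lam)"
    "\<And>x. 0 \<le> x \<Longrightarrow> x < s \<Longrightarrow> lam * cos x - (1 - lam) * cos (x / 2) > 0"
    "\<And>x. s < x \<Longrightarrow> x < 2 * arccos ((1 - lam) / lam) \<Longrightarrow> lam * cos x - (1 - lam) * cos (x / 2) < 0"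
proof -
  define g where "g c = 2 * lam * c\<^sup>2 - (1 - lam) * c - lam" for c
  define c0 where "c0 = (1 - lam) / lam"
  have c0: "0 \<le> c0" "c0 < 1" using lam by (auto simp: c0_def field_simps)
  have deriv: "lam * cos x - (1 - lam) * cos (x / 2) = g (cos (x / 2))" for x
  proof -
    have "cos x = 2 * (cos (x / 2))\<^sup>2 - 1" using cos_double_cos[of "x / 2"] by simp
    then show ?thesis by (simp only: g_def) (simp add: algebra_simps)
  qed
  have "\<exists>c\<ge>1 / sqrt 2. c \<le> 1 \<and> g c = 0"
  proof (rule IVT')
    show "g (1 / sqrt 2) \<le> 0" using lam by (simp add: g_def power_divide)
    show "0 \<le> g 1" using lam by (simp add: g_def)
    show "continuous_on {1 / sqrt 2..1} g" unfolding g_def by (intro continuous_intros)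
  qed simp
  then obtain c where c: "1 / sqrt 2 \<le> c" "c \<le> 1" "g c = 0" by blast
  have cpos: "c > 0" using c(1) by (rule less_le_trans[rotated]) simp
  have factor: "g d = (d - c) * (2 * lam * d + lam / c)" for d
  proof -
    have e: "1 - lam = 2 * lam * c - lam / c" using c(3) cpos
      by (simp add: g_def field_simps power2_eq_square)
    have "g d = 2 * lam * d\<^sup>2 - (2 * lam * c - lam / c) * d - lam"
      unfolding g_def by (simp only: e)
    then show ?thesis using cpos by (simp add: field_simps power2_eq_square)
  qed
  have pos: "2 * lam * d + lam / c > 0" if "d \<ge> 0" for d
    using that lam cpos by (intro add_nonneg_pos) auto
  have "c < 1" using c(2,3) lam by (cases "c = 1") (auto simp: g_def)
  have "c0 < c"
  proof (rule ccontr)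
    assume "\<not> c0 < c"
    then have "g c0 \<ge> 0" unfolding factor using pos[OF c0(1)] by simp
    moreover have "g c0 = ((1 - lam)\<^sup>2 - lam\<^sup>2) / lam"
      using lam by (simp add: g_def c0_def field_simps power2_eq_square)
    moreover have "(1 - lam)\<^sup>2 - lam\<^sup>2 < 0" using lam by (simp add: power2_eq_square algebra_simps)
    ultimately show False using lam by (simp add: zero_le_divide_iff)
  qed
  have Zpi: "2 * arccos c0 \<le> pi" using arccos_le_pi2[of c0] c0 by simp
  show thesis
  proof (rule that[of "2 * arccos c"], unfold deriv, fold c0_def)
    have "arccos 1 < arccos c" using \<open>c < 1\<close> cpos by (subst arccos_less_mono) auto
    then show "0 < 2 * arccos c" by simp
    have "1 / sqrt 2 = cos (pi / 4)" by (simp add: cos_45 field_simps)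
    then have "arccos (1 / sqrt 2) = pi / 4" by (simp only:) (rule arccos_cos, auto)
    moreover have "arccos c \<le> arccos (1 / sqrt 2)"
      using c by (intro arccos_le_arccos) (auto intro: order_trans[of _ 0])
    ultimately show "2 * arccos c \<le> pi / 2" by simp
    show "2 * arccos c < 2 * arccos c0"
      using arccos_less_arccos[of c0 c] \<open>c0 < c\<close> c0 c by simp
  next
    fix x assume x: "0 \<le> x" "x < 2 * arccos c"
    have "cos (arccos c) < cos (x / 2)"
      using x arccos_ubound[of c] cpos c(2) by (intro cos_monotone_0_pi) auto
    then have "c < cos (x / 2)" using cpos c(2) by simp
    then show "g (cos (x / 2)) > 0" unfolding factor using pos cpos by simp
  next
    fix x assume x: "2 * arccos c < x" "x < 2 * arccos c0"
    have "cos (x / 2) < cos (arccos c)"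
      using x arccos_lbound[of c] cpos c(2) Zpi by (intro cos_monotone_0_pi) auto
    then have "cos (x / 2) < c" using cpos c(2) by simp
    moreover have "cos (x / 2) \<ge> 0"
      using x Zpi arccos_lbound[of c] cpos c(2) by (intro cos_ge_zero) auto
    ultimately show "g (cos (x / 2)) < 0" unfolding factor using pos by (simp add: mult_neg_pos)
  qed
qed

text \<open>On either side of its maximum \<^term>\<open>f_lam lam\<close> is strictly monotone and takes the
  value \<^term>\<open>d\<close> exactly once, so that the two roots are well defined.\<close>

lemma f_lam_two_roots:
  assumes lam: "1 / 2 < lam" "lam \<le> 1"
    and l: "0 < l" "l < 2 * arccos ((1 - lam) / lam)" and d: "0 < d" "d < f_lam lam l"
  shows phi1_pos: "0 < phi1 lam d"
    and phi1_less: "phi1 lam d < l" and less_phi2: "l < phi2 lam d"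
    and phi1_less_pi_half: "phi1 lam d < pi / 2"
    and phi2_less: "phi2 lam d < 2 * arccos ((1 - lam) / lam)"
    and f_lam_phi1: "f_lam lam (phi1 lam d) = d"
    and f_lam_gt: "\<And>x. phi1 lam d < x \<Longrightarrow> x < phi2 lam d \<Longrightarrow> d < f_lam lam x"
    and f_lam_le: "\<And>x. 0 \<le> x \<Longrightarrow> x \<le> phi1 lam d \<Longrightarrow> f_lam lam x \<le> d"
    and f_lam_deriv_phi1_pos: "(1 - lam) * cos (phi1 lam d / 2) < lam * cos (phi1 lam d)"
proof -
  define Z where "Z = 2 * arccos ((1 - lam) / lam)"
  obtain s where s: "0 < s" "s \<le> pi / 2" "s < Z"
    and inc: "\<And>x. 0 \<le> x \<Longrightarrow> x < s \<Longrightarrow> lam * cos x - (1 - lam) * cos (x / 2) > 0"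
    and dec: "\<And>x. s < x \<Longrightarrow> x < Z \<Longrightarrow> lam * cos x - (1 - lam) * cos (x / 2) < 0"
    using f_lam_unimodal[OF lam] unfolding Z_def by metis
  have cont: "continuous_on X (f_lam lam)" for X
    using f_lam_deriv by (meson DERIV_isCont continuous_at_imp_continuous_on)
  have less: "f_lam lam x < f_lam lam y" if "0 \<le> x" "x < y" "y \<le> s" for x y
    using that inc f_lam_deriv by (intro DERIV_pos_imp_increasing_open[OF \<open>x < y\<close>] cont) force+
  have greater: "f_lam lam y < f_lam lam x" if "s \<le> x" "x < y" "y \<le> Z" for x y
    using that dec f_lam_deriv by (intro DERIV_neg_imp_decreasing_open[OF \<open>x < y\<close>] cont) force+
  have f0: "f_lam lam 0 = 0" by (simp add: f_lam_def)
  have fZ: "f_lam lam Z = 0" using lam by (simp add: f_lam_eq Z_def field_simps)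
  have fs: "d < f_lam lam s"
    using less[of l s] greater[of s l] l d unfolding Z_def[symmetric] by (cases l s rule: linorder_cases) auto
  have "\<exists>a\<ge>0. a \<le> s \<and> f_lam lam a = d"
    by (rule IVT') (use f0 fs d s cont in auto)
  then obtain a where a: "0 \<le> a" "a \<le> s" "f_lam lam a = d" by blast
  have "\<exists>b\<ge>s. b \<le> Z \<and> f_lam lam b = d"
    by (rule IVT2') (use fZ fs d s cont in auto)
  then obtain b where b: "s \<le> b" "b \<le> Z" "f_lam lam b = d" by blast
  have strict: "0 < a" "a < s" "s < b" "b < Z" using a b f0 fZ fs d by (auto simp: less_le)
  have below: "f_lam lam x < d" if "0 \<le> x" "x < a \<or> b < x" "x \<le> Z" for x
    using that less[of x a] greater[of b x] a b by auto
  have above: "d < f_lam lam x" if "a < x" "x < b" for x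
    using that less[of a x] greater[of x b] a b by (cases "x \<le> s") auto
  have roots: "f_roots lam d = {a, b}"
  proof (rule set_eqI)
    fix x
    consider "x < a \<or> b < x" | "a < x" "x < b" | "x = a \<or> x = b" by linarith
    then show "x \<in> f_roots lam d \<longleftrightarrow> x \<in> {a, b}"
    proof cases
      case 1
      then show ?thesis using below[of x] strict by (auto simp: f_roots_def Z_def[symmetric])
    next
      case 2
      then show ?thesis using above[of x] by (auto simp: f_roots_def)
    next
      case 3
      then show ?thesis using a b strict by (auto simp: f_roots_def Z_def[symmetric])
    qed
  qed
  have 1: "phi1 lam d = a" unfolding phi1_def roots
    by (rule the_equality) (use strict in \<open>auto simp: doubleton_eq_iff\<close>)
  have 2: "phi2 lam d = b" unfolding phi2_def roots
    by (rule the_equality) (use strict in \<open>auto simp: doubleton_eq_iff\<close>)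
  show "0 < phi1 lam d" "phi1 lam d < pi / 2" "phi2 lam d < 2 * arccos ((1 - lam) / lam)"
    "f_lam lam (phi1 lam d) = d"
    using 1 2 strict s a unfolding Z_def[symmetric] by auto
  show "phi1 lam d < l" using below[of l] a(3) d l unfolding 1 Z_def[symmetric]
    by (cases l a rule: linorder_cases) auto
  show "l < phi2 lam d" using below[of l] b(3) d l unfolding 2 Z_def[symmetric]
    by (cases l b rule: linorder_cases) auto
  show "d < f_lam lam x" if "phi1 lam d < x" "x < phi2 lam d" for x
    using above that unfolding 1 2 by blast
  show "f_lam lam x \<le> d" if "0 \<le> x" "x \<le> phi1 lam d" for x
    using below[of x] a(3) that strict unfolding 1 by (cases "x = a") auto
  show "(1 - lam) * cos (phi1 lam d / 2) < lam * cos (phi1 lam d)"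
    using inc[of a] strict unfolding 1 by simp
qed

text \<open>Put \<^term>\<open>x = phi1 lam d\<close> and \<^term>\<open>c = cos (x / 2)\<close>.  Positivity of the derivative of
  \<^term>\<open>f_lam lam\<close> at \<^term>\<open>x\<close> reads \<^prop>\<open>lam * (2 * c - 1) * (c + 1) > c\<close>, and this
  gives \<^prop>\<open>lam * c - (1 - lam) \<ge> 2 / 3 * (2 * lam - 1)\<close> because
  \<^prop>\<open>c * (3 * c - 1) - (2 * c - 1) * (c + 1) = (c - 1)\<^sup>2\<close>.  The other factor
  \<^term>\<open>2 * sin (x / 2)\<close> of \<^prop>\<open>f_lam lam x = d\<close> is estimated by Jordan's inequality.\<close>

lemma phi1_linear_bound:
  assumes lam: "1 / 2 < lam" "lam \<le> 1"
    and l: "0 < l" "l < 2 * arccos ((1 - lam) / lam)" and d: "0 < d" "d < f_lam lam l"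
  shows "phi1 lam d < 3 * pi / (4 * (2 * lam - 1)) * d"
proof -
  define x where "x = phi1 lam d"
  define c where "c = cos (x / 2)"
  have x: "0 < x" "x < pi / 2" "f_lam lam x = d"
    using phi1_pos[OF assms] phi1_less_pi_half[OF assms] f_lam_phi1[OF assms] by (auto simp: x_def)
  have "cos (pi / 3) < c" unfolding c_def using x by (intro cos_monotone_0_pi) auto
  then have c: "1 / 2 < c" "c \<le> 1" by (auto simp: cos_60 c_def)
  have "(1 - lam) * c < lam * (2 * c\<^sup>2 - 1)"
    using f_lam_deriv_phi1_pos[OF assms] cos_double_cos[of "x / 2"] by (simp add: x_def c_def)
  then have "c < lam * ((2 * c - 1) * (c + 1))" by (simp add: algebra_simps power2_eq_square)
  also have "\<dots> \<le> lam * (c * (3 * c - 1))"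
  proof (rule mult_left_mono)
    have "(c - 1)\<^sup>2 \<ge> 0" by simp
    then show "(2 * c - 1) * (c + 1) \<le> c * (3 * c - 1)" by (simp add: power2_eq_square algebra_simps)
  qed (use lam in simp)
  finally have "c * 1 < c * (lam * (3 * c - 1))" by (simp add: algebra_simps)
  then have "1 < lam * (3 * c - 1)" using c by simp
  then have "1 + lam < 3 * (lam * c)" by (simp add: algebra_simps)
  then have F: "2 / 3 * (2 * lam - 1) < lam * c - (1 - lam)" by simp
  have S: "x * (2 / pi) \<le> 2 * sin (x / 2)"
  proof -
    have "sin (pi / 2) / (pi / 2) \<le> sin (x / 2) / (x / 2)" using x by (intro sin_quotient_antimono) auto
    then show ?thesis using x by (simp add: field_simps)
  qed
  have "x * (2 / pi) * (2 / 3 * (2 * lam - 1)) < 2 * sin (x / 2) * (lam * c - (1 - lam))"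
  proof -
    have "x * (2 / pi) * (2 / 3 * (2 * lam - 1)) < x * (2 / pi) * (lam * c - (1 - lam))"
      using x F by (intro mult_strict_left_mono) auto
    also have "\<dots> \<le> 2 * sin (x / 2) * (lam * c - (1 - lam))"
      using S F lam by (intro mult_right_mono) auto
    finally show ?thesis .
  qed
  also have "\<dots> = d" using x(3) by (simp add: f_lam_eq c_def)
  finally have "x * (4 * (2 * lam - 1)) < d * (3 * pi)" by (simp add: field_simps)
  then have "x < d * (3 * pi) / (4 * (2 * lam - 1))" using lam by (simp add: pos_less_divide_eq)
  then show ?thesis by (simp add: x_def mult.commute)
qed

text \<open>The threshold is the value of \<^term>\<open>f_lam lam\<close> at \<^term>\<open>arccos ((1 - lam) / lam)\<close>, the
  point up to which \<^term>\<open>lam * cos x - (1 - lam)\<close> is positive.\<close>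

lemma below_threshold:
  assumes lam: "1 / 2 < lam" "lam \<le> 1"
    and l: "0 < l" "l < 2 * arccos ((1 - lam) / lam)" and d: "0 < d" "d < f_lam lam l"
    and thr: "d < delta_threshold lam"
  shows "1 - lam < lam * cos (phi1 lam d)"
proof -
  define p where "p = arccos ((1 - lam) / lam)"
  have c: "cos p = (1 - lam) / lam" "0 \<le> p" "p \<le> pi / 2"
    unfolding p_def using lam arccos_le_pi2[of "(1 - lam) / lam"]
    by (auto intro!: cos_arccos arccos_lbound simp: field_simps)
  have c2: "(cos (p / 2))\<^sup>2 = 1 / (2 * lam)"
    using cos_double_cos[of "p / 2"] c lam by (simp add: field_simps)
  have C: "cos (p / 2) = 1 / sqrt (2 * lam)"
  proof -
    have "cos (p / 2) \<ge> 0" using c by (intro cos_ge_zero) auto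
    then show ?thesis using c2 by (metis real_sqrt_abs abs_of_nonneg real_sqrt_divide real_sqrt_one)
  qed
  have S: "sin (p / 2) = sqrt (2 * lam - 1) / sqrt (2 * lam)"
  proof -
    have "(sin (p / 2))\<^sup>2 = 1 - (cos (p / 2))\<^sup>2" using sin_cos_squared_add[of "p / 2"] by linarith
    also have "\<dots> = (2 * lam - 1) / (2 * lam)" unfolding c2 using lam by (simp add: field_simps)
    finally have s2: "(sin (p / 2))\<^sup>2 = (2 * lam - 1) / (2 * lam)" .
    have "sin (p / 2) \<ge> 0" using c by (intro sin_ge_zero) auto
    then show ?thesis using s2 by (metis real_sqrt_abs abs_of_nonneg real_sqrt_divide)
  qed
  define r where "r = sqrt (lam / 2)"
  have r: "r\<^sup>2 = lam / 2" "r > 0" using lam by (auto simp: r_def)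
  have "lam * (1 / sqrt (2 * lam)) = r"
    using lam by (simp add: r_def real_sqrt_mult real_sqrt_divide field_simps flip: power2_eq_square)
  then have "f_lam lam p = 2 * (sqrt (2 * lam - 1) / sqrt (2 * lam)) * (r - (1 - lam))"
    unfolding f_lam_eq S C by simp
  also have "r - (1 - lam) = (2 * lam - 1) * (2 - lam) / 2 / (r + (1 - lam))"
  proof -
    have "(r - (1 - lam)) * (r + (1 - lam)) = r\<^sup>2 - (1 - lam)\<^sup>2"
      by (simp add: power2_eq_square algebra_simps)
    also have "\<dots> = (2 * lam - 1) * (2 - lam) / 2" unfolding r(1)
      by (simp add: power2_eq_square field_simps)
    finally have "r - (1 - lam) = (2 * lam - 1) * (2 - lam) / 2 / (r + (1 - lam))"
      by (subst nonzero_eq_divide_eq) (use r(2) lam in auto)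
    then show ?thesis .
  qed
  also have "2 * (sqrt (2 * lam - 1) / sqrt (2 * lam)) * \<dots> = delta_threshold lam"
  proof -
    have "(2 * lam - 1) powr (3 / 2) = (2 * lam - 1) powr 1 * (2 * lam - 1) powr (1 / 2)"
      by (simp only: flip: powr_add) simp
    also have "\<dots> = (2 * lam - 1) * sqrt (2 * lam - 1)" using lam by (simp add: powr_half_sqrt)
    finally have p: "(2 * lam - 1) powr (3 / 2) = (2 * lam - 1) * sqrt (2 * lam - 1)" .
    have "2 * (v / w) * ((2 * lam - 1) * (2 - lam) / 2 / z) = (2 * lam - 1) * v / w * ((2 - lam) / z)"
      for v w z :: real by simp
    then show ?thesis unfolding delta_threshold_def p r_def by blast
  qed
  finally have "d < f_lam lam p" using thr by simp
  then have "phi1 lam d < p"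
    using f_lam_le[OF lam l d, of p] c by (cases "p \<le> phi1 lam d") auto
  then have "cos p < cos (phi1 lam d)"
    using phi1_pos[OF lam l d] c by (intro cos_monotone_0_pi) auto
  then show ?thesis unfolding c(1) using lam by (simp add: field_simps)
qed


section \<open>Relative velocities of inertial oscillators\<close>

definition coupling :: "nat \<Rightarrow> (nat \<Rightarrow> real) \<Rightarrow> nat \<Rightarrow> real" where
  "coupling N x i = (\<Sum>k=1..N. sin (x k - x i)) / real N"

lemma sin_diff_le_abs: "sin a - sin b \<le> \<bar>a - b :: real\<bar>"
proof -
  have "\<bar>2 * sin ((a - b) / 2) * cos ((a + b) / 2)\<bar> \<le> 2 * \<bar>(a - b) / 2\<bar> * 1"
    unfolding abs_mult using abs_sin_x_le_abs_x[of "(a - b) / 2"] by (intro mult_mono) auto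
  then show ?thesis by (simp add: sin_diff_sin)
qed

text \<open>The forces on two oscillators in the configuration \<^term>\<open>x\<close> are compared with those in a
  nearby configuration \<^term>\<open>y\<close>.  A member \<^term>\<open>k\<close> of \<^term>\<open>S\<close> pulls the two together by
  \<^term>\<open>2 * sin ((y i - y j) / 2) * cos (y k - (y i + y j) / 2)\<close>; any other oscillator, wherever
  it is, pushes them apart by at most \<^term>\<open>2 * sin ((y i - y j) / 2)\<close>.\<close>

lemma coupling_difference_le:
  fixes x y :: "nat \<Rightarrow> real"
  assumes N: "N \<ge> 1" and S: "S \<subseteq> {1..N}" "lam * real N \<le> real (card S)"
    and close: "\<And>k l. k \<in> insert i (insert j S) \<Longrightarrow> l \<in> {i, j} \<Longrightarrow> \<bar>(x k - x l) - (y k - y l)\<bar> \<le> L"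
    and range: "0 \<le> y i - y j" "y i - y j \<le> 2 * pi"
    and q: "- 1 \<le> q" "\<And>k. k \<in> S \<Longrightarrow> q \<le> cos (y k - (y i + y j) / 2)"
  shows "coupling N x i - coupling N x j
    \<le> 2 * L - 2 * sin ((y i - y j) / 2) * (lam * q - (1 - lam))"
proof -
  define \<sigma> where "\<sigma> = sin ((y i - y j) / 2)"
  have \<sigma>: "\<sigma> \<ge> 0" unfolding \<sigma>_def using range by (intro sin_ge_zero) auto
  have L: "L \<ge> 0" using close[of i i] by simp
  have fin: "finite S" using S(1) finite_subset by blast
  have summand: "sin (x k - x i) - sin (x k - x j) \<le> (2 * L + 2 * \<sigma>) - (if k \<in> S then 2 * \<sigma> * (1 + q) else 0)"
    for k
  proof (cases "k \<in> S")
    case True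
    have "sin (y k - y i) - sin (y k - y j) = - 2 * \<sigma> * cos (y k - (y i + y j) / 2)"
    proof -
      have "(y k - y i - (y k - y j)) / 2 = - ((y i - y j) / 2)"
        "(y k - y i + (y k - y j)) / 2 = y k - (y i + y j) / 2" by (simp_all add: field_simps)
      then show ?thesis unfolding sin_diff_sin \<sigma>_def by (simp only: sin_minus)
    qed
    also have "\<dots> \<le> - 2 * \<sigma> * q" using q(2)[OF True] \<sigma> by (simp add: mult_left_mono)
    finally have "sin (y k - y i) - sin (y k - y j) \<le> - 2 * \<sigma> * q" .
    moreover have "sin (x k - x i) - sin (y k - y i) \<le> L" "sin (y k - y j) - sin (x k - x j) \<le> L"
      using sin_diff_le_abs[of "x k - x i" "y k - y i"] sin_diff_le_abs[of "y k - y j" "x k - x j"]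
        close[of k i] close[of k j] True by auto
    ultimately show ?thesis using True by (simp add: algebra_simps)
  next
    case False
    have "sin (x k - x i) - sin (x k - x j) \<le> \<bar>2 * sin ((x j - x i) / 2) * cos ((x k - x i + (x k - x j)) / 2)\<bar>"
      by (simp add: sin_diff_sin)
    also have "\<dots> \<le> 2 * \<bar>sin ((x i - x j) / 2)\<bar> * 1"
    proof -
      have "(x j - x i) / 2 = - ((x i - x j) / 2)" by argo
      then have "\<bar>sin ((x j - x i) / 2)\<bar> = \<bar>sin ((x i - x j) / 2)\<bar>"
        by (simp only: sin_minus abs_minus_cancel)
      then show ?thesis unfolding abs_mult by (intro mult_mono) auto
    qed
    also have "\<bar>sin ((x i - x j) / 2)\<bar> \<le> \<sigma> + L / 2"
    proof -
      have d: "\<bar>(x i - x j) / 2 - (y i - y j) / 2\<bar> \<le> L / 2"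
        using close[of i j] by (simp flip: diff_divide_distrib)
      have "sin ((x i - x j) / 2) - \<sigma> \<le> L / 2" "\<sigma> - sin ((x i - x j) / 2) \<le> L / 2"
        using sin_diff_le_abs[of "(x i - x j) / 2" "(y i - y j) / 2"]
          sin_diff_le_abs[of "(y i - y j) / 2" "(x i - x j) / 2"] d unfolding \<sigma>_def by linarith+
      then show ?thesis using \<sigma> by linarith
    qed
    finally show ?thesis using False L by simp
  qed
  have "(\<Sum>k=1..N. sin (x k - x i) - sin (x k - x j))
      \<le> (\<Sum>k=1..N. (2 * L + 2 * \<sigma>) - (if k \<in> S then 2 * \<sigma> * (1 + q) else 0))"
    by (intro sum_mono summand)
  also have "\<dots> = real N * (2 * L + 2 * \<sigma>) - real (card S) * (2 * \<sigma> * (1 + q))"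
  proof -
    have "{1..N} \<inter> S = S" using S by blast
    then show ?thesis by (simp add: sum_subtractf sum.If_cases)
  qed
  also have "\<dots> \<le> real N * (2 * L + 2 * \<sigma>) - lam * real N * (2 * \<sigma> * (1 + q))"
    using S(2) \<sigma> q(1) by (intro diff_left_mono mult_right_mono) auto
  also have "\<dots> = real N * (2 * L - 2 * \<sigma> * (lam * q - (1 - lam)))" by (simp add: algebra_simps)
  finally show ?thesis using N
    unfolding coupling_def \<sigma>_def by (simp add: field_simps sum_subtractf)
qed

locale inertial_kuramoto =
  fixes N :: nat and m \<kappa> :: real and \<nu> \<theta>0 \<omega>0 :: "nat \<Rightarrow> real" and \<theta> \<omega> :: "nat \<Rightarrow> real \<Rightarrow> real"
  assumes N_pos: "N \<ge> 1" and m_pos: "m > 0" and \<kappa>_pos: "\<kappa> > 0"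
    and solution: "kuramoto_solution N m \<kappa> \<nu> \<theta>0 \<omega>0 \<theta> \<omega>"
begin

definition force :: "nat \<Rightarrow> real \<Rightarrow> real" where
  "force i t = coupling N (\<lambda>k. \<theta> k t) i"

lemma initial_values: "i \<in> {1..N} \<Longrightarrow> \<theta> i 0 = \<theta>0 i" "i \<in> {1..N} \<Longrightarrow> \<omega> i 0 = \<omega>0 i"
  using solution by (auto simp: kuramoto_solution_def)

lemma continuous_\<omega>: "i \<in> {1..N} \<Longrightarrow> continuous_on {0..} (\<omega> i)"
  using solution by (auto simp: kuramoto_solution_def)

lemma continuous_\<theta>: "i \<in> {1..N} \<Longrightarrow> continuous_on {0..} (\<theta> i)"
  using solution unfolding kuramoto_solution_def
  by (intro DERIV_continuous_on[of _ _ "\<omega> i"]) auto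

lemma deriv_\<theta>:
  assumes "i \<in> {1..N}" "t > 0"
  shows "(\<theta> i has_real_derivative \<omega> i t) (at t)"
proof -
  have "(\<theta> i has_real_derivative \<omega> i t) (at t within {0..})"
    using solution assms by (auto simp: kuramoto_solution_def)
  moreover have "at t within {0..} = at t" using assms by (intro at_within_interior) simp
  ultimately show ?thesis by simp
qed

lemma deriv_\<omega>:
  assumes "i \<in> {1..N}" "t > 0"
  shows "(\<omega> i has_real_derivative (\<nu> i + \<kappa> * force i t - \<omega> i t) / m) (at t)"
proof -
  obtain a where a: "(\<omega> i has_real_derivative a) (at t)"
    "m * a + \<omega> i t = \<nu> i + \<kappa> / real N * (\<Sum>j=1..N. sin (\<theta> j t - \<theta> i t))"
    using solution assms unfolding kuramoto_solution_def by blast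
  then have "a = (\<nu> i + \<kappa> * force i t - \<omega> i t) / m"
    using m_pos by (simp add: force_def coupling_def field_simps)
  then show ?thesis using a(1) by simp
qed

lemma abs_force_le: "\<bar>force i t\<bar> \<le> 1"
proof -
  have "\<bar>\<Sum>k=1..N. sin (\<theta> k t - \<theta> i t)\<bar> \<le> (\<Sum>k=1..N. 1)"
    by (rule order_trans[OF sum_abs]) (intro sum_mono, simp)
  then show ?thesis using N_pos by (simp add: force_def coupling_def field_simps)
qed

definition speed_bound :: "nat set \<Rightarrow> real \<Rightarrow> real" where
  "speed_bound B t = exp (- t / m) * fam_diam B \<omega>0 + (1 - exp (- t / m)) * (fam_diam B \<nu> + 2 * \<kappa>)"

definition path_bound :: "nat set \<Rightarrow> real \<Rightarrow> real" where
  "path_bound B t = - m * exp (- t / m) * fam_diam B \<omega>0 + (t + m * exp (- t / m)) * (fam_diam B \<nu> + 2 * \<kappa>)"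

text \<open>The contribution of the initial velocities to the velocity estimate below, relative to the
  factor \<^term>\<open>(1 - exp (- t / m)) * \<kappa>\<close>.\<close>

definition transient :: "nat set \<Rightarrow> real \<Rightarrow> real" where
  "transient B t = fam_diam B \<omega>0 *
     (exp (- t / m) / (\<kappa> * (1 - exp (- t / m))) + 2 * t * exp (- t / m))"

lemma path_bound_deriv: "(path_bound B has_real_derivative speed_bound B t) (at t)"
  unfolding path_bound_def speed_bound_def using m_pos
  by (auto intro!: derivative_eq_intros simp: field_simps)

lemma relative_velocity_le:
  assumes B: "B \<subseteq> {1..N}" and ij: "i \<in> B" "j \<in> B" and t: "t \<ge> 0"
  shows "\<omega> i t - \<omega> j t \<le> speed_bound B t"
proof -
  have fin: "finite B" using B finite_subset by blast
  have ijN: "i \<in> {1..N}" "j \<in> {1..N}" using B ij by auto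
  define G where "G = fam_diam B \<nu> + 2 * \<kappa>"
  define w where "w s = exp (s / m) * (\<omega> i s - \<omega> j s - G)" for s
  have "w t \<le> w 0"
  proof (rule DERIV_nonpos_imp_decreasing_open[OF t])
    show "continuous_on {0..t} w" unfolding w_def using m_pos ijN
      by (intro continuous_intros continuous_on_subset[OF continuous_\<omega>]) auto
    fix s assume s: "0 < s" "s < t"
    have "(w has_real_derivative
        exp (s / m) / m * ((\<nu> i - \<nu> j) + \<kappa> * (force i s - force j s) - G)) (at s)"
      unfolding w_def using s m_pos ijN
      by (auto intro!: derivative_eq_intros deriv_\<omega> simp: field_simps)
    moreover have "(\<nu> i - \<nu> j) + \<kappa> * (force i s - force j s) - G \<le> 0"
    proof -
      have "force i s - force j s \<le> 2" using abs_force_le[of i s] abs_force_le[of j s] by linarith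
      then have "\<kappa> * (force i s - force j s) \<le> \<kappa> * 2" using \<kappa>_pos by (intro mult_left_mono) auto
      moreover have "\<nu> i - \<nu> j \<le> fam_diam B \<nu>" using diff_le_fam_diam[OF fin ij] .
      ultimately show ?thesis unfolding G_def by linarith
    qed
    then have "exp (s / m) / m * ((\<nu> i - \<nu> j) + \<kappa> * (force i s - force j s) - G) \<le> 0"
      using m_pos by (intro mult_nonneg_nonpos) auto
    ultimately show "\<exists>y. (w has_real_derivative y) (at s) \<and> y \<le> 0" by blast
  qed
  also have "w 0 \<le> fam_diam B \<omega>0 - G"
    using diff_le_fam_diam[OF fin ij, of \<omega>0] initial_values ijN by (simp add: w_def)
  finally have "exp (- t / m) * w t \<le> exp (- t / m) * (fam_diam B \<omega>0 - G)" by simp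
  moreover have "exp (- t / m) * w t = \<omega> i t - \<omega> j t - G"
    by (simp add: w_def exp_minus)
  ultimately show ?thesis by (simp add: speed_bound_def G_def algebra_simps)
qed

lemma relative_displacement_le:
  assumes B: "B \<subseteq> {1..N}" and ij: "i \<in> B" "j \<in> B" and s: "0 \<le> s" "s \<le> t"
  shows "\<bar>(\<theta> i s - \<theta> j s) - (\<theta> i t - \<theta> j t)\<bar> \<le> path_bound B t - path_bound B s"
proof -
  have *: "(\<theta> i t - \<theta> j t) - path_bound B t \<le> (\<theta> i s - \<theta> j s) - path_bound B s"
    if ij: "i \<in> B" "j \<in> B" for i j
  proof (rule DERIV_nonpos_imp_decreasing_open[OF s(2)])
    have ijN: "i \<in> {1..N}" "j \<in> {1..N}" using B ij by auto
    have "continuous_on {s..t} (path_bound B)"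
      using path_bound_deriv by (meson DERIV_isCont continuous_at_imp_continuous_on)
    then show "continuous_on {s..t} (\<lambda>t. (\<theta> i t - \<theta> j t) - path_bound B t)"
      using s ijN by (intro continuous_intros continuous_on_subset[OF continuous_\<theta>]) auto
    fix r assume r: "s < r" "r < t"
    then have "((\<lambda>t. (\<theta> i t - \<theta> j t) - path_bound B t) has_real_derivative
        (\<omega> i r - \<omega> j r) - speed_bound B r) (at r)"
      using s ijN by (intro DERIV_diff deriv_\<theta> path_bound_deriv) auto
    moreover have "(\<omega> i r - \<omega> j r) - speed_bound B r \<le> 0"
      using relative_velocity_le[OF B ij, of r] r s by simp
    ultimately show "\<exists>y. ((\<lambda>t. (\<theta> i t - \<theta> j t) - path_bound B t) has_real_derivative y) (at r) \<and> y \<le> 0"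
      by blast
  qed
  show ?thesis using *[OF ij] *[OF ij(2) ij(1)] by linarith
qed

text \<open>By variation of constants, the relative velocity at time \<^term>\<open>t\<close> is an average, with
  exponential weights, of the relative forces at the times \<^term>\<open>s \<le> t\<close>.  These differ from the
  force at time \<^term>\<open>t\<close> by at most twice the path travelled in between, so that the relative
  phase obeys, up to the error \<^term>\<open>delta m \<kappa> \<nu> B + transient B t\<close>, the first order model.\<close>

lemma first_order_velocity_estimate:
  assumes B: "B \<subseteq> {1..N}" and S: "S \<subseteq> B" "lam * real N \<le> real (card S)"
    and ij: "i \<in> B" "j \<in> B" and t: "t > 0"
    and range: "0 \<le> \<theta> i t - \<theta> j t" "\<theta> i t - \<theta> j t \<le> 2 * pi"
    and q: "- 1 \<le> q" "\<And>k. k \<in> S \<Longrightarrow> q \<le> cos (\<theta> k t - (\<theta> i t + \<theta> j t) / 2)"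
  shows "\<omega> i t - \<omega> j t \<le> (1 - exp (- t / m)) * \<kappa> *
    (delta m \<kappa> \<nu> B + transient B t - 2 * sin ((\<theta> i t - \<theta> j t) / 2) * (lam * q - (1 - lam)))"
proof -
  have fin: "finite B" using B finite_subset by blast
  have ijN: "i \<in> {1..N}" "j \<in> {1..N}" using B ij by auto
  define Q where "Q = 2 * sin ((\<theta> i t - \<theta> j t) / 2) * (lam * q - (1 - lam))"
  define W where "W = fam_diam B \<omega>0"
  define V where "V = fam_diam B \<nu>"
  define G where "G = V + 2 * \<kappa>"
  define E where "E = exp (- t / m)"
  have E: "0 < E" "E < 1" using t m_pos by (auto simp: E_def)
  have nonneg: "W \<ge> 0" "V \<ge> 0" "G \<ge> 0" using fam_diam_nonneg[OF fin] \<kappa>_pos by (auto simp: W_def V_def G_def)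
  define H where "H = path_bound B t"
  have force: "force i s - force j s \<le> 2 * (H - path_bound B s) - Q" if s: "0 \<le> s" "s \<le> t" for s
    unfolding force_def Q_def
    using S B ij range q N_pos unfolding H_def
    by (intro coupling_difference_le[where S = S] relative_displacement_le[OF B] s) auto
  \<comment> \<open>The function \<^term>\<open>P\<close> is an antiderivative of the upper bound for the derivative of
    \<^term>\<open>exp (s / m) * (\<omega> i s - \<omega> j s)\<close>.\<close>
  define P where "P s = exp (s / m) * (V - \<kappa> * Q + 2 * \<kappa> * H)
      - 2 * \<kappa> * (- W * s + G * ((s - m) * exp (s / m) + s))" for s
  define w where "w s = exp (s / m) * (\<omega> i s - \<omega> j s) - P s" for s
  have "w t \<le> w 0"
  proof (rule DERIV_nonpos_imp_decreasing_open[of 0 t])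
    show "0 \<le> t" using t by simp
  next
    show "continuous_on {0..t} w" unfolding w_def P_def using m_pos ijN
      by (intro continuous_intros continuous_on_subset[OF continuous_\<omega>]) auto
    fix s assume s: "0 < s" "s < t"
    have "(P has_real_derivative exp (s / m) / m * (V - \<kappa> * Q + 2 * \<kappa> * (H - path_bound B s))) (at s)"
    proof -
      have "exp (s / m) * exp (- s / m) = 1" by (simp add: exp_minus)
      then have path: "exp (s / m) * path_bound B s = - m * W + (s * exp (s / m) + m) * G"
        unfolding path_bound_def W_def V_def G_def by (simp add: algebra_simps)
      have "(P has_real_derivative exp (s / m) / m * (V - \<kappa> * Q + 2 * \<kappa> * H)
          - 2 * \<kappa> * (- W + G * ((s - m) * (exp (s / m) / m) + exp (s / m) + 1))) (at s)"
        unfolding P_def using m_pos by (auto intro!: derivative_eq_intros)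
      then show ?thesis
      proof (rule DERIV_cong)
        have "- W + G * ((s - m) * (exp (s / m) / m) + exp (s / m) + 1) = exp (s / m) * path_bound B s / m"
          unfolding path using m_pos by (simp add: field_simps)
        then show "exp (s / m) / m * (V - \<kappa> * Q + 2 * \<kappa> * H)
            - 2 * \<kappa> * (- W + G * ((s - m) * (exp (s / m) / m) + exp (s / m) + 1))
          = exp (s / m) / m * (V - \<kappa> * Q + 2 * \<kappa> * (H - path_bound B s))"
          by (simp only:) (simp add: algebra_simps)
      qed
    qed
    moreover have "((\<lambda>s. exp (s / m) * (\<omega> i s - \<omega> j s)) has_real_derivative
        exp (s / m) / m * ((\<nu> i - \<nu> j) + \<kappa> * (force i s - force j s))) (at s)"
      using s m_pos ijN by (auto intro!: derivative_eq_intros deriv_\<omega> simp: field_simps)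
    ultimately have "(w has_real_derivative exp (s / m) / m * ((\<nu> i - \<nu> j) + \<kappa> * (force i s - force j s))
        - exp (s / m) / m * (V - \<kappa> * Q + 2 * \<kappa> * (H - path_bound B s))) (at s)"
      unfolding w_def by (rule DERIV_diff[rotated])
    moreover have "exp (s / m) / m * ((\<nu> i - \<nu> j) + \<kappa> * (force i s - force j s))
        \<le> exp (s / m) / m * (V - \<kappa> * Q + 2 * \<kappa> * (H - path_bound B s))"
    proof (rule mult_left_mono)
      have "\<kappa> * (force i s - force j s) \<le> \<kappa> * (2 * (H - path_bound B s) - Q)"
        using force[of s] s \<kappa>_pos by (intro mult_left_mono) auto
      moreover have "\<nu> i - \<nu> j \<le> V" unfolding V_def by (rule diff_le_fam_diam[OF fin ij])
      ultimately show "(\<nu> i - \<nu> j) + \<kappa> * (force i s - force j s)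
          \<le> V - \<kappa> * Q + 2 * \<kappa> * (H - path_bound B s)" by (simp add: algebra_simps)
    qed (use m_pos in simp)
    ultimately show "\<exists>y. (w has_real_derivative y) (at s) \<and> y \<le> 0" by force
  qed
  also have "w 0 \<le> W - P 0"
    using diff_le_fam_diam[OF fin ij, of \<omega>0] initial_values ijN by (simp add: w_def W_def)
  finally have "E * (exp (t / m) * (\<omega> i t - \<omega> j t)) \<le> E * (W - P 0 + P t)"
    using E by (intro mult_left_mono) (auto simp: w_def)
  moreover have inv: "E * exp (t / m) = 1" by (simp add: E_def exp_minus)
  then have "E * (exp (t / m) * (\<omega> i t - \<omega> j t)) = \<omega> i t - \<omega> j t" by (simp flip: mult.assoc)
  ultimately have "\<omega> i t - \<omega> j t \<le> E * W + E * P t - E * P 0" by (simp add: algebra_simps)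
  also have "E * P t = (V - \<kappa> * Q + 2 * \<kappa> * H) - 2 * \<kappa> * (- W * t * E + G * ((t - m) + t * E))"
  proof -
    have "E * P t = (E * exp (t / m)) * (V - \<kappa> * Q + 2 * \<kappa> * H)
        - 2 * \<kappa> * (- W * t * E + G * ((t - m) * (E * exp (t / m)) + t * E))"
      by (simp add: P_def algebra_simps)
    then show ?thesis unfolding inv by simp
  qed
  also have "E * P 0 = E * (V - \<kappa> * Q + 2 * \<kappa> * H) + 2 * \<kappa> * G * m * E"
    by (simp add: P_def algebra_simps)
  also have "H = - m * E * W + (t + m * E) * G"
    by (simp add: H_def path_bound_def E_def W_def V_def G_def)
  also have "E * W + ((V - \<kappa> * Q + 2 * \<kappa> * (- m * E * W + (t + m * E) * G))
        - 2 * \<kappa> * (- W * t * E + G * ((t - m) + t * E)))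
      - (E * (V - \<kappa> * Q + 2 * \<kappa> * (- m * E * W + (t + m * E) * G)) + 2 * \<kappa> * G * m * E)
    = E * W + (1 - E) * (V - \<kappa> * Q)
      + 2 * \<kappa> * (W * (t * E - m * E * (1 - E)) + G * (m - 2 * t * E - m * E\<^sup>2))"
    by (simp add: algebra_simps power2_eq_square)
  also have "\<dots> \<le> E * W + (1 - E) * (V - \<kappa> * Q)
      + 2 * \<kappa> * (W * (t * E * (1 - E)) + G * (m * (1 - E)))"
  proof -
    \<comment> \<open>Both coefficients are compared by \<open>1 - x \<le> exp (- x) \<le> 1 / (1 + x)\<close> for \<open>x = t / m\<close>.\<close>
    have "1 + - t / m \<le> E" unfolding E_def by (rule exp_ge_add_one_self)
    then have 1: "m \<le> t + m * E" using m_pos by (simp add: field_simps)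
    have "1 + t / m \<le> exp (t / m)" by (rule exp_ge_add_one_self)
    then have "E * (1 + t / m) \<le> 1" using mult_left_mono[of "1 + t / m" "exp (t / m)" E] E inv by simp
    then have 2: "m * E + t * E \<le> m" using m_pos by (simp add: field_simps)
    have "E * (m * E + t * E) \<le> E * m" using 2 E by (intro mult_left_mono) auto
    then have a: "t * E - m * E * (1 - E) \<le> t * E * (1 - E)"
      by (simp add: algebra_simps)
    have "E * m \<le> E * (2 * t + m * E)" using 1 t E by (intro mult_left_mono) auto
    then have b: "m - 2 * t * E - m * E\<^sup>2 \<le> m * (1 - E)"
      by (simp add: algebra_simps power2_eq_square)
    show ?thesis using a b nonneg \<kappa>_pos
      by (intro add_left_mono mult_left_mono add_mono) auto
  qed
  also have "\<dots> = (1 - E) * \<kappa> * (delta m \<kappa> \<nu> B + transient B t - Q)"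
  proof -
    have 1: "\<kappa> * delta m \<kappa> \<nu> B = V + 2 * \<kappa> * (G * m)"
      using \<kappa>_pos unfolding delta_def V_def[symmetric] G_def by (simp add: distrib_left mult.commute mult.left_commute)
    have c: "(1 - E) * \<kappa> * (E / (\<kappa> * (1 - E))) = E" using E \<kappa>_pos by simp
    have "(1 - E) * \<kappa> * transient B t = W * ((1 - E) * \<kappa> * (E / (\<kappa> * (1 - E)))) + (1 - E) * \<kappa> * W * (2 * t * E)"
      unfolding transient_def E_def[symmetric] W_def[symmetric] by (simp only: distrib_left mult_ac)
    then have 2: "(1 - E) * \<kappa> * transient B t = W * E + (1 - E) * \<kappa> * W * (2 * t * E)"
      unfolding c .
    have "(1 - E) * \<kappa> * (delta m \<kappa> \<nu> B + transient B t - Q)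
        = (1 - E) * (\<kappa> * delta m \<kappa> \<nu> B) + (1 - E) * \<kappa> * transient B t - (1 - E) * \<kappa> * Q"
      by (simp only: distrib_left right_diff_distrib mult.assoc)
    then show ?thesis unfolding 1 2 by (simp add: algebra_simps)
  qed
  finally show ?thesis by (simp add: E_def Q_def)
qed

lemma transient_tendsto: "(transient B \<longlongrightarrow> 0) at_top"
proof -
  have "((\<lambda>t. exp (- t / m) / (\<kappa> * (1 - exp (- t / m))) + 2 * t * exp (- t / m)) \<longlongrightarrow> 0) at_top"
    using m_pos \<kappa>_pos by real_asymp
  from tendsto_mult_left[OF this, of "fam_diam B \<omega>0"] show ?thesis by (simp add: transient_def[abs_def])
qed

end


section \<open>Trapping of dominant clusters\<close>

lemma ensemble_concentrates_iff:
  "ensemble_concentrates lam d C \<theta> \<longleftrightarrow>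
    (\<forall>a>phi1 lam d. eventually (\<lambda>t. fam_diam C (\<lambda>i. \<theta> i t) \<le> a) at_top)"
  unfolding ensemble_concentrates_def by (rule Limsup_ereal_le_iff)

context inertial_kuramoto
begin

abbreviation spread :: "nat set \<Rightarrow> real \<Rightarrow> real" where
  "spread C t \<equiv> fam_diam C (\<lambda>i. \<theta> i t)"

abbreviation translated_spread :: "(nat \<Rightarrow> int) \<Rightarrow> nat set \<Rightarrow> real \<Rightarrow> real" where
  "translated_spread k C t \<equiv> fam_diam C (\<lambda>i. translate k \<theta> i t)"

abbreviation level :: "nat set \<Rightarrow> real" where
  "level B \<equiv> delta m \<kappa> \<nu> B"

lemma inertial_kuramoto_translate:
  "inertial_kuramoto N m \<kappa> \<nu> (\<lambda>i. \<theta>0 i - 2 * real_of_int (k i) * pi) \<omega>0 (translate k \<theta>) \<omega>"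
proof
  have per: "sin (translate k \<theta> j t - translate k \<theta> i t) = sin (\<theta> j t - \<theta> i t)" for i j t
  proof -
    have "translate k \<theta> j t - translate k \<theta> i t = (\<theta> j t - \<theta> i t) - (2 * pi) * of_int (k j - k i)"
      by (simp add: translate_def algebra_simps)
    then show ?thesis
      using sin_diff[of "\<theta> j t - \<theta> i t" "(2 * pi) * of_int (k j - k i)"]
      by (simp only: cos_int_2pin sin_int_2pin mult_1_right mult_zero_right diff_zero)
  qed
  have "(translate k \<theta> i has_real_derivative \<omega> i t) (at t within {0..})"
    if "(\<theta> i has_real_derivative \<omega> i t) (at t within {0..})" for i t
    using that unfolding translate_def[abs_def] by (auto intro!: derivative_eq_intros)
  then show "kuramoto_solution N m \<kappa> \<nu> (\<lambda>i. \<theta>0 i - 2 * real_of_int (k i) * pi) \<omega>0 (translate k \<theta>) \<omega>"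
    using solution unfolding kuramoto_solution_def per by (auto simp: translate_def)
qed (use N_pos m_pos \<kappa>_pos in auto)

lemma delta_pos:
  assumes "B \<subseteq> {1..N}"
  shows "4 * m * \<kappa> \<le> level B" and "0 < level B"
proof -
  have "0 \<le> fam_diam B \<nu>" using assms by (meson fam_diam_nonneg finite_atLeastAtMost finite_subset)
  then show "4 * m * \<kappa> \<le> level B" using m_pos \<kappa>_pos by (simp add: delta_def)
  moreover have "0 < 4 * m * \<kappa>" using m_pos \<kappa>_pos by simp
  ultimately show "0 < level B" by linarith
qed

text \<open>Below a line that descends more slowly than the extremal pairs approach each other, the
  diameter stays below it.\<close>

lemma diameter_below_line:
  assumes C: "C \<subseteq> {1..N}" "C \<noteq> {}" and T: "T > 0"
    and decay: "\<forall>t\<ge>T. \<forall>i\<in>C. \<forall>j\<in>C. \<theta> i t - \<theta> j t = spread C t \<longrightarrow>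
      a \<le> \<theta> i t - \<theta> j t \<longrightarrow> \<theta> i t - \<theta> j t \<le> c \<longrightarrow> \<omega> i t - \<omega> j t \<le> - r"
    and s: "s < r" and start: "T \<le> T0" "spread C T0 \<le> b"
    and line: "\<And>t. T0 \<le> t \<Longrightarrow> t \<le> S \<Longrightarrow> a \<le> b - s * (t - T0) \<and> b - s * (t - T0) \<le> c"
    and t: "T0 \<le> t" "t \<le> S"
  shows "spread C t \<le> b - s * (t - T0)"
proof -
  have fin: "finite C" using C finite_subset by blast
  define g where "g p u = (\<theta> (fst p) u - \<theta> (snd p) u) - (b - s * (u - T0))" for p u
  have bound: "g p t \<le> 0" if "p \<in> C \<times> C" for p
  proof (rule finite_family_barrier[where P = "C \<times> C" and T = T0 and S = S and g = g
      and g' = "\<lambda>p t. (\<omega> (fst p) t - \<omega> (snd p) t) + s"])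
    show "finite (C \<times> C)" using fin by simp
  next
    fix p u assume "p \<in> C \<times> C" and u: "T0 \<le> u" "u \<le> S"
    then have "fst p \<in> {1..N}" "snd p \<in> {1..N}" "u > 0" using C T start(1) by auto
    then show "(g p has_real_derivative (\<omega> (fst p) u - \<omega> (snd p) u) + s) (at u)"
      unfolding g_def using deriv_\<theta> by (auto intro!: derivative_eq_intros)
  next
    fix p assume "p \<in> C \<times> C"
    then show "g p T0 \<le> 0"
      using diff_le_fam_diam[OF fin, of "fst p" "snd p" "\<lambda>k. \<theta> k T0"] start(2) by (auto simp: g_def)
  next
    fix p u assume p: "p \<in> C \<times> C" and u: "T0 \<le> u" "u < S"
      and zero: "g p u = 0" and all: "\<forall>q\<in>C \<times> C. g q u \<le> 0"
    obtain i j where ij: "p = (i, j)" "i \<in> C" "j \<in> C" using p by blast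
    have eq: "\<theta> i u - \<theta> j u = b - s * (u - T0)" using zero ij by (simp add: g_def)
    have "spread C u \<le> b - s * (u - T0)"
      unfolding fam_diam_le_iff[OF fin C(2)] using all by (force simp: g_def)
    then have ext: "\<theta> i u - \<theta> j u = spread C u"
      using diff_le_fam_diam[OF fin ij(2,3), of "\<lambda>k. \<theta> k u"] unfolding eq by (intro antisym)
    have "a \<le> \<theta> i u - \<theta> j u" "\<theta> i u - \<theta> j u \<le> c" "T \<le> u"
      using line[of u] u start(1) unfolding eq by auto
    then have "\<omega> i u - \<omega> j u \<le> - r" using decay ij(2,3) ext by blast
    then show "(\<omega> (fst p) u - \<omega> (snd p) u) + s < 0" using s ij(1) by simp
  qed (use that t in auto)
  show ?thesis unfolding fam_diam_le_iff[OF fin C(2)]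
  proof (intro ballI)
    fix i j assume "i \<in> C" "j \<in> C"
    then show "\<theta> i t - \<theta> j t \<le> b - s * (t - T0)" using bound[of "(i, j)"] by (simp add: g_def)
  qed
qed

lemma damping_factor_mono:
  assumes "T \<le> t" "0 \<le> e"
  shows "(1 - exp (- t / m)) * \<kappa> * (- e) \<le> - ((1 - exp (- T / m)) * \<kappa> * e)"
proof -
  have "exp (- t / m) \<le> exp (- T / m)" using assms m_pos by (simp add: field_simps)
  then have "(1 - exp (- T / m)) * \<kappa> * e \<le> (1 - exp (- t / m)) * \<kappa> * e"
    using \<kappa>_pos assms by (intro mult_right_mono) auto
  then show ?thesis by simp
qed

text \<open>The diameter first stays below a line that descends from \<^term>\<open>c\<close> to \<^term>\<open>a\<close>, and
  then below the constant \<^term>\<open>a\<close>.\<close>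

lemma diameter_contracts:
  assumes C: "C \<subseteq> {1..N}" "C \<noteq> {}" and T: "T > 0"
    and decay: "\<forall>t\<ge>T. \<forall>i\<in>C. \<forall>j\<in>C. \<theta> i t - \<theta> j t = spread C t \<longrightarrow>
      a \<le> \<theta> i t - \<theta> j t \<longrightarrow> \<theta> i t - \<theta> j t \<le> c \<longrightarrow> \<omega> i t - \<omega> j t \<le> - r"
    and r: "r > 0" and ac: "a \<le> c" and start: "spread C T \<le> c"
  shows "\<And>t. t \<ge> T \<Longrightarrow> spread C t \<le> c"
    and "\<forall>\<^sub>F t in at_top. spread C t \<le> a"
proof -
  note line = diameter_below_line[OF C T decay]
  show "spread C t \<le> c" if "t \<ge> T" for t
    using line[of 0 T c t t] r ac start that by simp
  define T' where "T' = T + 2 * (c - a) / r"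
  have T': "T \<le> T'" using ac r by (simp add: T'_def)
  have "spread C T' \<le> c - r / 2 * (T' - T)"
  proof (rule line[where S = T'])
    fix t assume "T \<le> t" "t \<le> T'"
    then have "0 \<le> r / 2 * (t - T)" "r / 2 * (t - T) \<le> r / 2 * (T' - T)"
      using r by (auto intro!: mult_left_mono)
    then show "a \<le> c - r / 2 * (t - T) \<and> c - r / 2 * (t - T) \<le> c"
      using r by (simp add: T'_def)
  qed (use r start T' in auto)
  also have "\<dots> = a" using r by (simp add: T'_def field_simps)
  finally have *: "spread C T' \<le> a" .
  have "spread C t \<le> a" if "t \<ge> T'" for t
    using line[of 0 T' a t t] r ac * that T' by simp
  then show "\<forall>\<^sub>F t in at_top. spread C t \<le> a"
    by (auto simp: eventually_at_top_linorder)
qed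

text \<open>All members of a cluster lie between the two extremal ones, hence within half the diameter
  of their midpoint.\<close>

lemma extremal_pair_velocity:
  assumes B: "B \<subseteq> {1..N}" and C: "C \<subseteq> B" "lam * real N \<le> real (card C)"
    and ij: "i \<in> C" "j \<in> C" and t: "t > 0"
    and ext: "\<theta> i t - \<theta> j t = spread C t" and pi: "\<theta> i t - \<theta> j t \<le> pi"
  shows "\<omega> i t - \<omega> j t \<le> (1 - exp (- t / m)) * \<kappa> *
    (level B + transient B t - f_lam lam (\<theta> i t - \<theta> j t))"
proof -
  have fin: "finite C" using B C finite_subset by (meson finite_atLeastAtMost subset_trans)
  define D where "D = \<theta> i t - \<theta> j t"
  have D: "0 \<le> D" "D \<le> pi" using ext fam_diam_nonneg[OF fin] pi by (auto simp: D_def)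
  have "cos (D / 2) \<le> cos (\<theta> k t - (\<theta> i t + \<theta> j t) / 2)" if k: "k \<in> C" for k
  proof -
    have "\<theta> k t - \<theta> j t \<le> D" "\<theta> i t - \<theta> k t \<le> D"
      using diff_le_fam_diam[OF fin k ij(2), of "\<lambda>k. \<theta> k t"] diff_le_fam_diam[OF fin ij(1) k, of "\<lambda>k. \<theta> k t"]
        ext by (auto simp: D_def)
    then have "\<bar>\<theta> k t - (\<theta> i t + \<theta> j t) / 2\<bar> \<le> D / 2"
      unfolding D_def by (intro abs_leI) (simp_all add: field_simps)
    then have "cos (D / 2) \<le> cos \<bar>\<theta> k t - (\<theta> i t + \<theta> j t) / 2\<bar>"
      using D by (intro cos_monotone_0_pi_le) auto
    then show ?thesis by simp
  qed
  then show ?thesis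
    using ij C D unfolding f_lam_eq D_def
    by (intro first_order_velocity_estimate[OF B C _ _ t]) (auto intro: order_trans[OF _ pi_ge_zero])
qed

lemma cluster_contracts:
  assumes B: "B \<subseteq> {1..N}" and C: "C \<subseteq> B" "lam * real N \<le> real (card C)" "lam > 0"
    and T: "T > 0" and e: "e > 0" and ac: "a \<le> c" "c \<le> pi"
    and gap: "\<And>t x. T \<le> t \<Longrightarrow> a \<le> x \<Longrightarrow> x \<le> c \<Longrightarrow> level B + transient B t + e \<le> f_lam lam x"
    and start: "spread C T \<le> c"
  shows "\<And>t. t \<ge> T \<Longrightarrow> spread C t \<le> c"
    and "\<forall>\<^sub>F t in at_top. spread C t \<le> a"
proof -
  have CN: "C \<subseteq> {1..N}" using B C by blast
  have ne: "C \<noteq> {}" using C(2,3) N_pos by (auto simp: mult_le_0_iff)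
  define r where "r = (1 - exp (- T / m)) * \<kappa> * e"
  have r: "r > 0" using T m_pos \<kappa>_pos e by (simp add: r_def)
  have "\<omega> i t - \<omega> j t \<le> - r"
    if "T \<le> t" "i \<in> C" "j \<in> C" "\<theta> i t - \<theta> j t = spread C t"
      "a \<le> \<theta> i t - \<theta> j t" "\<theta> i t - \<theta> j t \<le> c" for t i j
  proof -
    have "\<omega> i t - \<omega> j t \<le> (1 - exp (- t / m)) * \<kappa> *
        (level B + transient B t - f_lam lam (\<theta> i t - \<theta> j t))"
      using that T ac by (intro extremal_pair_velocity[OF B C(1,2)]) auto
    also have "\<dots> \<le> (1 - exp (- t / m)) * \<kappa> * (- e)"
      using gap[of t "\<theta> i t - \<theta> j t"] that T m_pos \<kappa>_pos by (intro mult_left_mono) auto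
    also have "\<dots> \<le> - r" unfolding r_def using that e by (intro damping_factor_mono) auto
    finally show ?thesis .
  qed
  then have decay: "\<forall>t\<ge>T. \<forall>i\<in>C. \<forall>j\<in>C. \<theta> i t - \<theta> j t = spread C t \<longrightarrow>
      a \<le> \<theta> i t - \<theta> j t \<longrightarrow> \<theta> i t - \<theta> j t \<le> c \<longrightarrow> \<omega> i t - \<omega> j t \<le> - r" by blast
  show "\<And>t. t \<ge> T \<Longrightarrow> spread C t \<le> c"
    by (rule diameter_contracts(1)[OF CN ne T decay r ac(1) start])
  show "\<forall>\<^sub>F t in at_top. spread C t \<le> a"
    by (rule diameter_contracts(2)[OF CN ne T decay r ac(1) start])
qed

text \<open>Between the two roots the attraction \<^term>\<open>f_lam lam\<close> exceeds the level \<^term>\<open>delta m \<kappa> \<nu> B\<close>,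
  on compact intervals by a positive margin, which the transient cannot use up for ever.\<close>

lemma eventually_force_dominates:
  assumes lam: "1 / 2 < lam" "lam \<le> 1" and l: "0 < l" "l < 2 * arccos ((1 - lam) / lam)"
    and B: "B \<subseteq> {1..N}" and d: "level B < f_lam lam l"
    and ac: "phi1 lam (level B) < a" "a \<le> c" "c < phi2 lam (level B)"
  obtains T e where "T > 0" "e > 0"
    "\<And>t x. T \<le> t \<Longrightarrow> a \<le> x \<Longrightarrow> x \<le> c \<Longrightarrow> level B + transient B t + e \<le> f_lam lam x"
proof -
  note roots = f_lam_two_roots[OF lam l delta_pos(2)[OF B] d]
  have "continuous_on {a..c} (f_lam lam)"
    using f_lam_deriv by (meson DERIV_isCont continuous_at_imp_continuous_on)
  then obtain x0 where x0: "x0 \<in> {a..c}" "\<And>x. x \<in> {a..c} \<Longrightarrow> f_lam lam x0 \<le> f_lam lam x"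
    using continuous_attains_inf[of "{a..c}" "f_lam lam"] ac(2) by auto
  define e where "e = (f_lam lam x0 - level B) / 2"
  have e: "e > 0" using roots(7)[of x0] x0(1) ac by (simp add: e_def)
  have "\<forall>\<^sub>F t in at_top. transient B t < e" using order_tendstoD(2)[OF transient_tendsto] e by simp
  then have "\<forall>\<^sub>F t in at_top. 0 < t \<and> transient B t < e"
    by (rule eventually_conj[OF eventually_gt_at_top])
  then obtain T where "\<forall>t\<ge>T. 0 < t \<and> transient B t < e"
    unfolding eventually_at_top_linorder by blast
  then have T: "0 < T" "\<And>t. T \<le> t \<Longrightarrow> transient B t < e" by auto
  show thesis
  proof (rule that[OF T(1) e])
    fix t x assume "T \<le> t" "a \<le> x" "x \<le> c"
    then show "level B + transient B t + e \<le> f_lam lam x"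
      using T(2)[of t] x0(2)[of x] by (simp add: e_def field_simps)
  qed
qed

text \<open>A dominant cluster whose diameter returns below some level under the second root at
  arbitrarily late times returns there when the transient has become negligible, and is then trapped.\<close>

lemma cluster_concentrates:
  assumes lam: "1 / 2 < lam" "lam \<le> 1" and l: "0 < l" "l < 2 * arccos ((1 - lam) / lam)"
    and B: "B \<subseteq> {1..N}" and d: "level B < f_lam lam l"
    and C: "C \<subseteq> B" "lam * real N \<le> real (card C)"
    and c: "c < phi2 lam (level B)"
    and late: "\<And>T. \<exists>t\<ge>T. spread C t \<le> c"
  shows "ensemble_concentrates lam (level B) C \<theta>"
  unfolding ensemble_concentrates_iff
proof (intro allI impI)
  fix a' assume a': "phi1 lam (level B) < a'"
  note roots = f_lam_two_roots[OF lam l delta_pos(2)[OF B] d]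
  obtain a where a: "phi1 lam (level B) < a" "a < min a' (phi2 lam (level B))"
    using dense[of "phi1 lam (level B)" "min a' (phi2 lam (level B))"] a' roots(2,3) by auto
  define b where "b = max a c"
  have b: "a \<le> b" "c \<le> b" "b < phi2 lam (level B)" using a c by (auto simp: b_def)
  obtain T e where T: "T > 0" "e > 0" and
    gap: "\<And>t x. T \<le> t \<Longrightarrow> a \<le> x \<Longrightarrow> x \<le> b \<Longrightarrow> level B + transient B t + e \<le> f_lam lam x"
    using eventually_force_dominates[OF lam l B d a(1) b(1,3)] by blast
  obtain t0 where t0: "t0 \<ge> T" "spread C t0 \<le> c" using late by blast
  have "arccos ((1 - lam) / lam) \<le> pi / 2" using lam arccos_le_pi2[of "(1 - lam) / lam"] by simp
  then have "b \<le> pi" using b(3) roots(5) by simp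
  then have "\<forall>\<^sub>F t in at_top. spread C t \<le> a"
    using T t0 b lam gap by (intro cluster_contracts(2)[OF B C, where T = t0 and e = e and c = b]) auto
  then show "\<forall>\<^sub>F t in at_top. spread C t \<le> a'"
    by eventually_elim (use a in auto)
qed

lemma initial_diameter_bound:
  assumes A: "A \<subseteq> {1..N}" "A \<noteq> {}" and eta: "\<eta> > 0"
    and initial: "fam_diam A \<theta>0 \<le> ell - m * (1 - exp (- \<eta>)) * fam_diam A \<omega>0
          - (\<eta> * m - m + m * exp (- \<eta>)) * (fam_diam A \<nu> + 2 * \<kappa>)"
  shows "fam_diam A (\<lambda>i. \<theta> i (\<eta> * m)) \<le> ell"
proof -
  have fin: "finite A" using A finite_subset by blast
  have path: "path_bound A (\<eta> * m) - path_bound A 0 = m * (1 - exp (- \<eta>)) * fam_diam A \<omega>0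
      + (\<eta> * m - m + m * exp (- \<eta>)) * (fam_diam A \<nu> + 2 * \<kappa>)"
    using m_pos by (simp add: path_bound_def algebra_simps)
  show ?thesis unfolding fam_diam_le_iff[OF fin A(2)]
  proof (intro ballI)
    fix i j assume ij: "i \<in> A" "j \<in> A"
    have "\<bar>(\<theta> i 0 - \<theta> j 0) - (\<theta> i (\<eta> * m) - \<theta> j (\<eta> * m))\<bar> \<le> path_bound A (\<eta> * m) - path_bound A 0"
      using eta m_pos by (intro relative_displacement_le[OF A(1) ij]) auto
    moreover have "\<theta> i 0 - \<theta> j 0 \<le> fam_diam A \<theta>0"
      using diff_le_fam_diam[OF fin ij, of \<theta>0] initial_values(1)[of i] initial_values(1)[of j] ij A
      by (simp add: subset_iff)
    ultimately show "\<theta> i (\<eta> * m) - \<theta> j (\<eta> * m) \<le> ell"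
      using initial path by linarith
  qed
qed

text \<open>The supremum of \<^term>\<open>t * exp (- t / m)\<close> over \<^term>\<open>t \<ge> \<eta> * m\<close> is attained at
  \<^term>\<open>t = m * max 1 \<eta>\<close>.\<close>

lemma delta_transient_le_xi:
  assumes A: "A \<subseteq> {1..N}" and eta: "\<eta> > 0" and t: "t \<ge> \<eta> * m"
  shows "level A + transient A t \<le> 2 * xi m \<kappa> \<nu> \<omega>0 A \<eta>"
proof -
  have fin: "finite A" using A finite_subset by blast
  define x where "x = t / m"
  have x: "x \<ge> \<eta>" "t = m * x" using t m_pos by (auto simp: x_def field_simps)
  then have "x > 0" using eta by simp
  have 1: "x * exp (- x) \<le> max 1 \<eta> * exp (- max 1 \<eta>)"
  proof (cases "x \<le> max 1 \<eta>")
    case True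
    then have "max 1 \<eta> = x \<or> max 1 \<eta> = 1" using x by auto
    moreover have "x * exp (- x) \<le> exp (-1)"
      using exp_ge_add_one_self[of "x - 1"] by (simp add: exp_diff exp_minus field_simps)
    ultimately show ?thesis by auto
  next
    case False
    define y where "y = max 1 \<eta>"
    have y: "y \<ge> 1" "y < x" using False by (auto simp: y_def)
    have "x \<le> y * (1 + (x - y))" using y mult_right_mono[of 1 y "x - y"] by (simp add: algebra_simps)
    also have "\<dots> \<le> y * exp (x - y)" using exp_ge_add_one_self[of "x - y"] y by (intro mult_left_mono) auto
    finally have "x \<le> y * exp (x - y)" .
    then show ?thesis unfolding y_def[symmetric] by (simp add: exp_diff exp_minus field_simps)
  qed
  have "exp (- x) \<le> exp (- \<eta>)" "exp (- \<eta>) < 1" using x eta by auto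
  then have 2: "exp (- x) / (1 - exp (- x)) \<le> exp (- \<eta>) / (1 - exp (- \<eta>))"
    by (intro frac_le) auto
  have "transient A t = fam_diam A \<omega>0 * (exp (- x) / (1 - exp (- x)) / \<kappa> + 2 * m * (x * exp (- x)))"
    using m_pos unfolding transient_def x(2) by (simp add: field_simps)
  also have "\<dots> \<le> fam_diam A \<omega>0 * (exp (- \<eta>) / (1 - exp (- \<eta>)) / \<kappa> + 2 * m * (max 1 \<eta> * exp (- max 1 \<eta>)))"
    using fam_diam_nonneg[OF fin] \<kappa>_pos m_pos 1 2
    by (intro mult_left_mono add_mono divide_right_mono) auto
  finally have 3: "transient A t \<le> fam_diam A \<omega>0 *
      (exp (- \<eta>) / (1 - exp (- \<eta>)) / \<kappa> + 2 * m * (max 1 \<eta> * exp (- max 1 \<eta>)))" .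
  define R where "R = exp (- \<eta>) / (1 - exp (- \<eta>))"
  show ?thesis using 3 unfolding xi_def delta_def R_def[symmetric] by (simp add: algebra_simps)
qed

end


section \<open>Phase differences within a concentrated cluster\<close>

text \<open>For \<^prop>\<open>b = 1\<close> the equation \<^prop>\<open>m * u' + u + \<kappa> * b * y = \<kappa> * s\<close> is an overdamped
  oscillator, whose response operator is positive.  The deviation of \<^term>\<open>b\<close> from one is put
  into the forcing \<^term>\<open>s + (1 - b) * y\<close>.  An asymptotic lower bound \<^term>\<open>- l\<close> for \<^term>\<open>y\<close>
  then improves to \<^term>\<open>- (1 - \<beta>) * l\<close>, and iteration gives zero.\<close>

lemma variable_stiffness_eventually_nonneg:
  fixes y u u' g :: "real \<Rightarrow> real"
  assumes m: "m > 0" and k: "\<kappa> > 0" "4 * m * \<kappa> \<le> 1"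
    and dy: "\<And>t. t > 0 \<Longrightarrow> (y has_real_derivative u t) (at t)"
    and du: "\<And>t. t > 0 \<Longrightarrow> (u has_real_derivative u' t) (at t)"
    and eq: "\<And>t. t > 0 \<Longrightarrow> m * u' t + u t + \<kappa> * y t = \<kappa> * g t"
    and \<beta>: "0 < \<beta>" "\<beta> \<le> 1"
    and g: "\<forall>\<^sub>F t in at_top. \<exists>b. \<beta> \<le> b \<and> b \<le> 1 \<and> (1 - b) * y t \<le> g t"
    and bd: "\<forall>\<^sub>F t in at_top. - M \<le> y t"
    and e: "e > 0"
  shows "\<forall>\<^sub>F t in at_top. - e \<le> y t"
proof -
  define q where "q = 1 - \<beta>"
  have q: "0 \<le> q" "q < 1" using \<beta> by (auto simp: q_def)
  have step: "\<forall>\<^sub>F t in at_top. - (q * l) - e \<le> y t"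
    if l: "l \<ge> 0" "\<forall>\<^sub>F t in at_top. - l \<le> y t" and e: "e > 0" for l e
  proof (rule overdamped_eventually_ge[OF m k dy du eq _ e])
    show "\<forall>\<^sub>F t in at_top. - (q * l) \<le> g t"
      using g l(2)
    proof eventually_elim
      case (elim t)
      then obtain b where b: "\<beta> \<le> b" "b \<le> 1" "(1 - b) * y t \<le> g t" by blast
      have "(1 - b) * l \<le> q * l" using b l(1) by (intro mult_right_mono) (auto simp: q_def)
      moreover have "(1 - b) * (- l) \<le> (1 - b) * y t" using elim b by (intro mult_left_mono) auto
      ultimately show ?case using b(3) by simp
    qed
  qed
  have bound: "\<forall>\<^sub>F t in at_top. - (q ^ n * max M 0) - e \<le> y t" if e: "e > 0" for n e
    using e
  proof (induction n arbitrary: e)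
    case 0
    from bd show ?case by eventually_elim (use 0 in auto)
  next
    case (Suc n)
    have "\<forall>\<^sub>F t in at_top. - (q ^ n * max M 0 + e / 2) \<le> y t"
      using Suc.IH[of "e / 2"] Suc.prems by (auto elim!: eventually_mono)
    from step[OF _ this, of "e / 2"]
    have "\<forall>\<^sub>F t in at_top. - (q * (q ^ n * max M 0 + e / 2)) - e / 2 \<le> y t"
      using q Suc.prems by simp
    then show ?case
    proof eventually_elim
      case (elim t)
      have "q * (e / 2) \<le> 1 * (e / 2)" using q Suc.prems by (intro mult_right_mono) auto
      then show ?case using elim by (simp add: algebra_simps)
    qed
  qed
  have "(\<lambda>n. q ^ n * max M 0) \<longlonglongrightarrow> 0"
    using tendsto_mult_right[OF LIMSEQ_power_zero[of q], of "max M 0"] q by simp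
  then have "\<forall>\<^sub>F n in sequentially. q ^ n * max M 0 < e / 2"
    by (rule order_tendstoD(2)) (use e in simp)
  then obtain n where "q ^ n * max M 0 < e / 2" by (auto dest: eventually_happens)
  with bound[of "e / 2" n] e show ?thesis by (auto elim!: eventually_mono)
qed

text \<open>The difference \<^term>\<open>a / \<beta> - y\<close> solves the same equation, with the non-negative forcing
  \<^term>\<open>a * (b / \<beta> - 1)\<close> in place of \<^term>\<open>a\<close>.\<close>

lemma overdamped_variable_stiffness:
  fixes y u u' g :: "real \<Rightarrow> real"
  assumes m: "m > 0" and k: "\<kappa> > 0" "4 * m * \<kappa> \<le> 1"
    and dy: "\<And>t. t > 0 \<Longrightarrow> (y has_real_derivative u t) (at t)"
    and du: "\<And>t. t > 0 \<Longrightarrow> (u has_real_derivative u' t) (at t)"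
    and eq: "\<And>t. t > 0 \<Longrightarrow> m * u' t + u t + \<kappa> * y t = \<kappa> * g t"
    and a: "a \<ge> 0" and \<beta>: "0 < \<beta>" "\<beta> \<le> 1"
    and g: "\<forall>\<^sub>F t in at_top. \<exists>b. \<beta> \<le> b \<and> b \<le> 1 \<and> g t = a + (1 - b) * y t"
    and bd: "\<forall>\<^sub>F t in at_top. \<bar>y t\<bar> \<le> M"
    and e: "e > 0"
  shows "\<forall>\<^sub>F t in at_top. a - e \<le> y t" and "\<forall>\<^sub>F t in at_top. y t \<le> a / \<beta> + e"
proof -
  have "\<forall>\<^sub>F t in at_top. - (e / 2) \<le> y t"
  proof (rule variable_stiffness_eventually_nonneg[OF m k dy du eq \<beta>])
    show "\<forall>\<^sub>F t in at_top. \<exists>b. \<beta> \<le> b \<and> b \<le> 1 \<and> (1 - b) * y t \<le> g t"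
      using g by eventually_elim (use a in force)
    show "\<forall>\<^sub>F t in at_top. - M \<le> y t" using bd by eventually_elim auto
  qed (use e in auto)
  with g have "\<forall>\<^sub>F t in at_top. a - e / 2 \<le> g t"
  proof eventually_elim
    case (elim t)
    then obtain b where b: "\<beta> \<le> b" "b \<le> 1" "g t = a + (1 - b) * y t" by blast
    have "(1 - b) * (- (e / 2)) \<le> (1 - b) * y t" using elim(2) b by (intro mult_left_mono) auto
    moreover have "(1 - b) * (e / 2) \<le> 1 * (e / 2)" using b \<beta> e by (intro mult_right_mono) auto
    ultimately show ?case using b(3) by simp
  qed
  from overdamped_eventually_ge[OF m k dy du eq this, of "e / 2"] e
  show "\<forall>\<^sub>F t in at_top. a - e \<le> y t" by simp
  have "\<forall>\<^sub>F t in at_top. - e \<le> a / \<beta> - y t"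
  proof (rule variable_stiffness_eventually_nonneg[OF m k _ _ _ \<beta>,
      where u = "\<lambda>t. - u t" and u' = "\<lambda>t. - u' t" and g = "\<lambda>t. a / \<beta> - g t"])
    show "((\<lambda>t. a / \<beta> - y t) has_real_derivative - u t) (at t)" if "t > 0" for t
      using dy[OF that] by (auto intro!: derivative_eq_intros)
    show "m * - u' t + - u t + \<kappa> * (a / \<beta> - y t) = \<kappa> * (a / \<beta> - g t)" if "t > 0" for t
      using eq[OF that] by (simp add: algebra_simps)
    show "\<forall>\<^sub>F t in at_top. \<exists>b. \<beta> \<le> b \<and> b \<le> 1 \<and> (1 - b) * (a / \<beta> - y t) \<le> a / \<beta> - g t"
      using g
    proof eventually_elim
      case (elim t)
      then obtain b where b: "\<beta> \<le> b" "b \<le> 1" "g t = a + (1 - b) * y t" by blast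
      have "a / \<beta> * \<beta> \<le> a / \<beta> * b" using b a \<beta> by (intro mult_left_mono) auto
      then have "a \<le> a / \<beta> * b" using \<beta> by simp
      moreover have "(1 - b) * (c - y t) = c - c * b - (1 - b) * y t" for c by (simp add: algebra_simps)
      ultimately have "(1 - b) * (a / \<beta> - y t) \<le> a / \<beta> - g t" unfolding b(3) by simp
      then show ?case using b by blast
    qed
    show "\<forall>\<^sub>F t in at_top. - (M - a / \<beta>) \<le> a / \<beta> - y t" using bd by eventually_elim auto
  qed (use e du in \<open>auto intro: DERIV_minus\<close>)
  then show "\<forall>\<^sub>F t in at_top. y t \<le> a / \<beta> + e" by eventually_elim simp
qed

lemma coupling_difference_eq:
  "coupling N x i - coupling N x j =
    - 2 * sin ((x i - x j) / 2) * ((\<Sum>k=1..N. cos (x k - (x i + x j) / 2)) / real N)"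
proof -
  have "sin (x k - x i) - sin (x k - x j) = - 2 * sin ((x i - x j) / 2) * cos (x k - (x i + x j) / 2)" for k
  proof -
    have "(x k - x i - (x k - x j)) / 2 = - ((x i - x j) / 2)"
      "(x k - x i + (x k - x j)) / 2 = x k - (x i + x j) / 2" by (simp_all add: field_simps)
    then show ?thesis unfolding sin_diff_sin by (simp only: sin_minus)
  qed
  then show ?thesis unfolding coupling_def
    by (simp add: sum_distrib_left flip: sum_subtractf diff_divide_distrib)
qed

lemma mean_cos_lower_bound:
  fixes z :: "nat \<Rightarrow> real"
  assumes N: "N \<ge> 1" and C: "C \<subseteq> {1..N}" "lam * real N \<le> real (card C)"
    and q: "\<And>k. k \<in> C \<Longrightarrow> q \<le> cos (z k)" "- 1 \<le> q"
  shows "lam * q - (1 - lam) \<le> (\<Sum>k=1..N. cos (z k)) / real N"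
proof -
  have "(\<Sum>k=1..N. (if k \<in> C then 1 + q else 0) - 1) \<le> (\<Sum>k=1..N. cos (z k))"
    using q by (intro sum_mono) auto
  moreover have "{1..N} \<inter> C = C" using C by blast
  ultimately have "real (card C) * (1 + q) - real N \<le> (\<Sum>k=1..N. cos (z k))"
    by (simp add: sum_subtractf sum.If_cases)
  moreover have "lam * real N * (1 + q) \<le> real (card C) * (1 + q)"
    using C(2) q(2) by (intro mult_right_mono) auto
  ultimately show ?thesis using N by (simp add: field_simps)
qed

text \<open>For two members at the signed distance \<^term>\<open>y\<close>, the coefficient \<^term>\<open>b\<close> is
  \<^term>\<open>sin (y / 2) / (y / 2)\<close> times the mean of the cosines of all phases relative to the midpoint of the
  two.  Both factors are at most one, and the diameter bounds both from below.\<close>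

lemma cluster_stiffness:
  fixes \<theta> :: "nat \<Rightarrow> real"
  assumes N: "N \<ge> 1" and C: "C \<subseteq> {1..N}" "lam * real N \<le> real (card C)"
    and ij: "i \<in> C" "j \<in> C" and diam: "fam_diam C \<theta> \<le> x" and x: "0 < x" "x \<le> pi"
    and pos: "0 \<le> lam * cos x - (1 - lam)" and lam: "lam \<le> 1"
  shows "\<exists>b. sin (x / 2) / (x / 2) * (lam * cos x - (1 - lam)) \<le> b \<and> b \<le> 1 \<and>
    coupling N \<theta> i - coupling N \<theta> j = - b * (\<theta> i - \<theta> j)"
proof -
  have fin: "finite C" using C finite_subset by blast
  define y where "y = \<theta> i - \<theta> j"
  define K where "K = (\<Sum>k=1..N. cos (\<theta> k - (\<theta> i + \<theta> j) / 2)) / real N"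
  define k0 where "k0 = lam * cos x - (1 - lam)"
  have y: "\<bar>y\<bar> \<le> x"
    using diff_le_fam_diam[OF fin ij, of \<theta>] diff_le_fam_diam[OF fin ij(2,1), of \<theta>] diam by (auto simp: y_def)
  have "(\<Sum>k=1..N. cos (\<theta> k - (\<theta> i + \<theta> j) / 2)) \<le> (\<Sum>k=1..N. 1)" by (intro sum_mono) simp
  then have K1: "K \<le> 1" using N by (simp add: K_def field_simps)
  have K0: "k0 \<le> K"
    unfolding k0_def K_def
  proof (rule mean_cos_lower_bound[OF N C])
    fix k assume k: "k \<in> C"
    have "\<theta> k - \<theta> i \<le> x" "\<theta> i - \<theta> k \<le> x" "\<theta> k - \<theta> j \<le> x" "\<theta> j - \<theta> k \<le> x"
      using diff_le_fam_diam[OF fin, of _ _ \<theta>] k ij diam by (meson order_trans)+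
    then have "\<bar>\<theta> k - (\<theta> i + \<theta> j) / 2\<bar> \<le> x" by (intro abs_leI) (simp_all add: field_simps)
    then have "cos x \<le> cos \<bar>\<theta> k - (\<theta> i + \<theta> j) / 2\<bar>" using x by (intro cos_monotone_0_pi_le) auto
    then show "cos x \<le> cos (\<theta> k - (\<theta> i + \<theta> j) / 2)" by simp
  qed simp
  have "K \<ge> 0" using K0 pos by (simp add: k0_def)
  have F: "coupling N \<theta> i - coupling N \<theta> j = - 2 * sin (y / 2) * K"
    unfolding coupling_difference_eq y_def K_def ..
  have sinx: "0 \<le> sin (x / 2) / (x / 2)" "sin (x / 2) / (x / 2) \<le> 1"
    using x sin_x_le_x[of "x / 2"] by (auto intro!: divide_nonneg_nonneg sin_ge_zero simp: field_simps)
  show ?thesis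
  proof (cases "y = 0")
    case True
    have "k0 \<le> 1" using K0 K1 by simp
    then have "sin (x / 2) / (x / 2) * k0 \<le> 1 * 1"
      using sinx pos by (intro mult_mono) (auto simp: k0_def)
    then show ?thesis using True F unfolding y_def k0_def by (intro exI[of _ 1]) auto
  next
    case False
    define r where "r = sin (\<bar>y\<bar> / 2) / (\<bar>y\<bar> / 2)"
    define b where "b = r * K"
    have r: "sin (x / 2) / (x / 2) \<le> r"
      unfolding r_def using False y x by (intro sin_quotient_antimono) auto
    have "r \<le> 1"
      unfolding r_def using sin_x_le_x[of "\<bar>y\<bar> / 2"] False by (simp add: field_simps)
    then have "b \<le> 1 * 1" unfolding b_def using K1 \<open>K \<ge> 0\<close> by (intro mult_mono) auto
    moreover have "sin (x / 2) / (x / 2) * k0 \<le> b"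
      unfolding b_def using r sinx K0 pos by (intro mult_mono) (auto simp: k0_def)
    moreover have "- 2 * sin (y / 2) * K = - b * y"
    proof (cases "y > 0")
      case True then show ?thesis by (simp add: b_def r_def)
    next
      case neg: False
      then have "sin (\<bar>y\<bar> / 2) = - sin (y / 2)" by (simp flip: sin_minus)
      then show ?thesis using neg False by (simp add: b_def r_def)
    qed
    ultimately show ?thesis using F unfolding y_def k0_def by auto
  qed
qed

context inertial_kuramoto
begin

text \<open>Every \<^term>\<open>x\<close> beyond the first root is eventually a bound for the diameter, and gives a
  lower bound for the stiffness.  By continuity this bound may be replaced in the limit by its value at the
  root, which is positive below the threshold.  The motion is overdamped because
  \<^term>\<open>4 * m * \<kappa>\<close> is at most \<^term>\<open>delta m \<kappa> \<nu> B\<close>, hence less than a value of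
  \<^term>\<open>f_lam lam\<close>, which is at most one.\<close>

lemma phase_differences_of_concentrated_cluster:
  assumes lam: "1 / 2 < lam" "lam \<le> 1" and l: "0 < l" "l < 2 * arccos ((1 - lam) / lam)"
    and B: "B \<subseteq> {1..N}" and d: "level B < f_lam lam l"
    and C: "C \<subseteq> {1..N}" "lam * real N \<le> real (card C)"
    and conc: "ensemble_concentrates lam (level B) C \<theta>"
    and thr: "level B < delta_threshold lam"
  shows "phase_difference_bounds lam \<kappa> \<nu> (phi1 lam (level B)) C \<theta>"
  unfolding phase_difference_bounds_def
proof (intro ballI impI)
  fix i j assume ij: "i \<in> C" "j \<in> C" and \<nu>: "\<nu> i \<ge> \<nu> j"
  note roots = f_lam_two_roots[OF lam l delta_pos(2)[OF B] d]
  have ijN: "i \<in> {1..N}" "j \<in> {1..N}" using ij C by auto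
  have fin: "finite C" using C finite_subset by blast
  define \<phi> where "\<phi> = phi1 lam (level B)"
  define \<beta> where "\<beta> x = sin (x / 2) / (x / 2) * (lam * cos x - (1 - lam))" for x
  define a where "a = (\<nu> i - \<nu> j) / \<kappa>"
  define y where "y t = \<theta> i t - \<theta> j t" for t
  have a: "a \<ge> 0" using \<nu> \<kappa>_pos by (simp add: a_def)
  have \<phi>: "0 < \<phi>" "\<phi> < pi / 2" using roots(1,4) by (auto simp: \<phi>_def)
  have cpos: "lam * cos \<phi> - (1 - lam) > 0" using below_threshold[OF lam l delta_pos(2)[OF B] d thr] by (simp add: \<phi>_def)
  have "0 < sin (\<phi> / 2)" using \<phi> by (intro sin_gt_zero) auto
  then have \<beta>pos: "\<beta> \<phi> > 0" unfolding \<beta>_def using \<phi> cpos by (intro mult_pos_pos divide_pos_pos) auto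
  have km: "4 * m * \<kappa> \<le> 1"
  proof -
    have "arccos ((1 - lam) / lam) \<le> pi / 2" using lam arccos_le_pi2[of "(1 - lam) / lam"] by simp
    then have "0 \<le> sin (l / 2)" using l by (intro sin_ge_zero) auto
    then have "0 \<le> 2 * (1 - lam) * sin (l / 2)" using lam by simp
    moreover have "lam * sin l \<le> lam * 1" using lam by (intro mult_left_mono) auto
    ultimately have "f_lam lam l \<le> 1" unfolding f_lam_def using lam by linarith
    then show ?thesis using d delta_pos(1)[OF B] by linarith
  qed
  define g where "g t = a + y t + (force i t - force j t)" for t
  have eq: "m * ((\<nu> i + \<kappa> * force i t - \<omega> i t) / m - (\<nu> j + \<kappa> * force j t - \<omega> j t) / m)
      + (\<omega> i t - \<omega> j t) + \<kappa> * y t = \<kappa> * g t" for t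
  proof -
    have 1: "m * (p / m - q / m) = p - q" for p q using m_pos by (simp add: right_diff_distrib)
    have 2: "\<kappa> * a = \<nu> i - \<nu> j" using \<kappa>_pos by (simp add: a_def)
    show ?thesis unfolding 1 g_def distrib_left 2 by (simp add: right_diff_distrib)
  qed
  have near: "\<forall>\<^sub>F t in at_top. y t \<le> a / b + e" "\<forall>\<^sub>F t in at_top. a - e \<le> y t"
    if b: "0 < b" "b < \<beta> \<phi>" and e: "e > 0" for b e
  proof -
    have "isCont \<beta> \<phi>" unfolding \<beta>_def using \<phi> by (intro continuous_intros) auto
    then have "(\<beta> \<longlongrightarrow> \<beta> \<phi>) (at_right \<phi>)" by (simp add: isCont_def filterlim_at_split)
    then have 1: "\<forall>\<^sub>F x in at_right \<phi>. b < \<beta> x" using b(2) by (rule order_tendstoD)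
    have "isCont (\<lambda>x. lam * cos x - (1 - lam)) \<phi>" by (intro continuous_intros)
    then have "((\<lambda>x. lam * cos x - (1 - lam)) \<longlongrightarrow> lam * cos \<phi> - (1 - lam)) (at_right \<phi>)"
      by (simp add: isCont_def filterlim_at_split)
    then have 2: "\<forall>\<^sub>F x in at_right \<phi>. 0 < lam * cos x - (1 - lam)" using cpos by (rule order_tendstoD)
    have 3: "\<forall>\<^sub>F x in at_right \<phi>. x \<in> {\<phi><..<pi}" using \<phi> by (intro eventually_at_right_real) auto
    have "\<forall>\<^sub>F x in at_right \<phi>. b < \<beta> x \<and> 0 < lam * cos x - (1 - lam) \<and> x \<in> {\<phi><..<pi}"
      using 1 2 3 by eventually_elim simp
    then obtain x where x: "b < \<beta> x" "0 < lam * cos x - (1 - lam)" "\<phi> < x" "x < pi"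
      by (auto dest: eventually_happens)
    have diam: "\<forall>\<^sub>F t in at_top. spread C t \<le> x"
      using conc x(3) unfolding ensemble_concentrates_iff \<phi>_def by blast
    have bd: "\<forall>\<^sub>F t in at_top. \<bar>y t\<bar> \<le> x"
      using diam
    proof eventually_elim
      case (elim t)
      then show ?case
        using diff_le_fam_diam[OF fin ij, of "\<lambda>k. \<theta> k t"] diff_le_fam_diam[OF fin ij(2,1), of "\<lambda>k. \<theta> k t"]
        by (auto simp: y_def)
    qed
    have stiff: "\<forall>\<^sub>F t in at_top. \<exists>b. \<beta> x \<le> b \<and> b \<le> 1 \<and> g t = a + (1 - b) * y t"
      using diam
    proof eventually_elim
      case (elim t)
      obtain b where "\<beta> x \<le> b" "b \<le> 1" "force i t - force j t = - b * y t"
        using cluster_stiffness[OF N_pos C ij elim _ _ _ lam(2)] x \<phi> unfolding \<beta>_def force_def y_def by auto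
      then show ?case by (intro exI[of _ b]) (simp add: g_def algebra_simps)
    qed
    have "\<beta> x \<le> 1" using eventually_happens[OF stiff] by force
    have \<beta>x: "0 < \<beta> x" using x(1) b by simp
    have dy: "(y has_real_derivative \<omega> i t - \<omega> j t) (at t)" if "t > 0" for t
      unfolding y_def using that ijN by (intro DERIV_diff deriv_\<theta>) auto
    have du: "((\<lambda>t. \<omega> i t - \<omega> j t) has_real_derivative
        (\<nu> i + \<kappa> * force i t - \<omega> i t) / m - (\<nu> j + \<kappa> * force j t - \<omega> j t) / m) (at t)" if "t > 0" for t
      using that ijN by (intro DERIV_diff deriv_\<omega>) auto
    note bounds = overdamped_variable_stiffness[OF m_pos \<kappa>_pos km dy du eq a \<beta>x \<open>\<beta> x \<le> 1\<close> stiff bd e]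
    show "\<forall>\<^sub>F t in at_top. a - e \<le> y t" using bounds(1) by simp
    have "a / \<beta> x \<le> a / b" using a b x(1) by (intro divide_left_mono) auto
    then show "\<forall>\<^sub>F t in at_top. y t \<le> a / b + e" using bounds(2) by (auto elim!: eventually_mono)
  qed
  have lower: "ereal a \<le> Liminf at_top (\<lambda>t. ereal (y t))"
  proof (rule Liminf_ereal_geI)
    fix c assume "c < a"
    then show "\<forall>\<^sub>F t in at_top. ereal c \<le> ereal (y t)"
      using near(2)[of "\<beta> \<phi> / 2" "a - c"] \<beta>pos by simp
  qed
  have upper: "Limsup at_top (\<lambda>t. ereal (y t)) \<le> ereal (a / \<beta> \<phi>)"
    unfolding Limsup_ereal_le_iff
  proof (intro allI impI)
    fix c assume c: "a / \<beta> \<phi> < c"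
    have "isCont (\<lambda>b. a / b) (\<beta> \<phi>)" using \<beta>pos by (intro continuous_intros) auto
    then have "((\<lambda>b. a / b) \<longlongrightarrow> a / \<beta> \<phi>) (at_left (\<beta> \<phi>))" by (simp add: isCont_def filterlim_at_split)
    then have "\<forall>\<^sub>F b in at_left (\<beta> \<phi>). a / b < c" using c by (rule order_tendstoD)
    moreover have "\<forall>\<^sub>F b in at_left (\<beta> \<phi>). b \<in> {0<..<\<beta> \<phi>}" using \<beta>pos by (rule eventually_at_left_real)
    ultimately have "\<forall>\<^sub>F b in at_left (\<beta> \<phi>). a / b < c \<and> b \<in> {0<..<\<beta> \<phi>}" by (rule eventually_conj)
    then obtain b where b: "a / b < c" "0 < b" "b < \<beta> \<phi>" by (auto dest: eventually_happens)
    from near(1)[OF b(2,3), of "c - a / b"] b(1) show "\<forall>\<^sub>F t in at_top. y t \<le> c" by simp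
  qed
  have "a / \<beta> \<phi> = \<phi> / (2 * sin (\<phi> / 2) * (lam * cos \<phi> - (1 - lam))) * a"
    by (simp add: \<beta>_def mult_ac)
  then show "ereal ((\<nu> i - \<nu> j) / \<kappa>) \<le> Liminf at_top (\<lambda>t. ereal (\<theta> i t - \<theta> j t)) \<and>
        Liminf at_top (\<lambda>t. ereal (\<theta> i t - \<theta> j t)) \<le> Limsup at_top (\<lambda>t. ereal (\<theta> i t - \<theta> j t)) \<and>
        Limsup at_top (\<lambda>t. ereal (\<theta> i t - \<theta> j t)) \<le>
          ereal (phi1 lam (level B) / (2 * sin (phi1 lam (level B) / 2) *
            (lam * cos (phi1 lam (level B)) - (1 - lam))) * ((\<nu> i - \<nu> j) / \<kappa>))"
    using lower upper Liminf_le_Limsup[of at_top "\<lambda>t. ereal (y t)"]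
    unfolding y_def a_def \<phi>_def by simp
qed

end


section \<open>Phase locking of bounded solutions\<close>

text \<open>If \<^term>\<open>\<rho>\<close> did not converge, it would return to every value \<^term>\<open>r\<close> of some interval
  at arbitrarily late times.  In the limit along such times the numbers \<^term>\<open>S i\<close> become
  \<^term>\<open>\<sigma> i * sqrt (r - (f i)\<^sup>2)\<close> with signs \<^term>\<open>\<sigma> i\<close>, so that each \<^term>\<open>r\<close> solves one of finitely
  many self-consistency equations.  One of these then has infinitely many solutions in a compact
  interval; as it is analytic it holds identically, which is absurd for large \<^term>\<open>r\<close>, where
  the left hand side is of order \<^term>\<open>r\<close> and the right hand side of order \<^term>\<open>sqrt r\<close>.\<close>

lemma self_consistent_convergence:
  fixes S F :: "'i \<Rightarrow> real \<Rightarrow> real" and f :: "'i \<Rightarrow> real" and \<rho> :: "real \<Rightarrow> real"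
  assumes I: "finite I" "I \<noteq> {}"
    and cont: "continuous_on {T..} \<rho>" and bd: "\<And>t. t \<ge> T \<Longrightarrow> \<bar>\<rho> t\<bar> \<le> M"
    and sq: "\<And>i t. i \<in> I \<Longrightarrow> (S i t)\<^sup>2 + (F i t)\<^sup>2 = \<rho> t"
    and sum: "\<And>t. (\<Sum>i\<in>I. S i t) = real (card I) * \<rho> t"
    and lim: "\<And>i. i \<in> I \<Longrightarrow> (F i \<longlongrightarrow> f i) at_top"
  shows "\<exists>L. (\<rho> \<longlongrightarrow> L) at_top"
proof (rule ccontr)
  assume "\<not> ?thesis"
  then obtain \<alpha> \<beta> where ab: "\<alpha> < \<beta>" and rec: "\<And>r. r \<in> {\<alpha>..\<beta>} \<Longrightarrow> \<exists>\<^sub>F t in at_top. \<rho> t = r"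
    using convergent_or_recurrent_interval[OF cont bd] by blast
  have f\<alpha>: "(f i)\<^sup>2 \<le> \<alpha>" if i: "i \<in> I" for i
  proof (rule ccontr)
    assume "\<not> (f i)\<^sup>2 \<le> \<alpha>"
    then have "\<forall>\<^sub>F t in at_top. \<alpha> < (F i t)\<^sup>2"
      using order_tendstoD(1)[OF tendsto_power[OF lim[OF i], of 2], of \<alpha>] by simp
    moreover have "\<exists>\<^sub>F t in at_top. \<rho> t = \<alpha>" using rec[of \<alpha>] ab by simp
    ultimately have "\<exists>\<^sub>F t in at_top. \<rho> t = \<alpha> \<and> \<alpha> < (F i t)\<^sup>2"
      by (rule frequently_eventually_frequently[rotated])
    then obtain t where "\<rho> t = \<alpha>" "\<alpha> < (F i t)\<^sup>2" by (auto dest: frequently_ex)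
    then show False using sq[OF i, of t] zero_le_power2[of "S i t"] by linarith
  qed
  define signs :: "('i \<Rightarrow> real) set" where "signs = PiE I (\<lambda>_. {-1, 1})"
  have fin: "finite signs" using I by (auto simp: signs_def intro: finite_PiE)
  define h where "h \<sigma> r = real (card I) * r - (\<Sum>i\<in>I. \<sigma> i * sqrt (r - (f i)\<^sup>2))" for \<sigma> r
  \<comment> \<open>If no choice of signs solved the equation for \<open>r\<close>, all residuals would be at least some
    \<open>\<mu> > 0\<close>; but the actual signs at a late time with \<open>\<rho> t = r\<close> give a smaller one.\<close>
  have "\<exists>\<sigma>\<in>signs. h \<sigma> r = 0" if r: "r \<in> {\<alpha>..\<beta>}" for r
  proof (rule ccontr)
    assume no: "\<not> (\<exists>\<sigma>\<in>signs. h \<sigma> r = 0)"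
    have "signs \<noteq> {}" by (auto simp: signs_def PiE_eq_empty_iff)
    define \<mu> where "\<mu> = Min ((\<lambda>\<sigma>. \<bar>h \<sigma> r\<bar>) ` signs)"
    have "\<mu> \<in> (\<lambda>\<sigma>. \<bar>h \<sigma> r\<bar>) ` signs" unfolding \<mu>_def using fin \<open>signs \<noteq> {}\<close> by (intro Min_in) auto
    then have \<mu>: "\<mu> > 0" using no by auto
    have \<mu>le: "\<mu> \<le> \<bar>h \<sigma> r\<bar>" if "\<sigma> \<in> signs" for \<sigma>
      unfolding \<mu>_def using fin that by (intro Min_le) auto
    define c where "c = real (card I)"
    have c: "c > 0" using I by (simp add: c_def card_gt_0_iff)
    have "\<forall>\<^sub>F t in at_top. \<bar>sqrt (r - (F i t)\<^sup>2) - sqrt (r - (f i)\<^sup>2)\<bar> < \<mu> / c" if "i \<in> I" for i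
    proof -
      have "((\<lambda>t. sqrt (r - (F i t)\<^sup>2)) \<longlongrightarrow> sqrt (r - (f i)\<^sup>2)) at_top"
        by (intro tendsto_intros lim that)
      from tendstoD[OF this, of "\<mu> / c"] show ?thesis using \<mu> c by (simp add: dist_real_def)
    qed
    then have "\<forall>\<^sub>F t in at_top. \<forall>i\<in>I. \<bar>sqrt (r - (F i t)\<^sup>2) - sqrt (r - (f i)\<^sup>2)\<bar> < \<mu> / c"
      using I by (simp add: eventually_ball_finite)
    with rec[OF r] have "\<exists>\<^sub>F t in at_top. \<rho> t = r \<and> (\<forall>i\<in>I. \<bar>sqrt (r - (F i t)\<^sup>2) - sqrt (r - (f i)\<^sup>2)\<bar> < \<mu> / c)"
      by (rule frequently_eventually_frequently)
    then obtain t where t: "\<rho> t = r" "\<And>i. i \<in> I \<Longrightarrow> \<bar>sqrt (r - (F i t)\<^sup>2) - sqrt (r - (f i)\<^sup>2)\<bar> < \<mu> / c"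
      by (auto dest: frequently_ex)
    define \<sigma> where "\<sigma> = restrict (\<lambda>i. if S i t \<ge> 0 then 1 else - 1 :: real) I"
    have \<sigma>: "\<sigma> \<in> signs" by (auto simp: \<sigma>_def signs_def)
    have S: "S i t = \<sigma> i * sqrt (r - (F i t)\<^sup>2)" if "i \<in> I" for i
    proof -
      have "r - (F i t)\<^sup>2 = (S i t)\<^sup>2" using sq[OF that, of t] t(1) by simp
      then show ?thesis using that by (simp add: \<sigma>_def)
    qed
    have "h \<sigma> r = (\<Sum>i\<in>I. S i t) - (\<Sum>i\<in>I. \<sigma> i * sqrt (r - (f i)\<^sup>2))"
      unfolding h_def sum t(1) ..
    also have "\<dots> = (\<Sum>i\<in>I. \<sigma> i * (sqrt (r - (F i t)\<^sup>2) - sqrt (r - (f i)\<^sup>2)))"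
      unfolding sum_subtractf[symmetric] using S by (intro sum.cong) (auto simp: right_diff_distrib)
    also have "\<bar>\<dots>\<bar> \<le> (\<Sum>i\<in>I. \<bar>\<sigma> i * (sqrt (r - (F i t)\<^sup>2) - sqrt (r - (f i)\<^sup>2))\<bar>)" by (rule sum_abs)
    also have "\<dots> < (\<Sum>i\<in>I. \<mu> / c)"
    proof (rule sum_strict_mono[OF I])
      fix i assume i: "i \<in> I"
      have "\<bar>\<sigma> i\<bar> = 1" using i by (simp add: \<sigma>_def)
      then show "\<bar>\<sigma> i * (sqrt (r - (F i t)\<^sup>2) - sqrt (r - (f i)\<^sup>2))\<bar> < \<mu> / c"
        using t(2)[OF i] by (simp add: abs_mult)
    qed
    also have "\<dots> = \<mu>" using c by (simp add: c_def)
    finally show False using \<mu>le[OF \<sigma>] by simp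
  qed
  then have cover: "{(\<alpha> + \<beta>) / 2..\<beta>} \<subseteq> (\<Union>\<sigma>\<in>signs. {r \<in> {(\<alpha> + \<beta>) / 2..\<beta>}. h \<sigma> r = 0})"
    using ab by auto
  have "infinite {(\<alpha> + \<beta>) / 2..\<beta>}" using ab by (intro infinite_Icc) simp
  then obtain \<sigma> where \<sigma>: "\<sigma> \<in> signs" "infinite {r \<in> {(\<alpha> + \<beta>) / 2..\<beta>}. h \<sigma> r = 0}"
    using finite_subset[OF cover finite_UN_I[OF fin]] by blast
  define R where "R = {r \<in> {(\<alpha> + \<beta>) / 2..\<beta>}. h \<sigma> r = 0}"
  define H where "H z = of_nat (card I) * z - (\<Sum>i\<in>I. of_real (\<sigma> i) * csqrt (z - of_real ((f i)\<^sup>2)))"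
    for z :: complex
  define D where "D = {z. Re z > \<alpha>}"
  have H_real: "H (of_real r) = of_real (h \<sigma> r)" if "r \<ge> \<alpha>" for r
  proof -
    have "csqrt (of_real r - of_real ((f i)\<^sup>2)) = of_real (sqrt (r - (f i)\<^sup>2))" if "i \<in> I" for i
      using f\<alpha>[OF that] \<open>r \<ge> \<alpha>\<close> by (subst of_real_diff[symmetric], subst csqrt_of_real_nonneg) auto
    then show ?thesis by (simp add: H_def h_def)
  qed
  have holo: "H holomorphic_on D"
  proof -
    have "z - of_real ((f i)\<^sup>2) \<notin> \<real>\<^sub>\<le>\<^sub>0" if "i \<in> I" "z \<in> D" for i z
      using f\<alpha>[OF that(1)] that(2) by (auto simp: D_def complex_nonpos_Reals_iff)
    then show ?thesis unfolding H_def by (intro holomorphic_intros) auto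
  qed
  have "compact (complex_of_real ` {(\<alpha> + \<beta>) / 2..\<beta>})"
    by (intro compact_continuous_image continuous_intros) auto
  moreover have "infinite (complex_of_real ` R)"
    using \<sigma>(2) by (simp add: R_def finite_image_iff inj_on_def)
  moreover have "complex_of_real ` R \<subseteq> complex_of_real ` {(\<alpha> + \<beta>) / 2..\<beta>}" by (auto simp: R_def)
  ultimately obtain z0 where z0: "z0 \<in> complex_of_real ` {(\<alpha> + \<beta>) / 2..\<beta>}" "z0 islimpt complex_of_real ` R"
    using Heine_Borel_imp_Bolzano_Weierstrass by blast
  have zero: "H w = 0" if "w \<in> D" for w
  proof (rule analytic_continuation[OF holo _ _ _ _ z0(2) _ that])
    show "open D" by (simp add: D_def open_halfspace_Re_gt)
    show "connected D" by (simp add: D_def convex_connected convex_halfspace_Re_gt)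
    show "complex_of_real ` R \<subseteq> D" using ab by (auto simp: R_def D_def)
    show "z0 \<in> D" using z0(1) ab by (auto simp: D_def)
    show "H z = 0" if "z \<in> complex_of_real ` R" for z
      using that H_real ab by (auto simp: R_def)
  qed
  define w where "w = max \<alpha> 1 + 1"
  have w: "w > \<alpha>" "w > 1" by (auto simp: w_def)
  have "h \<sigma> w = 0" using zero[of "of_real w"] H_real[of w] w by (simp add: D_def)
  then have "real (card I) * w = (\<Sum>i\<in>I. \<sigma> i * sqrt (w - (f i)\<^sup>2))" by (simp add: h_def)
  also have "\<dots> \<le> (\<Sum>i\<in>I. sqrt w)"
  proof (rule sum_mono)
    fix i assume i: "i \<in> I"
    have "\<sigma> i \<in> {-1, 1}" using \<sigma>(1) i by (auto simp: signs_def PiE_iff)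
    then have "\<sigma> i * sqrt (w - (f i)\<^sup>2) \<le> sqrt (w - (f i)\<^sup>2)"
      using f\<alpha>[OF i] w by auto
    also have "\<dots> \<le> sqrt w" by simp
    finally show "\<sigma> i * sqrt (w - (f i)\<^sup>2) \<le> sqrt w" .
  qed
  also have "\<dots> = real (card I) * sqrt w" by simp
  finally have "w \<le> sqrt w" using I by (simp add: card_gt_0_iff)
  moreover have "sqrt w * 1 < sqrt w * sqrt w" using w by (intro mult_strict_left_mono) auto
  ultimately show False using w by simp
qed

lemma antimono_bounded_converges:
  fixes E :: "real \<Rightarrow> real"
  assumes cont: "continuous_on {T..} E" and dec: "\<And>s t. T \<le> s \<Longrightarrow> s \<le> t \<Longrightarrow> E t \<le> E s"
    and bd: "\<And>t. t \<ge> T \<Longrightarrow> - M \<le> E t"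
  shows "\<exists>L. (E \<longlongrightarrow> L) at_top"
proof (rule ccontr)
  assume no: "\<not> ?thesis"
  have "\<bar>E t\<bar> \<le> \<bar>M\<bar> + \<bar>E T\<bar>" if "t \<ge> T" for t using bd[OF that] dec[of T t] that by auto
  from convergent_or_recurrent_interval[OF cont this] no
  obtain \<alpha> \<beta> where ab: "\<alpha> < \<beta>" "\<forall>r\<in>{\<alpha>..\<beta>}. \<exists>\<^sub>F t in at_top. E t = r" by blast
  have rec: "\<exists>t\<ge>s. E t = r" if "r \<in> {\<alpha>..\<beta>}" for r s
  proof -
    have "\<exists>\<^sub>F t in at_top. E t = r \<and> s \<le> t"
      using ab(2) that by (intro frequently_eventually_frequently eventually_ge_at_top) blast
    then show ?thesis by (auto dest: frequently_ex)
  qed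
  obtain s where s: "s \<ge> T" "E s = \<alpha>" using rec[of \<alpha> T] ab(1) by auto
  obtain t where "t \<ge> s" "E t = \<beta>" using rec[of \<beta> s] ab(1) by auto
  then show False using dec[OF s(1)] s(2) ab(1) by force
qed

context inertial_kuramoto
begin

definition mean_frequency :: real where "mean_frequency = (\<Sum>k=1..N. \<nu> k) / real N"
definition relvel :: "nat \<Rightarrow> real \<Rightarrow> real" where
  "relvel i t = \<omega> i t - (\<Sum>k=1..N. \<omega> k t) / real N"
definition imbalance :: "nat \<Rightarrow> real \<Rightarrow> real" where
  "imbalance i t = \<nu> i - mean_frequency + \<kappa> * force i t"

lemma sum_force: "(\<Sum>i=1..N. force i t) = 0"
proof -
  have "(\<Sum>i=1..N. \<Sum>k=1..N. sin (\<theta> k t - \<theta> i t)) = (\<Sum>k=1..N. \<Sum>i=1..N. sin (\<theta> k t - \<theta> i t))"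
    by (rule sum.swap)
  also have "\<dots> = (\<Sum>k=1..N. \<Sum>i=1..N. - sin (\<theta> i t - \<theta> k t))"
    by (intro sum.cong refl) (metis minus_diff_eq sin_minus)
  also have "\<dots> = - (\<Sum>i=1..N. \<Sum>k=1..N. sin (\<theta> k t - \<theta> i t))" by (simp add: sum_negf)
  finally show ?thesis by (simp add: force_def coupling_def flip: sum_divide_distrib)
qed

lemma sum_detuning: "(\<Sum>i=1..N. \<nu> i - mean_frequency) = 0"
  using N_pos by (simp add: mean_frequency_def sum_subtractf)

lemma deriv_relvel:
  assumes "i \<in> {1..N}" "t > 0"
  shows "(relvel i has_real_derivative (imbalance i t - relvel i t) / m) (at t)"
proof -
  have "((\<lambda>t. \<omega> i t - (\<Sum>k=1..N. \<omega> k t) / real N) has_real_derivative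
      (\<nu> i + \<kappa> * force i t - \<omega> i t) / m - (\<Sum>k=1..N. (\<nu> k + \<kappa> * force k t - \<omega> k t) / m) / real N) (at t)"
    using assms by (intro DERIV_diff DERIV_cdivide DERIV_sum deriv_\<omega>) auto
  moreover have "(\<Sum>k=1..N. (\<nu> k + \<kappa> * force k t - \<omega> k t) / m)
      = ((\<Sum>k=1..N. \<nu> k) - (\<Sum>k=1..N. \<omega> k t)) / m"
    by (simp add: sum_force sum_subtractf sum.distrib del: One_nat_def flip: sum_divide_distrib sum_distrib_left)
  ultimately show ?thesis unfolding relvel_def[abs_def]
    by (elim DERIV_cong) (simp add: imbalance_def mean_frequency_def diff_divide_distrib add_divide_distrib mult.commute)
qed

lemma relvel_bounded:
  obtains V where "\<And>i t. i \<in> {1..N} \<Longrightarrow> t \<ge> 0 \<Longrightarrow> \<bar>relvel i t\<bar> \<le> V"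
    and "\<And>i j t. i \<in> {1..N} \<Longrightarrow> j \<in> {1..N} \<Longrightarrow> t \<ge> 0 \<Longrightarrow> \<bar>\<omega> i t - \<omega> j t\<bar> \<le> V"
proof -
  define V where "V = fam_diam {1..N} \<omega>0 + (fam_diam {1..N} \<nu> + 2 * \<kappa>)"
  have V: "\<omega> i t - \<omega> j t \<le> V" if "i \<in> {1..N}" "j \<in> {1..N}" "t \<ge> 0" for i j t
  proof -
    have nn: "0 \<le> fam_diam {1..N} \<omega>0" "0 \<le> fam_diam {1..N} \<nu> + 2 * \<kappa>"
      using fam_diam_nonneg[of "{1..N}"] \<kappa>_pos by auto
    have e: "exp (- t / m) \<le> 1" "1 - exp (- t / m) \<le> 1" using that m_pos by auto
    have "speed_bound {1..N} t \<le> 1 * fam_diam {1..N} \<omega>0 + 1 * (fam_diam {1..N} \<nu> + 2 * \<kappa>)"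
      unfolding speed_bound_def using e nn by (intro add_mono mult_right_mono)
    then show ?thesis
      using order_trans[OF relative_velocity_le[OF subset_refl that]] by (simp only: V_def mult_1_left)
  qed
  have abs: "\<bar>\<omega> i t - \<omega> j t\<bar> \<le> V" if "i \<in> {1..N}" "j \<in> {1..N}" "t \<ge> 0" for i j t
    using V[OF that] V[OF that(2,1,3)] by (intro abs_leI) auto
  have "\<bar>relvel i t\<bar> \<le> V" if i: "i \<in> {1..N}" "t \<ge> 0" for i t
  proof -
    have "real N * relvel i t = (\<Sum>k=1..N. \<omega> i t - \<omega> k t)"
      using N_pos by (simp add: relvel_def sum_subtractf right_diff_distrib)
    moreover have "\<bar>\<Sum>k=1..N. \<omega> i t - \<omega> k t\<bar> \<le> (\<Sum>k=1..N. V)"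
      by (rule order_trans[OF sum_abs]) (intro sum_mono abs i, auto)
    ultimately have "real N * \<bar>relvel i t\<bar> \<le> real N * V" by (simp add: abs_mult flip: abs_mult)
    then show ?thesis using N_pos by simp
  qed
  then show thesis using that abs by blast
qed

text \<open>The total energy in the frame that moves with the mean phase.\<close>

definition energy :: "real \<Rightarrow> real" where
  "energy t = (\<Sum>i=1..N. m / 2 * (relvel i t)\<^sup>2 - (\<nu> i - mean_frequency) * \<theta> i t)
    - \<kappa> / (2 * real N) * (\<Sum>i=1..N. \<Sum>k=1..N. cos (\<theta> k t - \<theta> i t))"

lemma energy_deriv:
  assumes t: "t > 0"
  shows "(energy has_real_derivative - (\<Sum>i=1..N. (relvel i t)\<^sup>2)) (at t)"
proof -
  define v where "v i = relvel i t" for i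
  have rel: "\<omega> k t - \<omega> i t = v k - v i" for i k by (simp add: v_def relvel_def)
  have "(energy has_real_derivative
      (\<Sum>i=1..N. m / 2 * (2 * v i * ((imbalance i t - v i) / m)) - (\<nu> i - mean_frequency) * \<omega> i t)
      - \<kappa> / (2 * real N) * (\<Sum>i=1..N. \<Sum>k=1..N. - sin (\<theta> k t - \<theta> i t) * (\<omega> k t - \<omega> i t))) (at t)"
    unfolding energy_def[abs_def] v_def using t
    by (intro DERIV_diff DERIV_sum DERIV_cmult) (auto intro!: derivative_eq_intros deriv_relvel deriv_\<theta>)
  moreover have "(\<Sum>i=1..N. m / 2 * (2 * v i * ((imbalance i t - v i) / m)) - (\<nu> i - mean_frequency) * \<omega> i t)
      = (\<Sum>i=1..N. \<kappa> * force i t * v i) - (\<Sum>i=1..N. (v i)\<^sup>2)"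
  proof -
    define w where "w = (\<Sum>k=1..N. \<omega> k t) / real N"
    have "m / 2 * (2 * v i * ((imbalance i t - v i) / m)) - (\<nu> i - mean_frequency) * \<omega> i t
        = \<kappa> * force i t * v i - (v i)\<^sup>2 - (\<nu> i - mean_frequency) * w" for i
    proof -
      have 1: "m / 2 * (2 * p * (q / m)) = p * q" for p q using m_pos by simp
      have 2: "\<omega> i t = v i + w" by (simp add: v_def relvel_def w_def)
      show ?thesis unfolding 1 2 imbalance_def by (simp add: power2_eq_square algebra_simps)
    qed
    then show ?thesis
      using sum_detuning by (simp add: sum_subtractf flip: sum_distrib_right)
  qed
  moreover have "\<kappa> / (2 * real N) * (\<Sum>i=1..N. \<Sum>k=1..N. - sin (\<theta> k t - \<theta> i t) * (\<omega> k t - \<omega> i t))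
      = (\<Sum>i=1..N. \<kappa> * force i t * v i)"
  proof -
    have 1: "(\<Sum>i=1..N. \<Sum>k=1..N. sin (\<theta> k t - \<theta> i t) * v k) = - (\<Sum>i=1..N. \<Sum>k=1..N. sin (\<theta> k t - \<theta> i t) * v i)"
    proof -
      have "(\<Sum>i=1..N. \<Sum>k=1..N. sin (\<theta> k t - \<theta> i t) * v k) = (\<Sum>k=1..N. \<Sum>i=1..N. sin (\<theta> k t - \<theta> i t) * v k)"
        by (rule sum.swap)
      also have "\<dots> = (\<Sum>k=1..N. \<Sum>i=1..N. - (sin (\<theta> i t - \<theta> k t) * v k))"
        by (intro sum.cong refl) (metis minus_diff_eq sin_minus mult_minus_left)
      finally show ?thesis by (simp add: sum_negf)
    qed
    have "(\<Sum>i=1..N. \<Sum>k=1..N. - sin (\<theta> k t - \<theta> i t) * (\<omega> k t - \<omega> i t))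
        = (\<Sum>i=1..N. \<Sum>k=1..N. sin (\<theta> k t - \<theta> i t) * v i) - (\<Sum>i=1..N. \<Sum>k=1..N. sin (\<theta> k t - \<theta> i t) * v k)"
      unfolding rel sum_subtractf[symmetric] by (intro sum.cong refl) (simp add: algebra_simps)
    also have "\<dots> = 2 * (\<Sum>i=1..N. real N * force i t * v i)"
      unfolding 1 using N_pos by (simp add: force_def coupling_def sum_distrib_right)
    finally show ?thesis using N_pos by (simp add: sum_distrib_left mult.assoc)
  qed
  ultimately show ?thesis by (simp add: v_def)
qed

text \<open>The energy is bounded below as long as the relative phases are bounded, and it dissipates
  the squares of the relative velocities.  Barbalat's lemma, applied to the energy and then to the
  velocities, shows that velocities and accelerations vanish in the limit.\<close>

lemma forces_converge:
  assumes bd: "\<And>i j t. i \<in> {1..N} \<Longrightarrow> j \<in> {1..N} \<Longrightarrow> t \<ge> 0 \<Longrightarrow> \<bar>\<theta> i t - \<theta> j t\<bar> \<le> M"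
    and i: "i \<in> {1..N}"
  shows "(force i \<longlongrightarrow> - (\<nu> i - mean_frequency) / \<kappa>) at_top"
proof -
  obtain V where V: "\<And>i t. i \<in> {1..N} \<Longrightarrow> t \<ge> 0 \<Longrightarrow> \<bar>relvel i t\<bar> \<le> V"
    "\<And>i j t. i \<in> {1..N} \<Longrightarrow> j \<in> {1..N} \<Longrightarrow> t \<ge> 0 \<Longrightarrow> \<bar>\<omega> i t - \<omega> j t\<bar> \<le> V"
    using relvel_bounded by blast
  have V0: "V \<ge> 0" using V(1)[OF i, of 0] by simp
  define v' where "v' i t = (imbalance i t - relvel i t) / m" for i t
  have dv: "(relvel i has_real_derivative v' i t) (at t)" if "i \<in> {1..N}" "t > 0" for i t
    unfolding v'_def by (rule deriv_relvel[OF that])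
  have v'_bound: "\<bar>v' i t\<bar> \<le> (\<bar>\<nu> i - mean_frequency\<bar> + \<kappa> + V) / m" if "i \<in> {1..N}" "t > 0" for i t
  proof -
    have "\<bar>\<kappa> * force i t\<bar> \<le> \<kappa> * 1" using abs_force_le[of i t] \<kappa>_pos
      unfolding abs_mult by (intro mult_mono) auto
    then have "\<bar>imbalance i t - relvel i t\<bar> \<le> \<bar>\<nu> i - mean_frequency\<bar> + \<kappa> + V"
      using V(1)[OF that(1), of t] that(2) unfolding imbalance_def by auto
    then show ?thesis using m_pos by (simp add: v'_def divide_right_mono)
  qed
  have E_cont: "continuous_on {1..} energy"
    using energy_deriv by (intro DERIV_continuous_on[where D = "\<lambda>t. - (\<Sum>i=1..N. (relvel i t)\<^sup>2)"])
      (auto intro: has_field_derivative_at_within)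
  have E_dec: "energy t \<le> energy s" if "1 \<le> s" "s \<le> t" for s t
  proof (rule DERIV_nonpos_imp_nonincreasing[OF that(2)])
    fix r assume "s \<le> r" "r \<le> t"
    then have "(energy has_real_derivative - (\<Sum>i=1..N. (relvel i r)\<^sup>2)) (at r)"
      using that by (intro energy_deriv) auto
    moreover have "- (\<Sum>i=1..N. (relvel i r)\<^sup>2) \<le> 0" by (simp add: sum_nonneg)
    ultimately show "\<exists>y. (energy has_real_derivative y) (at r) \<and> y \<le> 0" by blast
  qed
  define K where "K = (\<Sum>i=1..N. \<bar>\<nu> i - mean_frequency\<bar> * M) + \<kappa> / (2 * real N) * (real N * real N)"
  have E_low: "- K \<le> energy t" if t: "t \<ge> 1" for t
  proof -
    have "(\<Sum>i=1..N. (\<nu> i - mean_frequency) * \<theta> i t) = (\<Sum>i=1..N. (\<nu> i - mean_frequency) * (\<theta> i t - \<theta> 1 t))"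
      using sum_detuning by (simp add: right_diff_distrib sum_subtractf flip: sum_distrib_right)
    also have "\<dots> \<le> (\<Sum>i=1..N. \<bar>\<nu> i - mean_frequency\<bar> * M)"
    proof (rule sum_mono)
      fix i assume "i \<in> {1..N}"
      then have "\<bar>\<theta> i t - \<theta> 1 t\<bar> \<le> M" using bd[of i 1 t] t N_pos by auto
      then have "\<bar>(\<nu> i - mean_frequency) * (\<theta> i t - \<theta> 1 t)\<bar> \<le> \<bar>\<nu> i - mean_frequency\<bar> * M"
        unfolding abs_mult by (intro mult_left_mono) auto
      then show "(\<nu> i - mean_frequency) * (\<theta> i t - \<theta> 1 t) \<le> \<bar>\<nu> i - mean_frequency\<bar> * M" by linarith
    qed
    finally have 1: "(\<Sum>i=1..N. (\<nu> i - mean_frequency) * \<theta> i t) \<le> (\<Sum>i=1..N. \<bar>\<nu> i - mean_frequency\<bar> * M)" .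
    have "(\<Sum>i=1..N. \<Sum>k=1..N. cos (\<theta> k t - \<theta> i t)) \<le> (\<Sum>i=1..N. \<Sum>k=1..N. 1)"
      by (intro sum_mono) simp
    then have "\<kappa> / (2 * real N) * (\<Sum>i=1..N. \<Sum>k=1..N. cos (\<theta> k t - \<theta> i t)) \<le> \<kappa> / (2 * real N) * (real N * real N)"
      using \<kappa>_pos by (intro mult_left_mono) auto
    moreover have "0 \<le> (\<Sum>i=1..N. m / 2 * (relvel i t)\<^sup>2)"
      using m_pos by (intro sum_nonneg) auto
    ultimately show ?thesis using 1 by (simp add: K_def energy_def sum_subtractf)
  qed
  obtain E where "(energy \<longlongrightarrow> E) at_top"
    using antimono_bounded_converges[OF E_cont E_dec E_low] by blast
  then have "((\<lambda>t. - (\<Sum>i=1..N. (relvel i t)\<^sup>2)) \<longlongrightarrow> 0) at_top"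
  proof (rule derivative_tendsto_zero[OF energy_deriv,
      where f'' = "\<lambda>t. - (\<Sum>i=1..N. 2 * relvel i t * v' i t)"
      and K = "\<Sum>i=1..N. 2 * V * ((\<bar>\<nu> i - mean_frequency\<bar> + \<kappa> + V) / m)", rotated -1])
    fix t :: real assume t: "t > 0"
    show "((\<lambda>t. - (\<Sum>i=1..N. (relvel i t)\<^sup>2)) has_real_derivative
        - (\<Sum>i=1..N. 2 * relvel i t * v' i t)) (at t)"
      using t by (intro DERIV_minus DERIV_sum) (auto intro!: derivative_eq_intros dv)
    have "\<bar>\<Sum>i=1..N. 2 * relvel i t * v' i t\<bar>
        \<le> (\<Sum>i=1..N. \<bar>2 * relvel i t * v' i t\<bar>)" by (rule sum_abs)
    also have "\<dots> \<le> (\<Sum>i=1..N. 2 * V * ((\<bar>\<nu> i - mean_frequency\<bar> + \<kappa> + V) / m))"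
      unfolding abs_mult using V(1) v'_bound V0 t by (intro sum_mono mult_mono) auto
    finally show "\<bar>- (\<Sum>i=1..N. 2 * relvel i t * v' i t)\<bar>
        \<le> (\<Sum>i=1..N. 2 * V * ((\<bar>\<nu> i - mean_frequency\<bar> + \<kappa> + V) / m))" by simp
  qed
  then have sumsq: "((\<lambda>t. \<Sum>i=1..N. (relvel i t)\<^sup>2) \<longlongrightarrow> 0) at_top"
    using tendsto_minus by fastforce
  have "((\<lambda>t. (relvel i t)\<^sup>2) \<longlongrightarrow> 0) at_top"
  proof (rule tendsto_sandwich[OF _ _ tendsto_const sumsq])
    show "\<forall>\<^sub>F t in at_top. (relvel i t)\<^sup>2 \<le> (\<Sum>i=1..N. (relvel i t)\<^sup>2)"
      using i by (intro always_eventually allI member_le_sum) auto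
  qed simp
  then have "((\<lambda>t. sqrt ((relvel i t)\<^sup>2)) \<longlongrightarrow> sqrt 0) at_top" by (rule tendsto_real_sqrt)
  then have v0: "(relvel i \<longlongrightarrow> 0) at_top"
    by (simp add: tendsto_rabs_zero_iff)
  define F' where "F' t = (\<Sum>k=1..N. cos (\<theta> k t - \<theta> i t) * (\<omega> k t - \<omega> i t)) / real N" for t
  have dF: "(force i has_real_derivative F' t) (at t)" if "t > 0" for t
    unfolding force_def[abs_def] coupling_def F'_def using that i
    by (intro DERIV_cdivide DERIV_sum) (auto intro!: derivative_eq_intros deriv_\<theta>)
  have F': "\<bar>F' t\<bar> \<le> V" if "t > 0" for t
  proof -
    have "\<bar>\<Sum>k=1..N. cos (\<theta> k t - \<theta> i t) * (\<omega> k t - \<omega> i t)\<bar> \<le> (\<Sum>k=1..N. 1 * V)"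
    proof (intro order_trans[OF sum_abs] sum_mono)
      fix k assume "k \<in> {1..N}"
      then show "\<bar>cos (\<theta> k t - \<theta> i t) * (\<omega> k t - \<omega> i t)\<bar> \<le> 1 * V"
        using V(2)[of k i t] that i unfolding abs_mult by (intro mult_mono) auto
    qed
    then show ?thesis using N_pos by (simp add: F'_def field_simps)
  qed
  have "(v' i \<longlongrightarrow> 0) at_top"
  proof (rule derivative_tendsto_zero[OF dv[OF i] _ _ v0])
    fix t :: real assume t: "t > 0"
    show "(v' i has_real_derivative (\<kappa> * F' t - v' i t) / m) (at t)"
      unfolding v'_def[abs_def] imbalance_def[abs_def] using dF[OF t] dv[OF i t] m_pos
      by (auto intro!: derivative_eq_intros simp: v'_def imbalance_def)
    have "\<bar>\<kappa> * F' t\<bar> \<le> \<kappa> * V" using F'[OF t] \<kappa>_pos by (simp add: abs_mult)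
    then have "\<bar>\<kappa> * F' t - v' i t\<bar> \<le> \<kappa> * V + (\<bar>\<nu> i - mean_frequency\<bar> + \<kappa> + V) / m"
      using v'_bound[OF i t] by linarith
    then show "\<bar>(\<kappa> * F' t - v' i t) / m\<bar> \<le> (\<kappa> * V + (\<bar>\<nu> i - mean_frequency\<bar> + \<kappa> + V) / m) / m"
      using m_pos by (simp add: divide_right_mono)
  qed
  then have "((\<lambda>t. (m * v' i t + relvel i t - (\<nu> i - mean_frequency)) / \<kappa>)
      \<longlongrightarrow> (m * 0 + 0 - (\<nu> i - mean_frequency)) / \<kappa>) at_top"
    using \<kappa>_pos v0 by (intro tendsto_intros) auto
  moreover have "(m * v' i t + relvel i t - (\<nu> i - mean_frequency)) / \<kappa> = force i t" for t
    using m_pos \<kappa>_pos by (simp add: v'_def imbalance_def)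
  ultimately show ?thesis by simp
qed

text \<open>Write \<^term>\<open>Z\<close> for the mean of the points \<^term>\<open>cis (\<theta> k t)\<close>.  The force on
  oscillator \<^term>\<open>i\<close> is the imaginary part of \<^term>\<open>Z * cnj (cis (\<theta> i t))\<close>, and the real parts
  \<^term>\<open>S i t\<close> of these numbers add up to \<^term>\<open>real N * (cmod Z)\<^sup>2\<close>.  So \<^term>\<open>(cmod Z)\<^sup>2\<close> converges,
  hence so do the \<^term>\<open>S i t\<close>, and since \<^term>\<open>Z\<close> stays away from zero the relative phases converge
  modulo full turns.\<close>

lemma phase_locking_of_bounded_solution:
  assumes bd: "\<And>i j t. i \<in> {1..N} \<Longrightarrow> j \<in> {1..N} \<Longrightarrow> t \<ge> 0 \<Longrightarrow> \<bar>\<theta> i t - \<theta> j t\<bar> \<le> M"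
    and r0: "r0 > 0"
    and ordered: "\<forall>\<^sub>F t in at_top. r0 \<le> ((\<Sum>k=1..N. cos (\<theta> k t)) / real N)\<^sup>2 + ((\<Sum>k=1..N. sin (\<theta> k t)) / real N)\<^sup>2"
  shows "asymptotic_phase_locking N \<theta>"
proof -
  define X where "X t = (\<Sum>k=1..N. cos (\<theta> k t)) / real N" for t
  define Y where "Y t = (\<Sum>k=1..N. sin (\<theta> k t)) / real N" for t
  define \<rho> where "\<rho> t = (X t)\<^sup>2 + (Y t)\<^sup>2" for t
  define S where "S i t = X t * cos (\<theta> i t) + Y t * sin (\<theta> i t)" for i t
  have F: "force i t = Y t * cos (\<theta> i t) - X t * sin (\<theta> i t)" for i t
    by (simp add: force_def coupling_def X_def Y_def sin_diff sum_subtractf sum_distrib_right diff_divide_distrib)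
  have sq: "(S i t)\<^sup>2 + (force i t)\<^sup>2 = \<rho> t" for i t
  proof -
    have "(S i t)\<^sup>2 + (force i t)\<^sup>2 = \<rho> t * ((sin (\<theta> i t))\<^sup>2 + (cos (\<theta> i t))\<^sup>2)"
      unfolding S_def F \<rho>_def by algebra
    then show ?thesis by simp
  qed
  have sumS: "(\<Sum>i=1..N. S i t) = real (card {1..N}) * \<rho> t" for t
  proof -
    have "(\<Sum>k=1..N. cos (\<theta> k t)) = real N * X t" "(\<Sum>k=1..N. sin (\<theta> k t)) = real N * Y t"
      using N_pos by (simp_all add: X_def Y_def)
    moreover have "(\<Sum>i=1..N. S i t) = X t * (\<Sum>k=1..N. cos (\<theta> k t)) + Y t * (\<Sum>k=1..N. sin (\<theta> k t))"
      by (simp add: S_def sum.distrib sum_distrib_left)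
    ultimately show ?thesis by (simp add: \<rho>_def power2_eq_square algebra_simps)
  qed
  have cX: "continuous_on {0..} X" and cY: "continuous_on {0..} Y"
    unfolding X_def[abs_def] Y_def[abs_def]
    by (intro continuous_intros continuous_\<theta>; use N_pos in simp)+
  have c\<rho>: "continuous_on {0..} \<rho>" unfolding \<rho>_def[abs_def] by (intro continuous_intros cX cY)
  have X1: "\<bar>X t\<bar> \<le> 1" and Y1: "\<bar>Y t\<bar> \<le> 1" for t
  proof -
    have "\<bar>\<Sum>k=1..N. cos (\<theta> k t)\<bar> \<le> (\<Sum>k=1..N. 1)" "\<bar>\<Sum>k=1..N. sin (\<theta> k t)\<bar> \<le> (\<Sum>k=1..N. 1)"
      by (intro order_trans[OF sum_abs] sum_mono; simp)+
    then show "\<bar>X t\<bar> \<le> 1" "\<bar>Y t\<bar> \<le> 1" using N_pos by (auto simp: X_def Y_def field_simps)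
  qed
  have b\<rho>: "\<bar>\<rho> t\<bar> \<le> 2" for t
  proof -
    have "(X t)\<^sup>2 \<le> 1" "(Y t)\<^sup>2 \<le> 1" using X1[of t] Y1[of t] by (simp_all add: abs_square_le_1)
    then show ?thesis by (simp add: \<rho>_def)
  qed
  note Flim = forces_converge[OF bd]
  obtain L where L: "(\<rho> \<longlongrightarrow> L) at_top"
    using self_consistent_convergence[OF _ _ c\<rho> b\<rho> sq sumS Flim] N_pos by auto
  have "r0 \<le> L"
    using ordered by (intro tendsto_lowerbound[OF L]) (auto simp: \<rho>_def X_def Y_def)
  then have Lpos: "L > 0" using r0 by simp
  have Slim: "\<exists>s. (S i \<longlongrightarrow> s) at_top" if i: "i \<in> {1..N}" for i
  proof -
    define s where "s = sqrt (L - (- (\<nu> i - mean_frequency) / \<kappa>)\<^sup>2)"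
    have "((\<lambda>t. sqrt (\<rho> t - (force i t)\<^sup>2)) \<longlongrightarrow> s) at_top"
      unfolding s_def by (intro tendsto_intros L Flim i)
    moreover have "sqrt (\<rho> t - (force i t)\<^sup>2) = \<bar>S i t\<bar>" for t
      using sq[of i t] by (metis add_diff_cancel_right' real_sqrt_abs)
    ultimately have abs: "((\<lambda>t. \<bar>S i t\<bar>) \<longlongrightarrow> s) at_top" by simp
    then have s0: "s \<ge> 0" by (rule tendsto_lowerbound) auto
    have "\<exists>l\<in>{s, - s}. (S i \<longlongrightarrow> l) at_top"
    proof (rule tendsto_of_approaching_discrete_set)
      show "continuous_on {0..} (S i)" unfolding S_def[abs_def]
        by (intro continuous_intros cX cY continuous_\<theta> i)
      show "(if s = 0 then 1 else 2 * s) > 0" using s0 by simp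
      show "(if s = 0 then 1 else 2 * s) \<le> \<bar>x - y\<bar>" if "x \<in> {s, - s}" "y \<in> {s, - s}" "x \<noteq> y" for x y
        using that s0 by auto
      fix \<epsilon> :: real assume "\<epsilon> > 0"
      then have "\<forall>\<^sub>F t in at_top. \<bar>\<bar>S i t\<bar> - s\<bar> < \<epsilon>" using tendstoD[OF abs] by (simp add: dist_real_def)
      then show "\<forall>\<^sub>F t in at_top. \<exists>x\<in>{s, - s}. \<bar>S i t - x\<bar> < \<epsilon>"
        by eventually_elim (auto simp: abs_if split: if_splits)
    qed
    then show ?thesis by blast
  qed
  show ?thesis unfolding asymptotic_phase_locking_def
  proof (intro ballI)
    fix i j assume i: "i \<in> {1..N}" and j: "j \<in> {1..N}"
    obtain si sj where s: "(S i \<longlongrightarrow> si) at_top" "(S j \<longlongrightarrow> sj) at_top" using Slim i j by blast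
    define fi where "fi k = - (\<nu> k - mean_frequency) / \<kappa>" for k
    have f: "(force i \<longlongrightarrow> fi i) at_top" "(force j \<longlongrightarrow> fi j) at_top"
      using Flim i j by (auto simp: fi_def)
    have ev: "\<forall>\<^sub>F t in at_top. \<rho> t \<noteq> 0" using tendsto_imp_eventually_ne[OF L] Lpos by simp
    have "((\<lambda>t. (S i t * S j t + force i t * force j t) / \<rho> t) \<longlongrightarrow> (si * sj + fi i * fi j) / L) at_top"
      using Lpos by (intro tendsto_intros s f L) auto
    moreover have "S i t * S j t + force i t * force j t = \<rho> t * cos (\<theta> i t - \<theta> j t)" for t
      unfolding S_def F \<rho>_def cos_diff by (simp add: power2_eq_square algebra_simps)
    ultimately have "((\<lambda>t. \<rho> t * cos (\<theta> i t - \<theta> j t) / \<rho> t) \<longlongrightarrow> (si * sj + fi i * fi j) / L) at_top" by simp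
    then have C: "((\<lambda>t. cos (\<theta> i t - \<theta> j t)) \<longlongrightarrow> (si * sj + fi i * fi j) / L) at_top"
      by (rule Lim_transform_eventually) (use ev in eventually_elim, simp)
    have "((\<lambda>t. (S i t * force j t - force i t * S j t) / \<rho> t) \<longlongrightarrow> (si * fi j - fi i * sj) / L) at_top"
      using Lpos by (intro tendsto_intros s f L) auto
    moreover have "S i t * force j t - force i t * S j t = \<rho> t * sin (\<theta> i t - \<theta> j t)" for t
      unfolding S_def F \<rho>_def sin_diff by (simp add: power2_eq_square algebra_simps)
    ultimately have "((\<lambda>t. \<rho> t * sin (\<theta> i t - \<theta> j t) / \<rho> t) \<longlongrightarrow> (si * fi j - fi i * sj) / L) at_top" by simp
    then have "((\<lambda>t. sin (\<theta> i t - \<theta> j t)) \<longlongrightarrow> (si * fi j - fi i * sj) / L) at_top"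
      by (rule Lim_transform_eventually) (use ev in eventually_elim, simp)
    moreover have "continuous_on {0..} (\<lambda>t. \<theta> i t - \<theta> j t)" by (intro continuous_intros continuous_\<theta> i j)
    ultimately show "\<exists>L. ((\<lambda>t. \<theta> i t - \<theta> j t) \<longlongrightarrow> L) at_top"
      using tendsto_of_cos_sin_tendsto C by blast
  qed
qed

end


section \<open>Maximal ensembles\<close>

text \<open>The mean is projected to the direction \<^term>\<open>\<psi>\<close> of the midpoint of the cluster, which is
  within \<^term>\<open>l / 2\<close> of all its members.\<close>

lemma order_parameter_lower_bound:
  fixes x :: "nat \<Rightarrow> real"
  assumes N: "N \<ge> 1" and C: "C \<subseteq> {1..N}" "C \<noteq> {}" "lam * real N \<le> real (card C)"
    and l: "fam_diam C x \<le> l" "l \<le> pi" and pos: "0 \<le> lam * cos (l / 2) - (1 - lam)"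
  shows "(lam * cos (l / 2) - (1 - lam))\<^sup>2 \<le> ((\<Sum>k=1..N. cos (x k)) / real N)\<^sup>2 + ((\<Sum>k=1..N. sin (x k)) / real N)\<^sup>2"
proof -
  have fin: "finite C" using C finite_subset by blast
  obtain i j where ij: "i \<in> C" "j \<in> C" "x i - x j = fam_diam C x" using fam_diam_attained[OF fin C(2)] by blast
  define \<psi> where "\<psi> = (x i + x j) / 2"
  define X where "X = (\<Sum>k=1..N. cos (x k)) / real N"
  define Y where "Y = (\<Sum>k=1..N. sin (x k)) / real N"
  have "lam * cos (l / 2) - (1 - lam) \<le> (\<Sum>k=1..N. cos (x k - \<psi>)) / real N"
  proof (rule mean_cos_lower_bound[OF N C(1,3)])
    fix k assume k: "k \<in> C"
    have "x k - x j \<le> fam_diam C x" "x i - x k \<le> fam_diam C x"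
      using diff_le_fam_diam[OF fin k ij(2), of x] diff_le_fam_diam[OF fin ij(1) k, of x] by auto
    then have "\<bar>x k - \<psi>\<bar> \<le> l / 2" using ij(3) l(1) unfolding \<psi>_def by (intro abs_leI) (simp_all add: field_simps)
    moreover have "l / 2 \<le> pi" using l(2) pi_gt_zero by linarith
    ultimately have "cos (l / 2) \<le> cos \<bar>x k - \<psi>\<bar>" by (intro cos_monotone_0_pi_le) auto
    then show "cos (l / 2) \<le> cos (x k - \<psi>)" by simp
  qed simp
  also have "(\<Sum>k=1..N. cos (x k - \<psi>)) / real N = X * cos \<psi> + Y * sin \<psi>"
    by (simp add: X_def Y_def cos_diff sum.distrib sum_distrib_right add_divide_distrib)
  finally have "(lam * cos (l / 2) - (1 - lam))\<^sup>2 \<le> (X * cos \<psi> + Y * sin \<psi>)\<^sup>2"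
    using pos by (intro power_mono)
  also have "\<dots> \<le> (X * cos \<psi> + Y * sin \<psi>)\<^sup>2 + (X * sin \<psi> - Y * cos \<psi>)\<^sup>2" by simp
  also have "\<dots> = (X\<^sup>2 + Y\<^sup>2) * ((sin \<psi>)\<^sup>2 + (cos \<psi>)\<^sup>2)" by algebra
  finally show ?thesis by (simp add: X_def Y_def)
qed

lemma bounded_of_eventually_bounded:
  fixes y :: "real \<Rightarrow> real"
  assumes "continuous_on {0..} y" and "\<And>t. t \<ge> T \<Longrightarrow> \<bar>y t\<bar> \<le> M"
  shows "\<exists>M'. \<forall>t\<ge>0. \<bar>y t\<bar> \<le> M'"
proof -
  have "compact (y ` {0..T})"
    by (intro compact_continuous_image continuous_on_subset[OF assms(1)]) auto
  then obtain K where K: "\<And>t. t \<in> {0..T} \<Longrightarrow> \<bar>y t\<bar> \<le> K"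
    using compact_imp_bounded by (fastforce simp: bounded_iff)
  have "\<bar>y t\<bar> \<le> max K M" if "t \<ge> 0" for t
    using K[of t] assms(2)[of t] that by (cases "t \<le> T") (auto intro: max.coboundedI1 max.coboundedI2)
  then show ?thesis by blast
qed

lemma diameter_insert_le:
  fixes x :: real
  assumes fin: "finite Y" and y: "y \<in> Y"
  shows "diameter (insert x Y) \<le> \<bar>x - y\<bar> + diameter Y"
proof (rule diameter_le)
  have bY: "bounded Y" using fin by (rule finite_imp_bounded)
  have d: "\<bar>u - v\<bar> \<le> diameter Y" if "u \<in> Y" "v \<in> Y" for u v
    using diameter_bounded_bound[OF bY that] by (simp add: dist_real_def)
  have xv: "\<bar>x - v\<bar> \<le> \<bar>x - y\<bar> + diameter Y" if "v \<in> Y" for v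
    using d[OF y that] by linarith
  have nn: "0 \<le> diameter Y" using bY by (rule diameter_ge_0)
  fix u v assume "u \<in> insert x Y" "v \<in> insert x Y"
  then show "norm (u - v) \<le> \<bar>x - y\<bar> + diameter Y"
    using xv[of u] xv[of v] d[of u v] nn by (auto simp: abs_minus_commute)
qed simp

lemma eventually_at_top_late:
  fixes T :: real
  assumes "eventually P at_top"
  shows "\<exists>t\<ge>T. P t"
  using eventually_happens[OF eventually_conj[OF eventually_ge_at_top[of T] assms]] by auto

lemma fam_diam_cong: "(\<And>i. i \<in> C \<Longrightarrow> x i = y i) \<Longrightarrow> fam_diam C x = fam_diam C y"
  by (simp cong: image_cong)

context inertial_kuramoto
begin

text \<open>Both clusters have diameter at most about \<open>\<phi>\<^sub>1\<close>, so a common subcluster lies within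
  that distance of each of the two extremal members of the union.  The wider apart these are, the
  closer is the common subcluster to their midpoint, and the stronger is its pull on both.  Hence
  for extremal distances between \<open>\<phi>\<^sub>1\<close> and \<open>2 \<phi>\<^sub>1\<close>, even beyond \<open>\<phi>\<^sub>2\<close>, the
  attraction is at least as strong as at distance \<open>\<phi>\<^sub>1\<close>.\<close>

lemma union_concentrates:
  assumes lam: "1 / 2 < lam" "lam \<le> 1" and l: "0 < l" "l < 2 * arccos ((1 - lam) / lam)"
    and B: "B \<subseteq> {1..N}" and d: "level B < f_lam lam l"
    and A: "lam * real N \<le> real (card A)" "A \<subseteq> C" "A \<subseteq> C'" and C: "C \<subseteq> B" "C' \<subseteq> B"
    and conc: "ensemble_concentrates lam (level B) C \<theta>"
      "ensemble_concentrates lam (level B) C' \<theta>"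
  shows "ensemble_concentrates lam (level B) (C \<union> C') \<theta>"
proof -
  note roots = f_lam_two_roots[OF lam l delta_pos(2)[OF B] d]
  define D where "D = C \<union> C'"
  have finB: "finite B" using B finite_subset by blast
  have fin: "finite C" "finite C'" "finite D" using C finB finite_subset by (auto simp: D_def)
  have "A \<noteq> {}" using A(1) lam N_pos by (auto simp: mult_le_0_iff)
  then obtain k0 where k0: "k0 \<in> A" by blast
  have DB: "D \<subseteq> B" "D \<noteq> {}" using C A k0 by (auto simp: D_def)
  obtain a where a: "phi1 lam (level B) < a" "a < min (pi / 2) (phi2 lam (level B))"
    using dense[of "phi1 lam (level B)" "min (pi / 2) (phi2 lam (level B))"] roots(2,3,4) by auto
  have a0: "0 < a" using roots(1) a(1) by simp
  define q where "q = lam * cos (a / 2) - (1 - lam)"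
  have fa: "f_lam lam a = 2 * sin (a / 2) * q" by (simp add: f_lam_eq q_def)
  have fgt: "level B < f_lam lam a" using roots(7) a by simp
  have "0 < sin (a / 2)" using a0 a(2) by (intro sin_gt_zero) auto
  moreover have "0 < 2 * sin (a / 2) * q" using fa fgt delta_pos(2)[OF B] by linarith
  ultimately have q: "q > 0" by (simp add: zero_less_mult_iff)
  define e where "e = (f_lam lam a - level B) / 2"
  have e: "e > 0" using fgt by (simp add: e_def)
  have "\<forall>\<^sub>F t in at_top. t > 0 \<and> transient B t < e \<and> spread C t \<le> a \<and> spread C' t \<le> a"
  proof -
    have "\<forall>\<^sub>F t in at_top. transient B t < e" using order_tendstoD(2)[OF transient_tendsto e] .
    moreover have "\<forall>\<^sub>F t in at_top. spread C t \<le> a" "\<forall>\<^sub>F t in at_top. spread C' t \<le> a"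
      using conc a(1) unfolding ensemble_concentrates_iff by blast+
    ultimately show ?thesis using eventually_gt_at_top[of 0] by eventually_elim blast
  qed
  then obtain T where "\<forall>t\<ge>T. t > 0 \<and> transient B t < e \<and> spread C t \<le> a \<and> spread C' t \<le> a"
    unfolding eventually_at_top_linorder by blast
  then have T: "T > 0" "\<And>t. t \<ge> T \<Longrightarrow> transient B t < e"
    "\<And>t. t \<ge> T \<Longrightarrow> spread C t \<le> a" "\<And>t. t \<ge> T \<Longrightarrow> spread C' t \<le> a" by auto
  have near: "\<theta> i t - \<theta> k t \<le> a" "\<theta> k t - \<theta> i t \<le> a" if "i \<in> D" "k \<in> A" "t \<ge> T" for i k t
  proof -
    have "i \<in> C \<or> i \<in> C'" "k \<in> C" "k \<in> C'" using that A by (auto simp: D_def)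
    then show "\<theta> i t - \<theta> k t \<le> a" "\<theta> k t - \<theta> i t \<le> a"
      using T(3,4)[OF that(3)] fin
        diff_le_fam_diam[of C i k "\<lambda>i. \<theta> i t"] diff_le_fam_diam[of C k i "\<lambda>i. \<theta> i t"]
        diff_le_fam_diam[of C' i k "\<lambda>i. \<theta> i t"] diff_le_fam_diam[of C' k i "\<lambda>i. \<theta> i t"]
      by (meson order_trans)+
  qed
  define r where "r = (1 - exp (- T / m)) * \<kappa> * e"
  have r: "r > 0" using T(1) m_pos \<kappa>_pos e by (simp add: r_def)
  have decay: "\<omega> i t - \<omega> j t \<le> - r"
    if t: "t \<ge> T" and ij: "i \<in> D" "j \<in> D" and range: "a \<le> \<theta> i t - \<theta> j t" "\<theta> i t - \<theta> j t \<le> 2 * a" for i j t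
  proof -
    define y where "y = \<theta> i t - \<theta> j t"
    have y: "a \<le> y" "y \<le> 2 * a" using range by (auto simp: y_def)
    have "cos (a / 2) \<le> cos (\<theta> k t - (\<theta> i t + \<theta> j t) / 2)" if k: "k \<in> A" for k
    proof -
      have "\<bar>\<theta> k t - (\<theta> i t + \<theta> j t) / 2\<bar> \<le> a - y / 2"
        using near[OF ij(1) k t] near[OF ij(2) k t] unfolding y_def by (intro abs_leI) (simp_all add: field_simps)
      then have "cos (a / 2) \<le> cos \<bar>\<theta> k t - (\<theta> i t + \<theta> j t) / 2\<bar>"
        using y a by (intro cos_monotone_0_pi_le) auto
      then show ?thesis by simp
    qed
    then have "\<omega> i t - \<omega> j t \<le> (1 - exp (- t / m)) * \<kappa> *
        (level B + transient B t - 2 * sin ((\<theta> i t - \<theta> j t) / 2) * (lam * cos (a / 2) - (1 - lam)))"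
      using A C DB ij t T(1) range a a0
      by (intro first_order_velocity_estimate[OF B, where S = A]) auto
    also have "\<dots> \<le> (1 - exp (- t / m)) * \<kappa> * (- e)"
    proof (rule mult_left_mono)
      have "sin (a / 2) \<le> sin (y / 2)" using y a a0 by (intro sin_monotone_2pi_le) auto
      then have "f_lam lam a \<le> 2 * sin (y / 2) * q" unfolding fa using q by (intro mult_right_mono) auto
      then show "level B + transient B t - 2 * sin ((\<theta> i t - \<theta> j t) / 2) * (lam * cos (a / 2) - (1 - lam)) \<le> - e"
        using T(2)[OF t] unfolding y_def q_def e_def by (simp add: field_simps)
      show "0 \<le> (1 - exp (- t / m)) * \<kappa>" using \<kappa>_pos m_pos t T(1) by simp
    qed
    also have "\<dots> \<le> - r" unfolding r_def using t e by (intro damping_factor_mono) auto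
    finally show ?thesis .
  qed
  have "\<forall>\<^sub>F t in at_top. spread D t \<le> a"
  proof (rule diameter_contracts(2)[OF _ DB(2) T(1) _ r])
    show "D \<subseteq> {1..N}" using DB B by blast
    show "a \<le> 2 * a" using a0 by simp
    show "spread D T \<le> 2 * a"
      unfolding fam_diam_le_iff[OF fin(3) DB(2)]
    proof (intro ballI)
      fix i j assume "i \<in> D" "j \<in> D"
      then show "\<theta> i T - \<theta> j T \<le> 2 * a" using near[of i k0 T] near[of j k0 T] k0 by auto
    qed
    show "\<forall>t\<ge>T. \<forall>i\<in>D. \<forall>j\<in>D. \<theta> i t - \<theta> j t = spread D t \<longrightarrow>
      a \<le> \<theta> i t - \<theta> j t \<longrightarrow> \<theta> i t - \<theta> j t \<le> 2 * a \<longrightarrow> \<omega> i t - \<omega> j t \<le> - r"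
      using decay by blast
  qed
  then have late: "\<exists>t\<ge>T. spread D t \<le> a" for T
    by (rule eventually_at_top_late)
  have "A \<subseteq> D" using A by (auto simp: D_def)
  then have "real (card A) \<le> real (card D)" using fin by (simp add: card_mono)
  then show ?thesis unfolding D_def[symmetric]
    using cluster_concentrates[OF lam l B d DB(1) _ _ late] A(1) a(2) by simp
qed

end

locale trapping_ensemble = inertial_kuramoto +
  fixes lam l :: real and A B :: "nat set"
  assumes lam: "1 / 2 < lam" "lam \<le> 1" and l: "0 < l" "l < 2 * arccos ((1 - lam) / lam)"
    and A_B: "A \<subseteq> B" and B: "B \<subseteq> {1..N}" and A_card: "lam * real N \<le> real (card A)"
    and gap: "level B < f_lam lam l"
    and enters: "\<forall>\<^sub>F t in at_top. spread A t \<le> l"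
begin

abbreviation \<delta> :: real where "\<delta> \<equiv> level B"
abbreviation \<phi>1 :: real where "\<phi>1 \<equiv> phi1 lam \<delta>"
abbreviation \<phi>2 :: real where "\<phi>2 \<equiv> phi2 lam \<delta>"

lemmas roots = f_lam_two_roots[OF lam l delta_pos(2)[OF B] gap]

lemma \<phi>2_le_pi: "\<phi>2 \<le> pi"
proof -
  have "arccos ((1 - lam) / lam) \<le> pi / 2" using lam arccos_le_pi2[of "(1 - lam) / lam"] by simp
  then show ?thesis using roots(5) by simp
qed

lemma finite_B: "finite B" using B finite_subset by blast

lemma A_nonempty: "A \<noteq> {}"
  using A_card lam N_pos by (auto simp: mult_le_0_iff)

lemma card_ge: "A \<subseteq> C \<Longrightarrow> C \<subseteq> B \<Longrightarrow> lam * real N \<le> real (card C)"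
  using A_card card_mono[of C A] finite_B finite_subset by fastforce

text \<open>The time \<^term>\<open>T\<close> serves all clusters and translations at once, since the transient
  depends on \<^term>\<open>B\<close> and the initial velocities only.  This makes separation uniform over the
  infinitely many translates of an outsider.\<close>

lemma eventually_trapping:
  assumes c: "\<phi>1 < c" "c < \<phi>2"
  obtains T where "T > 0"
    "\<And>C k s t. A \<subseteq> C \<Longrightarrow> C \<subseteq> B \<Longrightarrow> T \<le> s \<Longrightarrow> s \<le> t \<Longrightarrow>
      translated_spread k C s \<le> c \<Longrightarrow> translated_spread k C t \<le> c"
proof -
  obtain T e where T: "T > 0" "e > 0" and
    gap: "\<And>t x. T \<le> t \<Longrightarrow> c \<le> x \<Longrightarrow> x \<le> c \<Longrightarrow> \<delta> + transient B t + e \<le> f_lam lam x"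
    using eventually_force_dominates[OF lam l B gap c(1) order_refl c(2)] by blast
  show thesis
  proof (rule that[OF T(1)])
    fix C k s t assume *: "A \<subseteq> C" "C \<subseteq> B" "T \<le> s" "s \<le> t" "translated_spread k C s \<le> c"
    show "translated_spread k C t \<le> c"
    proof (rule inertial_kuramoto.cluster_contracts(1)[OF inertial_kuramoto_translate B *(2) card_ge[OF *(1,2)] _ _ T(2) order_refl _ _ *(5,4)])
      show "\<delta> + transient B t + e \<le> f_lam lam x" if "s \<le> t" "c \<le> x" "x \<le> c" for t x
        using gap[of t x] that *(3) by linarith
      show "0 < lam" "0 < s" "c \<le> pi" using lam T(1) *(3) c(2) \<phi>2_le_pi by linarith+
    qed
  qed
qed

lemma concentrates_translate:
  assumes C: "A \<subseteq> C" "C \<subseteq> B" and c: "c < \<phi>2"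
    and late: "\<And>T. \<exists>t\<ge>T. translated_spread k C t \<le> c"
  shows "ensemble_concentrates lam \<delta> C (translate k \<theta>)"
  by (rule inertial_kuramoto.cluster_concentrates[OF inertial_kuramoto_translate lam l B gap C(2) card_ge[OF C] c late])

lemma translate_zero: "translate (\<lambda>_. 0) \<theta> = \<theta>"
  by (simp add: translate_def fun_eq_iff)

lemma A_concentrates: "ensemble_concentrates lam \<delta> A \<theta>"
proof -
  have "\<exists>t\<ge>T. spread A t \<le> l" for T
    using enters by (rule eventually_at_top_late)
  then show ?thesis
    using concentrates_translate[of A l "\<lambda>_. 0"] A_B roots(3) by (simp add: translate_zero)
qed

text \<open>If the phase of \<^term>\<open>i\<close> meets, modulo full turns, that of a member of \<^term>\<open>A\<close> at a late
  time, then it is trapped from that time on; otherwise it stays between two consecutive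
  representatives of that phase.\<close>

lemma relative_phase_bounded:
  assumes i: "i \<in> B" and j: "j \<in> A"
  shows "\<exists>M. \<forall>t\<ge>0. \<bar>\<theta> i t - \<theta> j t\<bar> \<le> M"
proof -
  obtain T where T: "T > 0"
    "\<And>C k s t. A \<subseteq> C \<Longrightarrow> C \<subseteq> B \<Longrightarrow> T \<le> s \<Longrightarrow> s \<le> t \<Longrightarrow>
      translated_spread k C s \<le> l \<Longrightarrow> translated_spread k C t \<le> l"
    using eventually_trapping[OF roots(2,3)] by blast
  obtain T0 where T0: "\<And>t. t \<ge> T0 \<Longrightarrow> spread A t \<le> l"
    using enters unfolding eventually_at_top_linorder by blast
  define T1 where "T1 = max T T0"
  have T1: "T1 \<ge> T" "T1 \<ge> T0" "T1 > 0" using T(1) by (auto simp: T1_def)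
  define y where "y t = \<theta> i t - \<theta> j t" for t
  have ijN: "i \<in> {1..N}" "j \<in> {1..N}" using i j A_B B by auto
  have cont: "continuous_on {0..} y" unfolding y_def[abs_def] using ijN by (intro continuous_intros continuous_\<theta>)
  have "\<exists>M T'. \<forall>t\<ge>T'. \<bar>y t\<bar> \<le> M"
  proof (cases "\<exists>s\<ge>T1. \<exists>n::int. y s = 2 * of_int n * pi")
    case True
    then obtain s and n :: int where s: "s \<ge> T1" "y s = 2 * of_int n * pi" by blast
    show ?thesis
    proof (cases "i \<in> A")
      case True
      have "\<bar>y t\<bar> \<le> l" if "t \<ge> T1" for t
        using T0[of t] that T1(2) diff_le_fam_diam[of A i j "\<lambda>i. \<theta> i t"] diff_le_fam_diam[of A j i "\<lambda>i. \<theta> i t"]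
          True j finite_subset[OF A_B finite_B] by (auto simp: y_def)
      then show ?thesis by blast
    next
      case False
      define k where "k = (\<lambda>_. 0)(i := n)"
      define C where "C = insert i A"
      have C: "A \<subseteq> C" "C \<subseteq> B" using i A_B by (auto simp: C_def)
      have finC: "finite C" using C finite_B finite_subset by blast
      have tr: "translate k \<theta> h t = \<theta> h t" if "h \<in> A" for h t
        using that False by (auto simp: translate_def k_def)
      have "(\<lambda>h. translate k \<theta> h s) ` C = (\<lambda>h. \<theta> h s) ` A"
      proof -
        have "translate k \<theta> i s = \<theta> j s" using s(2) by (simp add: translate_def k_def y_def)
        moreover have "(\<lambda>h. translate k \<theta> h s) ` A = (\<lambda>h. \<theta> h s) ` A" using tr by (intro image_cong) auto
        ultimately show ?thesis using j unfolding C_def by auto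
      qed
      then have start: "translated_spread k C s \<le> l" using T0[of s] s(1) T1(2) by simp
      have "\<bar>y t\<bar> \<le> l + \<bar>2 * of_int n * pi\<bar>" if t: "t \<ge> s" for t
      proof -
        have "translated_spread k C t \<le> l" using T(2)[OF C _ t start] s(1) T1(1) by simp
        moreover have "translate k \<theta> i t - translate k \<theta> j t \<le> translated_spread k C t"
          "translate k \<theta> j t - translate k \<theta> i t \<le> translated_spread k C t"
          using j by (intro diff_le_fam_diam[OF finC]; simp add: C_def)+
        moreover have "translate k \<theta> i t = \<theta> i t - 2 * of_int n * pi" by (simp add: translate_def k_def)
        ultimately show ?thesis using tr[OF j, of t] unfolding y_def by linarith
      qed
      then show ?thesis by blast
    qed
  next
    case False
    define n where "n = \<lfloor>y T1 / (2 * pi)\<rfloor>"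
    have n: "2 * of_int n * pi \<le> y T1" "y T1 \<le> 2 * of_int (n + 1) * pi"
    proof -
      have "of_int n \<le> y T1 / (2 * pi)" "y T1 / (2 * pi) \<le> of_int n + 1"
        unfolding n_def by linarith+
      then show "2 * of_int n * pi \<le> y T1" "y T1 \<le> 2 * of_int (n + 1) * pi"
        by (simp_all add: field_simps)
    qed
    have "2 * of_int n * pi \<le> y t \<and> y t \<le> 2 * of_int (n + 1) * pi" if t: "t \<ge> T1" for t
    proof (rule ccontr)
      assume "\<not> ?thesis"
      then consider "y t < 2 * of_int n * pi" | "2 * of_int (n + 1) * pi < y t" by linarith
      then show False
      proof cases
        case 1
        then have "\<exists>s\<ge>T1. s \<le> t \<and> y s = 2 * of_int n * pi"
          using n t T1(3) by (intro IVT2' continuous_on_subset[OF cont]) auto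
        then show False using False by blast
      next
        case 2
        then have "\<exists>s\<ge>T1. s \<le> t \<and> y s = 2 * of_int (n + 1) * pi"
          using n t T1(3) by (intro IVT' continuous_on_subset[OF cont]) auto
        then show False using False by blast
      qed
    qed
    then have "\<bar>y t\<bar> \<le> \<bar>2 * of_int n * pi\<bar> + \<bar>2 * of_int (n + 1) * pi\<bar>" if "t \<ge> T1" for t
      using that by fastforce
    then show ?thesis by blast
  qed
  then show ?thesis using bounded_of_eventually_bounded[OF cont] unfolding y_def by blast
qed

lemma relative_phases_bounded:
  obtains M where "\<And>i j t. i \<in> B \<Longrightarrow> j \<in> B \<Longrightarrow> t \<ge> 0 \<Longrightarrow> \<theta> i t - \<theta> j t \<le> M"
proof -
  obtain a where a: "a \<in> A" using A_nonempty by blast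
  have "\<forall>i\<in>B. \<exists>M. \<forall>t\<ge>0. \<bar>\<theta> i t - \<theta> a t\<bar> \<le> M" using relative_phase_bounded a by blast
  then obtain f where f: "\<And>i t. i \<in> B \<Longrightarrow> t \<ge> 0 \<Longrightarrow> \<bar>\<theta> i t - \<theta> a t\<bar> \<le> f i"
    using bchoice[of B "\<lambda>i M. \<forall>t\<ge>0. \<bar>\<theta> i t - \<theta> a t\<bar> \<le> M"] by blast
  have le: "f i \<le> Max (f ` B)" if "i \<in> B" for i using that finite_B by simp
  have "\<theta> i t - \<theta> j t \<le> 2 * Max (f ` B)" if "i \<in> B" "j \<in> B" "t \<ge> 0" for i j t
    using f[OF that(1,3)] f[OF that(2,3)] le[OF that(1)] le[OF that(2)] by linarith
  then show thesis by (rule that)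
qed

lemma sup_diameter_finite: "(SUP t\<in>{0..}. ereal (spread B t)) < \<infinity>"
proof -
  have ne: "B \<noteq> {}" using A_B A_nonempty by blast
  obtain M where "\<And>i j t. i \<in> B \<Longrightarrow> j \<in> B \<Longrightarrow> t \<ge> 0 \<Longrightarrow> \<theta> i t - \<theta> j t \<le> M"
    using relative_phases_bounded by blast
  then have "(SUP t\<in>{0..}. ereal (spread B t)) \<le> ereal M"
    by (intro SUP_least) (simp add: fam_diam_le_iff[OF finite_B ne])
  then show ?thesis by (rule le_less_trans) simp
qed

lemma phase_locking_of_full_ensemble:
  assumes "B = {1..N}"
  shows "asymptotic_phase_locking N \<theta>"
proof -
  obtain M where M: "\<And>i j t. i \<in> B \<Longrightarrow> j \<in> B \<Longrightarrow> t \<ge> 0 \<Longrightarrow> \<theta> i t - \<theta> j t \<le> M"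
    using relative_phases_bounded by blast
  have bd: "\<bar>\<theta> i t - \<theta> j t\<bar> \<le> M" if "i \<in> {1..N}" "j \<in> {1..N}" "t \<ge> 0" for i j t
    using M[of i j t] M[of j i t] that assms by auto
  have lpi: "l \<le> pi" using roots(3) \<phi>2_le_pi by simp
  have "cos (arccos ((1 - lam) / lam)) < cos (l / 2)" using l lpi by (intro cos_monotone_0_pi arccos_ubound) (use lam in \<open>auto simp: field_simps\<close>)
  then have "(1 - lam) / lam < cos (l / 2)" using lam by (simp add: field_simps)
  then have pos: "0 < lam * cos (l / 2) - (1 - lam)" using lam by (simp add: field_simps)
  show ?thesis
  proof (rule phase_locking_of_bounded_solution[OF bd])
    show "0 < (lam * cos (l / 2) - (1 - lam))\<^sup>2" using pos by simp
    show "\<forall>\<^sub>F t in at_top. (lam * cos (l / 2) - (1 - lam))\<^sup>2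
        \<le> ((\<Sum>k=1..N. cos (\<theta> k t)) / real N)\<^sup>2 + ((\<Sum>k=1..N. sin (\<theta> k t)) / real N)\<^sup>2"
      using enters
    proof eventually_elim
      case (elim t)
      then show ?case
        using A_B B A_nonempty A_card lpi pos
        by (intro order_parameter_lower_bound[OF N_pos, of A]) auto
    qed
  qed
qed

definition concentrating :: "nat set \<Rightarrow> (nat \<Rightarrow> int) \<Rightarrow> bool" where
  "concentrating C k \<longleftrightarrow> A \<subseteq> C \<and> C \<subseteq> B \<and> (\<forall>i. i \<notin> C - A \<longrightarrow> k i = 0) \<and>
    ensemble_concentrates lam \<delta> C (translate k \<theta>)"

abbreviation outsider_spread :: "(nat \<Rightarrow> int) \<Rightarrow> nat set \<Rightarrow> nat \<Rightarrow> int \<Rightarrow> real \<Rightarrow> real" where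
  "outsider_spread k C i n t \<equiv>
    diameter (insert (translate k \<theta> i t - 2 * pi * real_of_int n) ((\<lambda>j. translate k \<theta> j t) ` C))"

text \<open>An outsider that came close to \<^term>\<open>C\<close> at a late time would be trapped, and could be added
  to \<^term>\<open>C\<close> with a suitable translation.\<close>

lemma outsiders_eventually_far:
  assumes C: "concentrating C k" and max: "\<And>C' k'. concentrating C' k' \<Longrightarrow> C \<subseteq> C' \<Longrightarrow> C = C'"
    and c: "\<phi>1 < c" "c < \<phi>2"
  shows "\<forall>\<^sub>F t in at_top. \<forall>i\<in>B - C. \<forall>n::int.
    c < outsider_spread k C i n t"
proof -
  obtain T where T: "T > 0"
    "\<And>C k s t. A \<subseteq> C \<Longrightarrow> C \<subseteq> B \<Longrightarrow> T \<le> s \<Longrightarrow> s \<le> t \<Longrightarrow>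
      translated_spread k C s \<le> c \<Longrightarrow> translated_spread k C t \<le> c"
    using eventually_trapping[OF c] by blast
  have "c < outsider_spread k C i n s"
    if s: "s \<ge> T" and i: "i \<in> B" "i \<notin> C" for s i and n :: int
  proof (rule ccontr)
    assume close: "\<not> ?thesis"
    define k' where "k' = k(i := n)"
    define C' where "C' = insert i C"
    have C': "A \<subseteq> C'" "C' \<subseteq> B" "i \<notin> A" using C i by (auto simp: C'_def concentrating_def)
    have "k i = 0" using C i by (auto simp: concentrating_def)
    then have "(\<lambda>j. translate k' \<theta> j s) ` C' = insert (translate k \<theta> i s - 2 * pi * of_int n) ((\<lambda>j. translate k \<theta> j s) ` C)"
      using i unfolding C'_def k'_def by (auto simp: translate_def image_iff intro!: bexI)
    then have start: "translated_spread k' C' s \<le> c"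
      using close by simp
    have "\<exists>t\<ge>T'. translated_spread k' C' t \<le> c" for T'
      using T(2)[OF C'(1,2) s _ start, of "max s T'"] by (intro exI[of _ "max s T'"]) auto
    then have "ensemble_concentrates lam \<delta> C' (translate k' \<theta>)"
      by (rule concentrates_translate[OF C'(1,2) c(2)])
    then have "concentrating C' k'"
      using C C' unfolding concentrating_def by (auto simp: k'_def C'_def)
    then have "C = C'" by (rule max) (auto simp: C'_def)
    then show False using i by (auto simp: C'_def)
  qed
  then show ?thesis unfolding eventually_at_top_linorder by (intro exI[of _ T]) blast
qed

lemma maximal_concentrating_separated:
  assumes C: "concentrating C k" and max: "\<And>C' k'. concentrating C' k' \<Longrightarrow> C \<subseteq> C' \<Longrightarrow> C = C'"
  shows "ensemble_separated lam \<delta> B C (translate k \<theta>)"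
proof -
  have finC: "finite C" using C finite_B finite_subset by (auto simp: concentrating_def)
  have far: "\<forall>\<^sub>F t in at_top. \<forall>i\<in>B - C. \<forall>n::int.
      c < outsider_spread k C i n t" if "\<phi>1 < c" "c < \<phi>2" for c
    by (rule outsiders_eventually_far[OF C max that])
  have \<phi>12: "\<phi>1 < \<phi>2" using roots(2,3) by simp
  have 1: "ereal \<phi>2 \<le> Liminf at_top (\<lambda>t. INF (i, n)\<in>(B - C) \<times> (UNIV :: int set).
      ereal (outsider_spread k C i n t))"
  proof (rule Liminf_ereal_geI)
    fix a assume a: "a < \<phi>2"
    define c where "c = max a ((\<phi>1 + \<phi>2) / 2)"
    have c: "\<phi>1 < c" "c < \<phi>2" "a \<le> c" using a \<phi>12 by (auto simp: c_def less_max_iff_disj)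
    from far[OF c(1,2)]
    show "\<forall>\<^sub>F t in at_top. ereal a \<le> (INF (i, n)\<in>(B - C) \<times> (UNIV :: int set).
      ereal (outsider_spread k C i n t))"
    proof eventually_elim
      case (elim t)
      show ?case
      proof (rule INF_greatest, clarify)
        fix i and n :: int assume "i \<in> B" "i \<notin> C"
        then have "c < outsider_spread k C i n t" using elim by blast
        then show "ereal a \<le> ereal (outsider_spread k C i n t)"
          using c(3) by simp
      qed
    qed
  qed
  have 2: "ereal (\<phi>2 - \<phi>1) \<le> Liminf at_top (\<lambda>t. INF (i, j, n)\<in>(B - C) \<times> C \<times> (UNIV :: int set).
      ereal \<bar>translate k \<theta> i t - 2 * pi * real_of_int n - translate k \<theta> j t\<bar>)"
  proof (rule Liminf_ereal_geI)
    fix a assume a: "a < \<phi>2 - \<phi>1"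
    define e where "e = (\<phi>2 - \<phi>1 - a) / 2"
    define c where "c = max (\<phi>2 - e) ((\<phi>1 + \<phi>2) / 2)"
    have e: "e > 0" using a by (simp add: e_def)
    have c: "\<phi>1 < c" "c < \<phi>2" "\<phi>2 - e \<le> c" using e \<phi>12 by (auto simp: c_def less_max_iff_disj)
    have "\<phi>1 < \<phi>1 + e" using e by simp
    then have "\<forall>\<^sub>F t in at_top. translated_spread k C t \<le> \<phi>1 + e"
      using C unfolding concentrating_def ensemble_concentrates_iff by blast
    with far[OF c(1,2)]
    show "\<forall>\<^sub>F t in at_top. ereal a \<le> (INF (i, j, n)\<in>(B - C) \<times> C \<times> (UNIV :: int set).
      ereal \<bar>translate k \<theta> i t - 2 * pi * real_of_int n - translate k \<theta> j t\<bar>)"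
    proof eventually_elim
      case (elim t)
      show ?case
      proof (rule INF_greatest, clarify)
        fix i j and n :: int assume ij: "i \<in> B" "i \<notin> C" "j \<in> C"
        have "c < outsider_spread k C i n t" using elim ij by blast
        also have "\<dots> \<le> \<bar>translate k \<theta> i t - 2 * pi * real_of_int n - translate k \<theta> j t\<bar> + translated_spread k C t"
          using finC ij by (intro diameter_insert_le) auto
        finally have "c - (\<phi>1 + e) \<le> \<bar>translate k \<theta> i t - 2 * pi * real_of_int n - translate k \<theta> j t\<bar>" using elim(2) by linarith
        moreover have "a \<le> c - (\<phi>1 + e)" using c(3) by (simp add: e_def field_simps)
        ultimately show "ereal a \<le> ereal \<bar>translate k \<theta> i t - 2 * pi * real_of_int n - translate k \<theta> j t\<bar>" by simp
      qed
    qed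
  qed
  show ?thesis using 1 2 unfolding ensemble_separated_def by blast
qed

text \<open>Both translations put the phase of \<^term>\<open>i\<close> within a quarter turn of that of a common member of
  \<^term>\<open>A\<close>, so they differ by less than a full turn.\<close>

lemma translations_agree:
  assumes C: "concentrating C k" "concentrating C' k'" and i: "i \<in> C" "i \<in> C'"
  shows "k i = k' i"
proof -
  obtain a where a: "a \<in> A" using A_nonempty by blast
  have zero: "k a = 0" "k' a = 0" and aC: "a \<in> C" "a \<in> C'" using C a by (auto simp: concentrating_def)
  have fin: "finite C" "finite C'" using C finite_B finite_subset by (auto simp: concentrating_def)
  have "\<phi>1 < pi / 2" using roots(4) .
  then have "\<forall>\<^sub>F t in at_top. translated_spread k C t \<le> pi / 2 \<and> translated_spread k' C' t \<le> pi / 2"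
    using C unfolding concentrating_def ensemble_concentrates_iff by (intro eventually_conj) blast+
  then obtain t where t: "translated_spread k C t \<le> pi / 2" "translated_spread k' C' t \<le> pi / 2"
    by (auto dest: eventually_happens)
  have "translate k \<theta> i t - translate k \<theta> a t \<le> pi / 2" "translate k \<theta> a t - translate k \<theta> i t \<le> pi / 2"
    "translate k' \<theta> i t - translate k' \<theta> a t \<le> pi / 2" "translate k' \<theta> a t - translate k' \<theta> i t \<le> pi / 2"
    using diff_le_fam_diam[OF fin(1) i(1) aC(1), of "\<lambda>i. translate k \<theta> i t"]
      diff_le_fam_diam[OF fin(1) aC(1) i(1), of "\<lambda>i. translate k \<theta> i t"]
      diff_le_fam_diam[OF fin(2) i(2) aC(2), of "\<lambda>i. translate k' \<theta> i t"]
      diff_le_fam_diam[OF fin(2) aC(2) i(2), of "\<lambda>i. translate k' \<theta> i t"] t by linarith+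
  then have "2 * real_of_int (k i) * pi - 2 * real_of_int (k' i) * pi \<le> pi"
    "2 * real_of_int (k' i) * pi - 2 * real_of_int (k i) * pi \<le> pi"
    unfolding translate_def zero by simp_all
  then have "pi * (2 * real_of_int (k i - k' i)) \<le> pi * 1" "pi * (2 * real_of_int (k' i - k i)) \<le> pi * 1"
    by (simp_all add: algebra_simps)
  then have "real_of_int (2 * (k i - k' i)) \<le> real_of_int 1" "real_of_int (2 * (k' i - k i)) \<le> real_of_int 1"
    by simp_all
  then have "2 * (k i - k' i) \<le> 1" "2 * (k' i - k i) \<le> 1" unfolding of_int_le_iff by auto
  then show ?thesis by presburger
qed

lemma concentrating_union:
  assumes C: "concentrating C k" "concentrating C' k'"
  defines "k'' \<equiv> \<lambda>i. if i \<in> C then k i else k' i"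
  shows "concentrating (C \<union> C') k''"
    and "\<And>i. i \<in> C \<Longrightarrow> k'' i = k i" and "\<And>i. i \<in> C' \<Longrightarrow> k'' i = k' i"
proof -
  show k: "\<And>i. i \<in> C \<Longrightarrow> k'' i = k i" and k': "\<And>i. i \<in> C' \<Longrightarrow> k'' i = k' i"
    using translations_agree[OF C] by (auto simp: k''_def)
  have "translated_spread k'' C t = translated_spread k C t" for t
    using k by (intro fam_diam_cong) (simp add: translate_def)
  then have c: "ensemble_concentrates lam \<delta> C (translate k'' \<theta>)"
    using C(1) by (simp add: concentrating_def ensemble_concentrates_def)
  have "translated_spread k'' C' t = translated_spread k' C' t" for t
    using k' by (intro fam_diam_cong) (simp add: translate_def)
  then have c': "ensemble_concentrates lam \<delta> C' (translate k'' \<theta>)"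
    using C(2) by (simp add: concentrating_def ensemble_concentrates_def)
  have "ensemble_concentrates lam \<delta> (C \<union> C') (translate k'' \<theta>)"
    using C by (intro inertial_kuramoto.union_concentrates[OF inertial_kuramoto_translate lam l B gap A_card _ _ _ _ c c']) (auto simp: concentrating_def)
  then show "concentrating (C \<union> C') k''"
    using C by (auto simp: concentrating_def k''_def)
qed

text \<open>The union of the two sets concentrates, too.  If \<^term>\<open>C'\<close> were not contained in
  \<^term>\<open>C\<close>, this would bring a member of \<^term>\<open>C'\<close> outside \<^term>\<open>C\<close> closer to \<^term>\<open>C\<close> than separation permits.\<close>

lemma maximal_ensemble_contains:
  assumes C: "A \<subseteq> C" "C \<subseteq> B" "maximal_ensemble lam \<delta> A B \<theta> C k" and C': "concentrating C' k'"
  shows "C' \<subseteq> C"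
proof
  fix i assume i: "i \<in> C'"
  show "i \<in> C"
  proof (rule ccontr)
    assume nC: "i \<notin> C"
    have iB: "i \<in> B" using C' i by (auto simp: concentrating_def)
    then have ne: "C \<noteq> B" using nC by blast
    have conc: "concentrating C k" using C by (auto simp: concentrating_def maximal_ensemble_def)
    define k'' where "k'' = (\<lambda>i. if i \<in> C then k i else k' i)"
    note union = concentrating_union[OF conc C', folded k''_def]
    have \<phi>12: "\<phi>1 < \<phi>2" using roots(2,3) by simp
    define c where "c = (\<phi>1 + \<phi>2) / 2"
    let ?inf = "\<lambda>t. INF (i, n)\<in>(B - C) \<times> (UNIV :: int set).
        ereal (outsider_spread k C i n t)"
    have c: "\<phi>1 < c" "c < \<phi>2" using \<phi>12 by (auto simp: c_def)
    have "\<forall>\<^sub>F t in at_top. translated_spread k'' (C \<union> C') t \<le> c"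
      using union(1) c(1) unfolding concentrating_def ensemble_concentrates_iff by blast
    moreover have fin: "finite (C \<union> C')" using C C' finite_B finite_subset by (auto simp: concentrating_def)
    have "k i = 0" using C nC by (auto simp: maximal_ensemble_def)
    then have sub: "insert (translate k \<theta> i t - 2 * pi * real_of_int (k' i)) ((\<lambda>j. translate k \<theta> j t) ` C)
        \<subseteq> (\<lambda>j. translate k'' \<theta> j t) ` (C \<union> C')" for t
    proof -
      have "translate k \<theta> i t - 2 * pi * real_of_int (k' i) = translate k'' \<theta> i t"
        using \<open>k i = 0\<close> nC by (simp add: translate_def k''_def)
      moreover have "translate k \<theta> j t = translate k'' \<theta> j t" if "j \<in> C" for j
        using that by (simp add: translate_def k''_def)
      ultimately show ?thesis using i by auto
    qed
    ultimately have "\<forall>\<^sub>F t in at_top. ?inf t \<le> ereal c"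
    proof (elim eventually_mono)
      fix t assume t: "translated_spread k'' (C \<union> C') t \<le> c"
      have "outsider_spread k C i (k' i) t
          \<le> translated_spread k'' (C \<union> C') t"
        using sub fin by (intro diameter_subset finite_imp_bounded) auto
      then have "ereal (outsider_spread k C i (k' i) t) \<le> ereal c"
        using t by simp
      then show "?inf t \<le> ereal c"
        using iB nC by (intro INF_lower2[of "(i, k' i)"]) auto
    qed
    then have "Liminf at_top ?inf \<le> ereal c"
      by (intro order_trans[OF Liminf_le_Limsup Limsup_bounded]) auto
    moreover have "ereal \<phi>2 \<le> Liminf at_top ?inf"
      using C(3) ne unfolding maximal_ensemble_def ensemble_separated_def by blast
    ultimately have "ereal \<phi>2 \<le> ereal c" by (rule order_trans[rotated])
    then show False using c(2) by simp
  qed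
qed

lemma unique_maximal_ensemble:
  "\<exists>!C. A \<subseteq> C \<and> C \<subseteq> B \<and> (\<exists>k. maximal_ensemble lam \<delta> A B \<theta> C k)"
proof -
  define F where "F = {C. \<exists>k. concentrating C k}"
  have "finite F" using finite_B by (rule finite_subset[rotated, OF finite_Pow_iff[THEN iffD2]]) (auto simp: F_def concentrating_def)
  moreover have "A \<in> F"
    unfolding F_def concentrating_def using A_concentrates A_B
    by (auto intro!: exI[of _ "\<lambda>_. 0"] simp: translate_zero)
  ultimately obtain C where C: "C \<in> F" "\<And>C'. C' \<in> F \<Longrightarrow> C \<subseteq> C' \<Longrightarrow> C = C'"
    using finite_has_maximal[of F] by blast
  then obtain k where k: "concentrating C k" by (auto simp: F_def)
  have "ensemble_separated lam \<delta> B C (translate k \<theta>)"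
    using C(2) by (intro maximal_concentrating_separated[OF k]) (auto simp: F_def)
  then have max: "maximal_ensemble lam \<delta> A B \<theta> C k"
    using k by (auto simp: maximal_ensemble_def concentrating_def)
  show ?thesis
  proof (rule ex1I[of _ C])
    show "A \<subseteq> C \<and> C \<subseteq> B \<and> (\<exists>k. maximal_ensemble lam \<delta> A B \<theta> C k)"
      using max k by (auto simp: concentrating_def)
    fix C' assume C': "A \<subseteq> C' \<and> C' \<subseteq> B \<and> (\<exists>k. maximal_ensemble lam \<delta> A B \<theta> C' k)"
    then obtain k' where k': "maximal_ensemble lam \<delta> A B \<theta> C' k'" by blast
    then have "concentrating C' k'" using C' by (auto simp: maximal_ensemble_def concentrating_def)
    then have "C' \<subseteq> C" using maximal_ensemble_contains[OF _ _ max] k by (auto simp: concentrating_def)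
    moreover have "C \<subseteq> C'" using maximal_ensemble_contains[OF _ _ k' k] C' by blast
    ultimately show "C' = C" by blast
  qed
qed

lemma phase_differences:
  assumes thr: "\<delta> < delta_threshold lam" and C: "A \<subseteq> C" "C \<subseteq> B"
    and conc: "ensemble_concentrates lam \<delta> C (translate k \<theta>)"
  shows "phase_difference_bounds lam \<kappa> \<nu> \<phi>1 C (translate k \<theta>)"
  by (rule inertial_kuramoto.phase_differences_of_concentrated_cluster[OF inertial_kuramoto_translate
      lam l B gap subset_trans[OF C(2) B] card_ge[OF C] conc thr])

end


section \<open>The asymptotic behaviour\<close>

theorem corollary4p1:
  fixes N :: nat and m \<kappa> lam ell \<eta> :: real
    and \<nu> \<theta>0 \<omega>0 :: "nat \<Rightarrow> real"
    and \<theta> \<omega> :: "nat \<Rightarrow> real \<Rightarrow> real"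
    and A :: "nat set"
  assumes N: "N \<ge> 1" and m: "m > 0" and kappa: "\<kappa> > 0"
    and solution: "kuramoto_solution N m \<kappa> \<nu> \<theta>0 \<omega>0 \<theta> \<omega>"
    and lam: "1 / 2 < lam" "lam \<le> 1"
    and ell: "0 < ell" "ell < 2 * arccos (1 / lam - 1)"
    and eta: "\<eta> > 0"
    and A_subset: "A \<subseteq> {1..N}" and A_card: "real (card A) \<ge> lam * real N"
    and xi_bound: "xi m \<kappa> \<nu> \<omega>0 A \<eta> < lam / 2 * sin ell - (1 - lam) * sin (ell / 2)"
    and initial: "fam_diam A \<theta>0 \<le>
      ell - m * (1 - exp (- \<eta>)) * fam_diam A \<omega>0
          - (\<eta> * m - m + m * exp (- \<eta>)) * (fam_diam A \<nu> + 2 * \<kappa>)"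
  shows
    "((SUP t\<in>{\<eta> * m..}. ereal (fam_diam A (\<lambda>i. \<theta> i t))) \<le> ereal ell \<and>
      Limsup at_top (\<lambda>t. ereal (fam_diam A (\<lambda>i. \<theta> i t)))
        \<le> ereal (phi1 lam (delta m \<kappa> \<nu> A)) \<and>
      phi1 lam (delta m \<kappa> \<nu> A) < 3 * pi / (4 * (2 * lam - 1)) * delta m \<kappa> \<nu> A) \<and>
    (delta m \<kappa> \<nu> A < delta_threshold lam \<longrightarrow>
      phase_difference_bounds lam \<kappa> \<nu> (phi1 lam (delta m \<kappa> \<nu> A)) A \<theta>) \<and>
    (\<forall>B. B \<subseteq> {1..N} \<and> A \<subseteq> B \<and>
        m * fam_diam B \<nu> + 2 * m * \<kappa> + fam_diam B \<nu> / (2 * \<kappa>)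
          < lam / 2 * sin ell - (1 - lam) * sin (ell / 2) \<longrightarrow>
      (SUP t\<in>{0..}. ereal (fam_diam B (\<lambda>i. \<theta> i t))) < \<infinity> \<and>
      (B = {1..N} \<longrightarrow> asymptotic_phase_locking N \<theta>) \<and>
      (\<exists>!C. A \<subseteq> C \<and> C \<subseteq> B \<and> (\<exists>k. maximal_ensemble lam (delta m \<kappa> \<nu> B) A B \<theta> C k)) \<and>
      (delta m \<kappa> \<nu> B < delta_threshold lam \<longrightarrow>
        (\<forall>C k. A \<subseteq> C \<and> C \<subseteq> B \<and> maximal_ensemble lam (delta m \<kappa> \<nu> B) A B \<theta> C k \<longrightarrow>
          phase_difference_bounds lam \<kappa> \<nu> (phi1 lam (delta m \<kappa> \<nu> B)) C (translate k \<theta>))))"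
proof -
  interpret inertial_kuramoto N m \<kappa> \<nu> \<theta>0 \<omega>0 \<theta> \<omega>
    by unfold_locales (use N m kappa solution in auto)
  have ell': "ell < 2 * arccos ((1 - lam) / lam)"
    using ell(2) lam by (simp add: diff_divide_distrib)
  have f: "f_lam lam ell = 2 * (lam / 2 * sin ell - (1 - lam) * sin (ell / 2))"
    by (simp add: f_lam_def)
  have finA: "finite A" using A_subset finite_subset by blast
  have neA: "A \<noteq> {}" using A_card lam N by (auto simp: mult_le_0_iff)
  have xi: "2 * xi m \<kappa> \<nu> \<omega>0 A \<eta> < f_lam lam ell" using xi_bound f by simp
  have "delta m \<kappa> \<nu> A \<le> 2 * xi m \<kappa> \<nu> \<omega>0 A \<eta>"
  proof -
    have "0 \<le> fam_diam A \<omega>0 * m * max 1 \<eta> * exp (- max 1 \<eta>)"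
      "0 \<le> fam_diam A \<omega>0 / (2 * \<kappa>) * (exp (- \<eta>) / (1 - exp (- \<eta>)))"
      using fam_diam_nonneg[OF finA] m kappa eta by (auto intro!: mult_nonneg_nonneg divide_nonneg_nonneg)
    moreover have "2 * xi m \<kappa> \<nu> \<omega>0 A \<eta> = delta m \<kappa> \<nu> A
        + 2 * (fam_diam A \<omega>0 * m * max 1 \<eta> * exp (- max 1 \<eta>))
        + 2 * (fam_diam A \<omega>0 / (2 * \<kappa>) * (exp (- \<eta>) / (1 - exp (- \<eta>))))"
      by (simp add: delta_def xi_def)
    ultimately show ?thesis by linarith
  qed
  then have dA: "delta m \<kappa> \<nu> A < f_lam lam ell" using xi by simp
  have ell_pi: "ell \<le> pi"
    using ell' arccos_le_pi2[of "(1 - lam) / lam"] lam by simp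
  have stays: "fam_diam A (\<lambda>i. \<theta> i t) \<le> ell" if t: "t \<ge> \<eta> * m" for t
  proof (rule cluster_contracts(1)[OF A_subset order_refl A_card, where T = "\<eta> * m" and a = ell
        and e = "f_lam lam ell - 2 * xi m \<kappa> \<nu> \<omega>0 A \<eta>"])
    show "fam_diam A (\<lambda>k. \<theta> k (\<eta> * m)) \<le> ell"
      by (rule initial_diameter_bound[OF A_subset neA eta initial])
    fix t x assume t: "\<eta> * m \<le> t" and x: "ell \<le> x" "x \<le> ell"
    then have "x = ell" by simp
    then show "delta m \<kappa> \<nu> A + transient A t + (f_lam lam ell - 2 * xi m \<kappa> \<nu> \<omega>0 A \<eta>) \<le> f_lam lam x"
      using delta_transient_le_xi[OF A_subset eta t] by simp
  qed (use lam eta m xi ell_pi t in auto)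
  then have enters: "\<forall>\<^sub>F t in at_top. fam_diam A (\<lambda>i. \<theta> i t) \<le> ell"
    unfolding eventually_at_top_linorder by blast
  have trapping: "trapping_ensemble N m \<kappa> \<nu> \<theta>0 \<omega>0 \<theta> \<omega> lam ell A B"
    if "A \<subseteq> B" "B \<subseteq> {1..N}" "delta m \<kappa> \<nu> B < f_lam lam ell" for B
    by unfold_locales (use that lam ell(1) ell' A_card enters in auto)
  interpret AA: trapping_ensemble N m \<kappa> \<nu> \<theta>0 \<omega>0 \<theta> \<omega> lam ell A A
    by (rule trapping[OF order_refl A_subset dA])
  have part1: "(SUP t\<in>{\<eta> * m..}. ereal (fam_diam A (\<lambda>i. \<theta> i t))) \<le> ereal ell"
    using stays by (intro SUP_least) auto
  have part1': "Limsup at_top (\<lambda>t. ereal (fam_diam A (\<lambda>i. \<theta> i t))) \<le> ereal (phi1 lam (delta m \<kappa> \<nu> A))"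
    using AA.A_concentrates unfolding ensemble_concentrates_def .
  have part1'': "phi1 lam (delta m \<kappa> \<nu> A) < 3 * pi / (4 * (2 * lam - 1)) * delta m \<kappa> \<nu> A"
    by (rule phi1_linear_bound[OF lam ell(1) ell' delta_pos(2)[OF A_subset] dA])
  have part2: "phase_difference_bounds lam \<kappa> \<nu> (phi1 lam (delta m \<kappa> \<nu> A)) A \<theta>"
    if "delta m \<kappa> \<nu> A < delta_threshold lam"
    using AA.phase_differences[OF that, of A "\<lambda>_. 0"] AA.A_concentrates
    by (simp add: AA.translate_zero)
  have AB: "trapping_ensemble N m \<kappa> \<nu> \<theta>0 \<omega>0 \<theta> \<omega> lam ell A B"
    if "B \<subseteq> {1..N}" "A \<subseteq> B" "m * fam_diam B \<nu> + 2 * m * \<kappa> + fam_diam B \<nu> / (2 * \<kappa>)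
      < lam / 2 * sin ell - (1 - lam) * sin (ell / 2)" for B
  proof -
    have "delta m \<kappa> \<nu> B = 2 * (m * fam_diam B \<nu> + 2 * m * \<kappa> + fam_diam B \<nu> / (2 * \<kappa>))"
      by (simp add: delta_def)
    then show ?thesis using that f by (intro trapping) auto
  qed
  have concentrates: "ensemble_concentrates lam d C (translate k \<theta>)"
    if "maximal_ensemble lam d A B \<theta> C k" for d B C k
    using that by (simp add: maximal_ensemble_def)
  show ?thesis
    by (intro conjI impI allI part1 part1' part1'' part2
        trapping_ensemble.sup_diameter_finite[OF AB] trapping_ensemble.phase_locking_of_full_ensemble[OF AB]
        trapping_ensemble.unique_maximal_ensemble[OF AB]
        trapping_ensemble.phase_differences[OF AB _ _ _ concentrates]; (elim conjE)?; assumption)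
qed

end
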